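(* Let $\alpha>0$, let $g$ be a real non-negative smooth function on $\mathbb{T}$ with $\int_0^{2\pi}g(x)\,dx=1$ as described in the context, and let $s\ge 0$ be given. There exist positive constants $M=M(\alpha,g,s)$ and $\gamma=\gamma(g)$ such that for any $u_0\in H^s_p(\mathbb{T})$ the unique solution $u\in C([0,\infty);H^s_p(\mathbb{T}))$ of the closed-loop system $$\partial_t u-\alpha\mathcal{H}\partial_x^2u-\partial_x^3u=-GG^*u,\quad t>0,\ x\in\mathbb{T},\qquad u(x,0)=u_0(x),\ x\in\mathbb{T},$$ satisfies $$\|u(\cdot,t)-[u_0]\|_{H^s_p(\mathbb{T})}\le M e^{-\gamma t}\|u_0-[u_0]\|_{H^s_p(\mathbb{T})}\qquad\text{for all } t\ge 0.$$
   Context: $\mathbb{T}=\mathbb{R}/(2\pi\mathbb{Z})$. For a periodic distribution $f$ on $\mathbb{T}$, $\widehat f(k)=\frac1{2\pi}\int_0^{2\pi}f(x)e^{-ikx}dx$ ($k\in\mathbb{Z}$), and $H^s_p(\mathbb{T})$ is the Hilbert space of periodic distributions with $\|f\|^2_{H^s_p(\mathbb{T})}=2\pi\sum_{k\in\mathbb{Z}}(1+|k|^2)^s|\widehat f(k)|^2<\infty$. $[f]=\frac1{2\pi}\int_0^{2\pi}f(x)\,dx$ is the mean value of $f$. $\mathcal{H}$ is the periodic Hilbert transform: $\widehat{\mathcal{H}f}(k)=-i\,\mathrm{sgn}(k)\widehat f(k)$, with $\mathrm{sgn}(0)=0$. The function $g$ is supported in $\omega$, where $\omega=\{x\in\mathbb{T}:g(x)>0\}$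 is an open interval. The operator $G$ is $G\varphi(x)=g(x)\bigl[\varphi(x)-\int_0^{2\pi}g(y)\varphi(y)\,dy\bigr]$, and $G^*$ is its adjoint in $L^2(\mathbb{T})$. Solutions are mild solutions: $u(t)=U(t)u_0-\int_0^tU(t-t')GG^*u(t')\,dt'$, where $\widehat{U(t)\varphi}(k)=e^{ik^2[\alpha\,\mathrm{sgn}(k)-k]t}\,\widehat\varphi(k)$. The arguments displayed in $M(\alpha,g,s)$ and $\gamma(g)$ are the quantities on which these constants depend. *)

theory Defs
  imports "HOL-Analysis.Analysis"
begin

(* Functions on the torus R / (2 pi Z) are 2 pi-periodic functions on the real line. *)

definition periodic :: "(real \<Rightarrow> 'a) \<Rightarrow> bool" where
  "periodic f \<longleftrightarrow> (\<forall>x. f (x + 2 * pi) = f x)"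

definition nderiv :: "nat \<Rightarrow> (real \<Rightarrow> 'a::real_normed_vector) \<Rightarrow> real \<Rightarrow> 'a" where
  "nderiv n f = ((\<lambda>h x. vector_derivative h (at x)) ^^ n) f"

definition smooth :: "(real \<Rightarrow> 'a::real_normed_vector) \<Rightarrow> bool" where
  "smooth f \<longleftrightarrow> (\<forall>n x. nderiv n f differentiable (at x))"

definition test_fun :: "(real \<Rightarrow> complex) \<Rightarrow> bool" where
  "test_fun \<phi> \<longleftrightarrow> smooth \<phi> \<and> periodic \<phi>"


section \<open>Periodic distributions\<close>

type_synonym functional = "(real \<Rightarrow> complex) \<Rightarrow> complex"

(* Continuous linear functionals on the Frechet space of test functions. The last conjunct
   fixes a junk value outside that space, so that HOL equality of functionals is equality of
   distributions. *)
definition periodic_distribution :: "functional \<Rightarrow> bool" where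
  "periodic_distribution T \<longleftrightarrow>
     (\<forall>\<phi> \<psi>. test_fun \<phi> \<longrightarrow> test_fun \<psi> \<longrightarrow> T (\<lambda>x. \<phi> x + \<psi> x) = T \<phi> + T \<psi>) \<and>
     (\<forall>c \<phi>. test_fun \<phi> \<longrightarrow> T (\<lambda>x. c * \<phi> x) = c * T \<phi>) \<and>
     (\<exists>C N. \<forall>\<phi>. test_fun \<phi> \<longrightarrow>
        cmod (T \<phi>) \<le> C * (\<Sum>n\<le>(N::nat). SUP x\<in>{0..2 * pi}. cmod (nderiv n \<phi> x))) \<and>
     (\<forall>\<phi>. \<not> test_fun \<phi> \<longrightarrow> T \<phi> = 0)"

definition distr_of :: "(real \<Rightarrow> complex) \<Rightarrow> functional" where
  "distr_of f = (\<lambda>\<phi>. if test_fun \<phi> then (LBINT x:{0..2 * pi}. f x * \<phi> x) else 0)"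

definition fcoeff :: "functional \<Rightarrow> int \<Rightarrow> complex" where
  "fcoeff T k = T (\<lambda>x. exp (- \<i> * of_int k * of_real x)) / (2 * pi)"

definition mean :: "functional \<Rightarrow> complex" where
  "mean T = T (\<lambda>x. 1) / (2 * pi)"

definition const_distr :: "complex \<Rightarrow> functional" where
  "const_distr c = distr_of (\<lambda>x. c)"

definition fourier_multiplier :: "(int \<Rightarrow> complex) \<Rightarrow> functional \<Rightarrow> functional" where
  "fourier_multiplier m T =
     (THE S. periodic_distribution S \<and> (\<forall>k. fcoeff S k = m k * fcoeff T k))"


section \<open>The spaces \<open>H\<^sup>s\<^sub>p\<close>\<close>

definition Hs :: "real \<Rightarrow> functional set" where
  "Hs s = {T. periodic_distribution T \<and>
     (\<lambda>k::int. (1 + \<bar>real_of_int k\<bar>\<^sup>2) powr s * (cmod (fcoeff T k))\<^sup>2) summable_on UNIV}"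

definition Hs_norm :: "real \<Rightarrow> functional \<Rightarrow> real" where
  "Hs_norm s T =
     sqrt (2 * pi * (\<Sum>\<^sub>\<infinity>k::int. (1 + \<bar>real_of_int k\<bar>\<^sup>2) powr s * (cmod (fcoeff T k))\<^sup>2))"

definition Hs_continuous :: "real \<Rightarrow> (real \<Rightarrow> functional) \<Rightarrow> bool" where
  "Hs_continuous s u \<longleftrightarrow>
     (\<forall>t\<ge>0. u t \<in> Hs s) \<and>
     (\<forall>t\<ge>0. ((\<lambda>r. Hs_norm s (u r - u t)) \<longlongrightarrow> 0) (at t within {0..}))"

(* The library's has_integral, unfolded, with the norm of H^s: the elements of H^s do not
   form a type of class real_normed_vector. For integrands that are continuous into H^s this
   is the Riemann (equivalently Bochner) integral. *)
definition has_Hs_integral :: "real \<Rightarrow> (real \<Rightarrow> functional) \<Rightarrow> functional \<Rightarrow> real \<Rightarrow> real \<Rightarrow> bool" where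
  "has_Hs_integral s F I a b \<longleftrightarrow>
     I \<in> Hs s \<and> (\<forall>t\<in>{a..b}. F t \<in> Hs s) \<and>
     (\<forall>e>0. \<exists>\<gamma>. gauge \<gamma> \<and>
        (\<forall>\<D>. \<D> tagged_division_of {a..b} \<and> \<gamma> fine \<D> \<longrightarrow>
           Hs_norm s (\<lambda>\<phi>. (\<Sum>(t,K)\<in>\<D>. measure lborel K *\<^sub>R F t \<phi>) - I \<phi>) < e))"


section \<open>The control operator\<close>

definition L2 :: "(real \<Rightarrow> complex) set" where
  "L2 = {f. periodic f \<and> f \<in> borel_measurable lborel \<and>
            set_integrable lborel {0..2 * pi} (\<lambda>x. (cmod (f x))\<^sup>2)}"

definition L2_inner :: "(real \<Rightarrow> complex) \<Rightarrow> (real \<Rightarrow> complex) \<Rightarrow> complex" where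
  "L2_inner f h = (LBINT x:{0..2 * pi}. f x * cnj (h x))"

(* Determined up to null sets, as are the elements of L^2. *)
definition L2_adjoint ::
    "((real \<Rightarrow> complex) \<Rightarrow> real \<Rightarrow> complex) \<Rightarrow> (real \<Rightarrow> complex) \<Rightarrow> real \<Rightarrow> complex" where
  "L2_adjoint A \<psi> = (SOME \<eta>. \<eta> \<in> L2 \<and> (\<forall>\<phi>\<in>L2. L2_inner (A \<phi>) \<psi> = L2_inner \<phi> \<eta>))"

definition G :: "(real \<Rightarrow> real) \<Rightarrow> (real \<Rightarrow> complex) \<Rightarrow> real \<Rightarrow> complex" where
  "G g \<phi> = (\<lambda>x. g x * (\<phi> x - (LBINT y:{0..2 * pi}. g y * \<phi> y)))"

(* The distribution induced by A f, where T is induced by f in L^2. Every element of H^s with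
   s >= 0 is of this kind, and f is unique up to null sets. *)
definition on_distr ::
    "((real \<Rightarrow> complex) \<Rightarrow> real \<Rightarrow> complex) \<Rightarrow> functional \<Rightarrow> functional" where
  "on_distr A T = distr_of (A (SOME f. f \<in> L2 \<and> T = distr_of f))"

definition GGstar :: "(real \<Rightarrow> real) \<Rightarrow> functional \<Rightarrow> functional" where
  "GGstar g = on_distr (\<lambda>f. G g (L2_adjoint (G g) f))"


section \<open>Mild solutions\<close>

definition U :: "real \<Rightarrow> real \<Rightarrow> functional \<Rightarrow> functional" where
  "U \<alpha> t = fourier_multiplier
     (\<lambda>k. exp (\<i> * of_real ((real_of_int k)\<^sup>2 * (\<alpha> * sgn (real_of_int k) - real_of_int k) * t)))"

(* Mild solutions, continuous into H^s on [0,oo), of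
     u_t - alpha H u_xx - u_xxx = - G G* u,   u(0) = u0.
   The multiplier in U is the exponential of t times the symbol of alpha H (d/dx)^2 + (d/dx)^3.
   The values u t for t < 0 are irrelevant. *)
definition mild_solution ::
    "real \<Rightarrow> (real \<Rightarrow> real) \<Rightarrow> real \<Rightarrow> functional \<Rightarrow> (real \<Rightarrow> functional) \<Rightarrow> bool" where
  "mild_solution \<alpha> g s u0 u \<longleftrightarrow>
     Hs_continuous s u \<and>
     (\<forall>t\<ge>0. \<exists>I. has_Hs_integral s (\<lambda>r. U \<alpha> (t - r) (GGstar g (u r))) I 0 t \<and>
                 u t = U \<alpha> t u0 - I)"

(* An arc of the torus, as a 2 pi-periodic subset of the real line. *)
definition open_arc :: "real set \<Rightarrow> bool" where
  "open_arc S \<longleftrightarrow> (\<exists>a b. a < b \<and> b \<le> a + 2 * pi \<and>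
     S = (\<Union>k::int. {a + 2 * pi * of_int k <..< b + 2 * pi * of_int k}))"

end

theory Submission
  imports Defs
begin

text \<open>In Fourier coefficients the equation is \<open>z\<^sub>k' = i \<lambda>\<^sub>k z\<^sub>k - (\<Sum>l. b\<^sub>k\<^sub>l z\<^sub>l)\<close>, where \<open>\<lambda>\<^sub>k = \<alpha> k \<bar>k\<bar> - k\<^sup>3\<close> and \<open>b\<close> is
the matrix of \<open>G G\<^sup>*\<close>. It decays rapidly off the diagonal because \<open>g\<close> is smooth, and its row and column \<open>0\<close> vanish,
so that the mean value is conserved and drops out. What is left is the decay of sequences with \<open>z\<^sub>0 = 0\<close>, at a rate
that depends neither on \<open>\<alpha>\<close> nor on \<open>s\<close>.

The energy \<open>\<bar>z\<bar>\<^sup>2\<close> loses \<open>2 \<langle>b z, z\<rangle>\<close> per unit of time, and this does not control \<open>\<bar>z\<bar>\<^sup>2\<close> because \<open>b\<close> does not see what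
happens where \<open>g\<close> vanishes. The proof adds a corrector to the energy and works with the Lyapunov functional
\<open>K \<bar>z\<bar>\<^sup>2 + \<langle>P z, z\<rangle>\<close>, where \<open>p\<^sub>k\<^sub>l = b\<^sub>k\<^sub>l (1 - \<tau>\<^sub>k\<^sub>l) / (i (\<lambda>\<^sub>l - \<lambda>\<^sub>k))\<close> and \<open>\<tau>\<^sub>k\<^sub>l = max 0 (1 - \<bar>\<lambda>\<^sub>k - \<lambda>\<^sub>l\<bar>)\<close>. Along the
free flow \<open>\<langle>P z, z\<rangle>\<close> has the derivative \<open>\<langle>b z, z\<rangle> - \<langle>q z, z\<rangle>\<close> with \<open>q\<^sub>k\<^sub>l = b\<^sub>k\<^sub>l \<tau>\<^sub>k\<^sub>l\<close>. The feedback adds terms of size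
\<open>\<bar>z\<bar> \<bar>b z\<bar>\<close>, which the dissipation absorbs since \<open>\<bar>b z\<bar>\<^sup>2 \<le> C \<langle>b z, z\<rangle>\<close>. As \<open>1 - \<tau>\<^sub>k\<^sub>l \<le> \<bar>\<lambda>\<^sub>k - \<lambda>\<^sub>l\<bar>\<close>, the entries of \<open>P\<close> are
no larger than those of \<open>b\<close>, for every \<open>\<alpha>\<close>.

The form \<open>q\<close> is coercive (\<open>near_part_coercive\<close>). Since \<open>\<tau>\<^sub>k\<^sub>l\<close> is the length of the overlap of the unit intervals around \<open>\<lambda>\<^sub>k\<close>
and \<open>\<lambda>\<^sub>l\<close>, the form \<open>\<langle>q z, z\<rangle>\<close> is the integral over \<open>\<omega>\<close> of \<open>\<langle>b z\<^sub>\<omega>, z\<^sub>\<omega>\<rangle>\<close>, where \<open>z\<^sub>\<omega>\<close> keeps the frequencies with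
\<open>\<bar>\<lambda>\<^sub>k - \<omega>\<bar> \<le> 1/2\<close>. At most six of them are nonzero, because the third divided difference of the cubic \<open>\<lambda>\<close> is \<open>-1\<close>
(\<open>dispersion_window_card\<close>). And a sum of boundedly many exponentials is controlled by its values on an interval on which
\<open>g\<close> is positive, uniformly in the frequencies (\<open>trig_sum_interval_lower_bound\<close>).

In \<open>H\<^sup>s\<close> the weight changes \<open>b\<close> by a commutator of order \<open>-1\<close>, which interpolation bounds by a small multiple of the
\<open>H\<^sup>s\<close> norm and a large multiple of the \<open>L\<^sup>2\<close> norm. The functional for \<open>H\<^sup>s\<close> plus a large multiple of the functional for
\<open>L\<^sup>2\<close> therefore decays at a rate that does not depend on \<open>s\<close> (\<open>trajectory_decay\<close>).

The rest connects the two descriptions. Undoing the free flow turns the mild equation into a linear equation with bounded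
coefficients, which gives existence and uniqueness. The Fourier series of a test function converges in the topology of
test functions (\<open>distribution_expansion\<close>), so that a periodic distribution is determined by its coefficients, and the
theorem of Riesz and Fischer provides the square-integrable representatives on which \<open>G G\<^sup>*\<close> is defined.\<close>

section \<open>The Hilbert space of square-summable sequences\<close>

text \<open>Each space \<open>H\<^sup>s\<close> will be identified with this one through its weighted Fourier coefficients. Having it as a type makes the
Henstock-Kurzweil integral and the calculus of Banach spaces available for \<open>H\<^sup>s\<close>.\<close>

typedef ell2 = "{f :: int \<Rightarrow> complex. (\<lambda>k. (cmod (f k))\<^sup>2) summable_on UNIV}"
  morphisms coord Abs_ell2
  by (rule exI[of _ "\<lambda>_. 0"]) simp

setup_lifting type_definition_ell2

lemma coord_summable: "(\<lambda>k. (cmod (coord x k))\<^sup>2) summable_on A"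
  using coord[of x] summable_on_subset_banach[of _ UNIV A] by auto

lemma coord_Abs_ell2:
  "(\<lambda>k. (cmod (f k))\<^sup>2) summable_on UNIV \<Longrightarrow> coord (Abs_ell2 f) = f"
  by (simp add: Abs_ell2_inverse)

lemma ell2_eqI: "(\<And>k. coord x k = coord y k) \<Longrightarrow> x = y"
  by (metis coord_inject ext)

lemma square_summable_add:
  fixes f g :: "'k \<Rightarrow> complex"
  assumes "(\<lambda>k. (cmod (f k))\<^sup>2) summable_on A" "(\<lambda>k. (cmod (g k))\<^sup>2) summable_on A"
  shows "(\<lambda>k. (cmod (f k + g k))\<^sup>2) summable_on A"
proof (rule summable_on_comparison_test[where f = "\<lambda>k. 2 * (cmod (f k))\<^sup>2 + 2 * (cmod (g k))\<^sup>2"])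
  show "(\<lambda>k. 2 * (cmod (f k))\<^sup>2 + 2 * (cmod (g k))\<^sup>2) summable_on A"
    using assms by (intro summable_on_add summable_on_cmult_right)
  fix k
  have "(cmod (f k + g k))\<^sup>2 \<le> (cmod (f k) + cmod (g k))\<^sup>2"
    by (intro power_mono norm_triangle_ineq) auto
  also have "\<dots> \<le> 2 * (cmod (f k))\<^sup>2 + 2 * (cmod (g k))\<^sup>2"
    using sum_squares_bound[of "cmod (f k)" "cmod (g k)"] by (simp add: power2_sum)
  finally show "(cmod (f k + g k))\<^sup>2 \<le> 2 * (cmod (f k))\<^sup>2 + 2 * (cmod (g k))\<^sup>2" .
qed auto

lemma square_summable_mult_bounded:
  fixes f m :: "'k \<Rightarrow> complex"
  assumes "(\<lambda>k. (cmod (f k))\<^sup>2) summable_on A" "\<And>k. cmod (m k) \<le> C"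
  shows "(\<lambda>k. (cmod (m k * f k))\<^sup>2) summable_on A"
proof (rule summable_on_comparison_test[where f = "\<lambda>k. C\<^sup>2 * (cmod (f k))\<^sup>2"])
  show "(\<lambda>k. C\<^sup>2 * (cmod (f k))\<^sup>2) summable_on A"
    using assms(1) by (intro summable_on_cmult_right)
  fix k show "(cmod (m k * f k))\<^sup>2 \<le> C\<^sup>2 * (cmod (f k))\<^sup>2"
    using assms(2)[of k] by (auto simp: norm_mult power_mult_distrib intro!: mult_right_mono power_mono)
qed auto

lemma complex_inner_abs_summable:
  fixes f g :: "'k \<Rightarrow> complex"
  assumes "(\<lambda>k. (cmod (f k))\<^sup>2) summable_on A" "(\<lambda>k. (cmod (g k))\<^sup>2) summable_on A"
  shows "(\<lambda>k. f k \<bullet> g k) summable_on A"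
proof -
  have "(\<lambda>k. norm (f k \<bullet> g k)) summable_on A"
  proof (rule summable_on_comparison_test[where f = "\<lambda>k. (cmod (f k))\<^sup>2 + (cmod (g k))\<^sup>2"])
    show "(\<lambda>k. (cmod (f k))\<^sup>2 + (cmod (g k))\<^sup>2) summable_on A"
      using assms by (intro summable_on_add)
    fix k
    have "norm (f k \<bullet> g k) \<le> cmod (f k) * cmod (g k)"
      using Cauchy_Schwarz_ineq2 by auto
    also have "\<dots> \<le> (cmod (f k))\<^sup>2 + (cmod (g k))\<^sup>2"
      using sum_squares_bound[of "cmod (f k)" "cmod (g k)"]
        mult_nonneg_nonneg[OF norm_ge_zero[of "f k"] norm_ge_zero[of "g k"]] by linarith
    finally show "norm (f k \<bullet> g k) \<le> (cmod (f k))\<^sup>2 + (cmod (g k))\<^sup>2" .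
  qed auto
  then show ?thesis by (rule abs_summable_summable)
qed

instantiation ell2 :: real_inner
begin

lift_definition zero_ell2 :: ell2 is "\<lambda>_. 0" by simp
lift_definition plus_ell2 :: "ell2 \<Rightarrow> ell2 \<Rightarrow> ell2" is "\<lambda>f g k. f k + g k"
  by (rule square_summable_add)
lift_definition uminus_ell2 :: "ell2 \<Rightarrow> ell2" is "\<lambda>f k. - f k" by simp
lift_definition minus_ell2 :: "ell2 \<Rightarrow> ell2 \<Rightarrow> ell2" is "\<lambda>f g k. f k - g k"
  using square_summable_add[where g = "\<lambda>k. - g k" for g] by force
lift_definition scaleR_ell2 :: "real \<Rightarrow> ell2 \<Rightarrow> ell2" is "\<lambda>c f k. c *\<^sub>R f k"
  using square_summable_mult_bounded[where m = "\<lambda>_. of_real c" and C = "\<bar>c\<bar>" for c]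
  by (force simp: scaleR_conv_of_real)
lift_definition inner_ell2 :: "ell2 \<Rightarrow> ell2 \<Rightarrow> real" is "\<lambda>f g. \<Sum>\<^sub>\<infinity>k. f k \<bullet> g k" .

definition norm_ell2 :: "ell2 \<Rightarrow> real" where "norm_ell2 x = sqrt (x \<bullet> x)"
definition dist_ell2 :: "ell2 \<Rightarrow> ell2 \<Rightarrow> real" where "dist_ell2 x y = norm (x - y)"
definition sgn_ell2 :: "ell2 \<Rightarrow> ell2" where "sgn_ell2 x = inverse (norm x) *\<^sub>R x"
definition uniformity_ell2 :: "(ell2 \<times> ell2) filter" where
  "uniformity_ell2 = (INF e\<in>{0 <..}. principal {(x, y). dist x y < e})"
definition open_ell2 :: "ell2 set \<Rightarrow> bool" where
  "open_ell2 S = (\<forall>x\<in>S. \<forall>\<^sub>F (x', y) in uniformity. x' = x \<longrightarrow> y \<in> S)"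

instance
proof
  fix x y z :: ell2 and a b :: real
  show "x + y + z = x + (y + z)" by transfer (simp add: add.assoc)
  show "x + y = y + x" by transfer (simp add: add.commute)
  show "0 + x = x" by transfer simp
  show "- x + x = 0" by transfer simp
  show "x - y = x + - y" by transfer simp
  show "a *\<^sub>R (x + y) = a *\<^sub>R x + a *\<^sub>R y" by transfer (simp add: scaleR_add_right)
  show "(a + b) *\<^sub>R x = a *\<^sub>R x + b *\<^sub>R x" by transfer (simp add: scaleR_add_left)
  show "a *\<^sub>R b *\<^sub>R x = (a * b) *\<^sub>R x" by transfer simp
  show "1 *\<^sub>R x = x" by transfer simp
  show "dist x y = norm (x - y)" by (rule dist_ell2_def)
  show "sgn x = inverse (norm x) *\<^sub>R x" by (rule sgn_ell2_def)
  show "(uniformity :: (ell2 \<times> ell2) filter) = (INF e\<in>{0 <..}. principal {(x, y). dist x y < e})"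
    by (rule uniformity_ell2_def)
  show "open S = (\<forall>x\<in>S. \<forall>\<^sub>F (x', y) in uniformity. x' = x \<longrightarrow> y \<in> S)" for S :: "ell2 set"
    by (rule open_ell2_def)
  show "x \<bullet> y = y \<bullet> x" by transfer (simp add: inner_commute)
  show "(x + y) \<bullet> z = x \<bullet> z + y \<bullet> z"
    by transfer (simp add: inner_add_left infsum_add complex_inner_abs_summable)
  show "a *\<^sub>R x \<bullet> y = a * (x \<bullet> y)"
    by transfer (simp add: infsum_cmult_right')
  show "0 \<le> x \<bullet> x" by transfer (simp add: infsum_nonneg)
  show "(x \<bullet> x = 0) = (x = 0)"
  proof
    assume *: "x \<bullet> x = 0"
    have "coord x k \<bullet> coord x k = 0" for k
      by (rule nonneg_infsum_le_0D[of _ UNIV])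
         (use * in \<open>auto simp: inner_ell2.rep_eq intro: complex_inner_abs_summable coord_summable\<close>)
    then show "x = 0" by (intro ell2_eqI) (simp add: zero_ell2.rep_eq)
  qed (transfer, simp)
  show "norm x = sqrt (x \<bullet> x)" by (rule norm_ell2_def)
qed

end

lemmas coord_simps [simp] =
  zero_ell2.rep_eq plus_ell2.rep_eq minus_ell2.rep_eq uminus_ell2.rep_eq scaleR_ell2.rep_eq

lemma norm_ell2_sq: "(norm x)\<^sup>2 = (\<Sum>\<^sub>\<infinity>k. (cmod (coord x k))\<^sup>2)" for x :: ell2
  by (simp add: power2_norm_eq_inner inner_ell2.rep_eq)

lemma ell2_finite_sum_le: "finite F \<Longrightarrow> (\<Sum>k\<in>F. (cmod (coord x k))\<^sup>2) \<le> (norm x)\<^sup>2"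
  unfolding norm_ell2_sq by (rule finite_sum_le_infsum) (auto intro: coord_summable)

lemma coord_le_norm: "cmod (coord x k) \<le> norm x"
  using ell2_finite_sum_le[of "{k}" x] by (simp add: power2_le_iff_abs_le)

lemma ell2_norm_leI:
  assumes "\<And>F. finite F \<Longrightarrow> (\<Sum>k\<in>F. (cmod (coord x k))\<^sup>2) \<le> c\<^sup>2" "0 \<le> c"
  shows "norm x \<le> c"
proof -
  have "(norm x)\<^sup>2 \<le> c\<^sup>2" unfolding norm_ell2_sq
    by (rule infsum_le_finite_sums) (auto intro: coord_summable assms)
  then show ?thesis using assms(2) by (simp add: power2_le_iff_abs_le)
qed

lemma square_summableI:
  fixes f :: "int \<Rightarrow> complex"
  assumes "\<And>F. finite F \<Longrightarrow> (\<Sum>k\<in>F. (cmod (f k))\<^sup>2) \<le> M"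
  shows "(\<lambda>k. (cmod (f k))\<^sup>2) summable_on UNIV"
  by (rule nonneg_bdd_above_summable_on) (auto intro!: bdd_aboveI2 assms)

lemma bounded_linear_coord: "bounded_linear (\<lambda>x. coord x k)"
  by (rule bounded_linear_intro[where K = 1]) (auto simp: coord_le_norm)

instance ell2 :: banach
proof
  fix X :: "nat \<Rightarrow> ell2"
  assume X: "Cauchy X"
  have "\<exists>l. (\<lambda>n. coord (X n) k) \<longlonglongrightarrow> l" for k
  proof -
    have "Cauchy (\<lambda>n. coord (X n) k)"
      by (rule bounded_linear.Cauchy[OF bounded_linear_coord X])
    then show ?thesis by (simp add: Cauchy_convergent_iff convergent_def)
  qed
  then obtain f where f: "\<And>k. (\<lambda>n. coord (X n) k) \<longlonglongrightarrow> f k" by metis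
  have tail: "\<exists>N. \<forall>n\<ge>N. \<forall>F. finite F \<longrightarrow> (\<Sum>k\<in>F. (cmod (coord (X n) k - f k))\<^sup>2) \<le> e\<^sup>2" if e: "e > 0" for e
  proof -
    obtain N where N: "\<And>m n. m \<ge> N \<Longrightarrow> n \<ge> N \<Longrightarrow> norm (X m - X n) < e"
      using X e unfolding Cauchy_def dist_norm by blast
    have "(\<Sum>k\<in>F. (cmod (coord (X n) k - f k))\<^sup>2) \<le> e\<^sup>2" if "n \<ge> N" "finite F" for n F
    proof (rule tendsto_upperbound)
      show "((\<lambda>m. \<Sum>k\<in>F. (cmod (coord (X n) k - coord (X m) k))\<^sup>2) \<longlongrightarrow>
              (\<Sum>k\<in>F. (cmod (coord (X n) k - f k))\<^sup>2)) sequentially"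
        by (intro tendsto_intros f)
      show "\<forall>\<^sub>F m in sequentially. (\<Sum>k\<in>F. (cmod (coord (X n) k - coord (X m) k))\<^sup>2) \<le> e\<^sup>2"
      proof (rule eventually_sequentiallyI[of N])
        fix m assume "N \<le> m"
        have "(\<Sum>k\<in>F. (cmod (coord (X n - X m) k))\<^sup>2) \<le> (norm (X n - X m))\<^sup>2"
          by (rule ell2_finite_sum_le[OF \<open>finite F\<close>])
        also have "\<dots> \<le> e\<^sup>2" using N[OF \<open>n \<ge> N\<close> \<open>N \<le> m\<close>] by (intro power_mono) auto
        finally show "(\<Sum>k\<in>F. (cmod (coord (X n) k - coord (X m) k))\<^sup>2) \<le> e\<^sup>2" by simp
      qed
    qed auto
    then show ?thesis by blast
  qed
  obtain N where "\<And>F. finite F \<Longrightarrow> (\<Sum>k\<in>F. (cmod (coord (X N) k - f k))\<^sup>2) \<le> 1\<^sup>2"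
    using tail[of 1] by auto
  then have "(\<lambda>k. (cmod (coord (X N) k - f k))\<^sup>2) summable_on UNIV" by (rule square_summableI)
  from square_summable_add[OF coord_summable this[unfolded norm_minus_commute[of "coord (X N) _"]], of "X N"]
  have fs: "(\<lambda>k. (cmod (f k))\<^sup>2) summable_on UNIV" by simp
  have "X \<longlonglongrightarrow> Abs_ell2 f"
  proof (rule LIMSEQ_I)
    fix r :: real assume "r > 0"
    then obtain N where N: "\<And>n F. n \<ge> N \<Longrightarrow> finite F \<Longrightarrow> (\<Sum>k\<in>F. (cmod (coord (X n) k - f k))\<^sup>2) \<le> (r/2)\<^sup>2"
      using tail[of "r/2"] by auto
    have "norm (X n - Abs_ell2 f) \<le> r/2" if "n \<ge> N" for n
      by (rule ell2_norm_leI) (use N[OF that] \<open>r > 0\<close> in \<open>auto simp: coord_Abs_ell2[OF fs]\<close>)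
    then show "\<exists>N. \<forall>n\<ge>N. norm (X n - Abs_ell2 f) < r"
      using \<open>r > 0\<close> by (intro exI[of _ N]) force
  qed
  then show "convergent X" by (rule convergentI)
qed

section \<open>Matrices with decay off the diagonal\<close>

definition bracket :: "int \<Rightarrow> real" where "bracket k = 1 + \<bar>real_of_int k\<bar>"

lemma bracket_ge1: "1 \<le> bracket k" by (simp add: bracket_def)
lemma bracket_pos [simp]: "0 < bracket k" by (simp add: bracket_def add_pos_nonneg)
lemma bracket_nonneg [simp]: "0 \<le> bracket k" by (simp add: bracket_def)
lemma bracket_minus [simp]: "bracket (- k) = bracket k" by (simp add: bracket_def)
lemma bracket_diff_commute: "bracket (k - l) = bracket (l - k)" by (simp add: bracket_def abs_minus_commute)

lemma bracket_triangle: "bracket (k + l) \<le> bracket k * bracket l"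
proof -
  have "\<bar>real_of_int k + real_of_int l\<bar> \<le> \<bar>real_of_int k\<bar> + \<bar>real_of_int l\<bar>" by simp
  moreover have "0 \<le> \<bar>real_of_int k\<bar> * \<bar>real_of_int l\<bar>" by simp
  ultimately show ?thesis unfolding bracket_def of_int_add by (simp only: distrib_left distrib_right mult_1_left mult_1_right)
qed

lemma int_summable_split:
  fixes f :: "int \<Rightarrow> real"
  assumes "summable (\<lambda>n. f (int n))" "summable (\<lambda>n. f (- int n))" "\<And>k. 0 \<le> f k"
  shows "f summable_on UNIV"
proof -
  have "f summable_on range int" 
    using assms by (subst summable_on_reindex) (auto simp: o_def summable_on_UNIV_nonneg_real_iff)
  moreover have "f summable_on range (\<lambda>n. - int n)" 
    using assms by (subst summable_on_reindex) (auto simp: o_def summable_on_UNIV_nonneg_real_iff inj_on_def)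
  moreover have "UNIV = range int \<union> range (\<lambda>n. - int n)"
    by (auto simp: image_iff) (metis int_cases2)
  moreover have "f summable_on (range (\<lambda>n. - int n) - range int)"
    using calculation(2) by (rule summable_on_subset_banach) auto
  ultimately show ?thesis using summable_on_Un_disjoint[of f "range int" "range (\<lambda>n. - int n) - range int"]
    by (simp add: Un_commute)
qed

lemma bracket_summable: "(\<lambda>k. 1 / (bracket k)\<^sup>2) summable_on UNIV"
proof -
  have "summable (\<lambda>n. 1 / (1 + real n)\<^sup>2)"
    using summable_Suc_iff[of "\<lambda>n. inverse ((real n)^2)"] inverse_power_summable[of 2, where 'a=real]
    by (simp add: field_simps)
  then show ?thesis by (intro int_summable_split) (auto simp: bracket_def)
qed

lemma bracket_summable_shift: "(\<lambda>l. 1 / (bracket (k - l))\<^sup>2) summable_on UNIV"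
  using bracket_summable summable_on_reindex_bij_betw[of "\<lambda>l. k - l" UNIV UNIV "\<lambda>k. 1 / (bracket k)\<^sup>2"]
  by (simp add: bij_diff)

definition bracket_sum :: real where "bracket_sum = (\<Sum>\<^sub>\<infinity>k. 1 / (bracket k)\<^sup>2)"

lemma bracket_sum_nonneg: "0 \<le> bracket_sum"
  unfolding bracket_sum_def by (rule infsum_nonneg) simp

lemma bracket_sum_finite_le:
  assumes "finite F"
  shows "(\<Sum>l\<in>F. 1 / (bracket (k - l))\<^sup>2) \<le> bracket_sum"
proof -
  have "(\<Sum>l\<in>F. 1 / (bracket (k - l))\<^sup>2) = (\<Sum>j\<in>(\<lambda>l. k - l) ` F. 1 / (bracket j)\<^sup>2)"
    by (subst sum.reindex) (auto simp: inj_on_def)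
  also have "\<dots> \<le> bracket_sum" unfolding bracket_sum_def
    by (rule finite_sum_le_infsum) (auto intro: bracket_summable assms)
  finally show ?thesis .
qed

text \<open>Decay of order two makes the absolute row and column sums converge, which is what Schur's test asks for.\<close>

definition offdiag :: "real \<Rightarrow> (int \<Rightarrow> int \<Rightarrow> complex) \<Rightarrow> bool" where
  "offdiag C m \<longleftrightarrow> 0 \<le> C \<and> (\<forall>k l. cmod (m k l) \<le> C / (bracket (k - l))\<^sup>2)"

lemma offdiagD: "offdiag C m \<Longrightarrow> cmod (m k l) \<le> C / (bracket (k - l))\<^sup>2"
  by (simp add: offdiag_def)

lemma offdiag_nonneg: "offdiag C m \<Longrightarrow> 0 \<le> C" by (simp add: offdiag_def)

definition mat_app :: "(int \<Rightarrow> int \<Rightarrow> complex) \<Rightarrow> ell2 \<Rightarrow> ell2" where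
  "mat_app m x = Abs_ell2 (\<lambda>k. \<Sum>\<^sub>\<infinity>l. m k l * coord x l)"

lemma offdiag_row_summable:
  assumes "offdiag C m"
  shows "(\<lambda>l. m k l * coord x l) summable_on UNIV"
proof -
  have "(\<lambda>l. norm (m k l * coord x l)) summable_on UNIV"
  proof (rule summable_on_comparison_test[where f = "\<lambda>l. (C * norm x) * (1 / (bracket (k - l))\<^sup>2)"])
    show "(\<lambda>l. (C * norm x) * (1 / (bracket (k - l))\<^sup>2)) summable_on UNIV"
      by (intro summable_on_cmult_right bracket_summable_shift)
    fix l
    have "norm (m k l * coord x l) \<le> C / (bracket (k - l))\<^sup>2 * norm x"
      unfolding norm_mult using offdiagD[OF assms] coord_le_norm offdiag_nonneg[OF assms]
      by (intro mult_mono) auto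
    then show "norm (m k l * coord x l) \<le> (C * norm x) * (1 / (bracket (k - l))\<^sup>2)" by simp
  qed auto
  then show ?thesis by (rule abs_summable_summable)
qed

text \<open>Schur's test: the Cauchy-Schwarz inequality with respect to the weight \<open>1 / \<langle>k - l\<rangle>\<^sup>2\<close> in each row, followed by summation
over the rows.\<close>

lemma schur_finite:
  assumes m: "offdiag C m" and F: "finite F" and L: "finite L"
  shows "(\<Sum>k\<in>F. (cmod (\<Sum>l\<in>L. m k l * coord x l))\<^sup>2) \<le> (C * bracket_sum * norm x)\<^sup>2"
proof -
  define w where "w = (\<lambda>k l. 1 / (bracket (k - l))\<^sup>2)"
  have w0: "0 \<le> w k l" for k l by (simp add: w_def)
  have C: "0 \<le> C" using m by (rule offdiag_nonneg)
  have row: "(cmod (\<Sum>l\<in>L. m k l * coord x l))\<^sup>2 \<le> C\<^sup>2 * bracket_sum * (\<Sum>l\<in>L. w k l * (cmod (coord x l))\<^sup>2)" for k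
  proof -
    have "cmod (\<Sum>l\<in>L. m k l * coord x l) \<le> (\<Sum>l\<in>L. (C * w k l) * cmod (coord x l))"
    proof (rule sum_norm_le)
      fix l
      have "cmod (m k l) \<le> C * w k l" using offdiagD[OF m] by (simp add: w_def)
      then show "norm (m k l * coord x l) \<le> C * w k l * cmod (coord x l)"
        by (simp add: norm_mult mult_right_mono)
    qed
    also have "\<dots> = C * (\<Sum>l\<in>L. sqrt (w k l) * (sqrt (w k l) * cmod (coord x l)))"
      using w0 by (simp add: sum_distrib_left mult.assoc[symmetric])
    finally have "(cmod (\<Sum>l\<in>L. m k l * coord x l))\<^sup>2 \<le> C\<^sup>2 * (\<Sum>l\<in>L. sqrt (w k l) * (sqrt (w k l) * cmod (coord x l)))\<^sup>2"
      using power_mono[OF _ norm_ge_zero, of "\<Sum>l\<in>L. m k l * coord x l" _ 2] by (metis power_mult_distrib)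
    also have "\<dots> \<le> C\<^sup>2 * ((\<Sum>l\<in>L. (sqrt (w k l))\<^sup>2) * (\<Sum>l\<in>L. (sqrt (w k l) * cmod (coord x l))\<^sup>2))"
      by (intro mult_left_mono Cauchy_Schwarz_ineq_sum) auto
    also have "\<dots> = C\<^sup>2 * ((\<Sum>l\<in>L. w k l) * (\<Sum>l\<in>L. w k l * (cmod (coord x l))\<^sup>2))"
      using w0 by (simp add: power_mult_distrib)
    also have "\<dots> \<le> C\<^sup>2 * (bracket_sum * (\<Sum>l\<in>L. w k l * (cmod (coord x l))\<^sup>2))"
      using bracket_sum_finite_le[OF L] w0
      by (intro mult_left_mono mult_right_mono sum_nonneg) (auto simp: w_def)
    finally show ?thesis by (simp add: mult.assoc)
  qed
  have "(\<Sum>k\<in>F. (cmod (\<Sum>l\<in>L. m k l * coord x l))\<^sup>2)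
        \<le> (\<Sum>k\<in>F. C\<^sup>2 * bracket_sum * (\<Sum>l\<in>L. w k l * (cmod (coord x l))\<^sup>2))"
    by (intro sum_mono row)
  also have "\<dots> = C\<^sup>2 * bracket_sum * (\<Sum>l\<in>L. (\<Sum>k\<in>F. w k l) * (cmod (coord x l))\<^sup>2)"
    by (simp add: sum_distrib_left[symmetric] sum_distrib_right sum.swap[of _ F L])
  also have "\<dots> \<le> C\<^sup>2 * bracket_sum * (\<Sum>l\<in>L. bracket_sum * (cmod (coord x l))\<^sup>2)"
    using bracket_sum_finite_le[OF F] bracket_sum_nonneg
    by (intro mult_left_mono sum_mono mult_right_mono) (auto simp: w_def bracket_diff_commute)
  also have "\<dots> = C\<^sup>2 * bracket_sum\<^sup>2 * (\<Sum>l\<in>L. (cmod (coord x l))\<^sup>2)"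
    by (simp add: sum_distrib_left[symmetric] power2_eq_square)
  also have "\<dots> \<le> C\<^sup>2 * bracket_sum\<^sup>2 * (norm x)\<^sup>2"
    by (intro mult_left_mono ell2_finite_sum_le[OF L]) auto
  finally show ?thesis by (simp add: power_mult_distrib)
qed

lemma schur_infinite:
  assumes m: "offdiag C m" and F: "finite F"
  shows "(\<Sum>k\<in>F. (cmod (\<Sum>\<^sub>\<infinity>l. m k l * coord x l))\<^sup>2) \<le> (C * bracket_sum * norm x)\<^sup>2"
proof (rule tendsto_upperbound)
  show "((\<lambda>L. \<Sum>k\<in>F. (cmod (\<Sum>l\<in>L. m k l * coord x l))\<^sup>2) \<longlongrightarrow>
      (\<Sum>k\<in>F. (cmod (\<Sum>\<^sub>\<infinity>l. m k l * coord x l))\<^sup>2)) (finite_subsets_at_top UNIV)"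
    by (intro tendsto_intros infsum_tendsto offdiag_row_summable[OF m])
  show "\<forall>\<^sub>F L in finite_subsets_at_top UNIV.
      (\<Sum>k\<in>F. (cmod (\<Sum>l\<in>L. m k l * coord x l))\<^sup>2) \<le> (C * bracket_sum * norm x)\<^sup>2"
    using schur_finite[OF m F] by (intro eventually_finite_subsets_at_top_weakI) auto
qed auto

lemma coord_mat_app:
  "offdiag C m \<Longrightarrow> coord (mat_app m x) k = (\<Sum>\<^sub>\<infinity>l. m k l * coord x l)"
  unfolding mat_app_def
  by (subst coord_Abs_ell2) (auto intro: square_summableI schur_infinite)

lemma mat_app_norm_le:
  assumes "offdiag C m"
  shows "norm (mat_app m x) \<le> C * bracket_sum * norm x"
  by (rule ell2_norm_leI)
     (use schur_infinite[OF assms] bracket_sum_nonneg offdiag_nonneg[OF assms] in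
      \<open>auto simp: coord_mat_app[OF assms]\<close>)

lemma bounded_linear_mat_app:
  assumes "offdiag C m"
  shows "bounded_linear (mat_app m)"
proof (rule bounded_linear_intro)
  note s = offdiag_row_summable[OF assms]
  show "mat_app m (x + y) = mat_app m x + mat_app m y" for x y
    by (rule ell2_eqI) (simp add: coord_mat_app[OF assms] distrib_left infsum_add s)
  show "mat_app m (r *\<^sub>R x) = r *\<^sub>R mat_app m x" for r x
    by (rule ell2_eqI) (simp add: coord_mat_app[OF assms] infsum_scaleR_right[symmetric])
  show "norm (mat_app m x) \<le> norm x * (C * bracket_sum)" for x
    using mat_app_norm_le[OF assms, of x] by (simp add: mult_ac)
qed

section \<open>Diagonal phases and truncation\<close>

lift_definition phase :: "(int \<Rightarrow> real) \<Rightarrow> ell2 \<Rightarrow> ell2" is "\<lambda>\<theta> f k. cis (\<theta> k) * f k"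
  by (simp add: norm_mult)

lift_definition trunc :: "int set \<Rightarrow> ell2 \<Rightarrow> ell2" is "\<lambda>S f k. if k \<in> S then f k else 0"
  by (erule summable_on_comparison_test) auto

declare phase.rep_eq [simp] trunc.rep_eq [simp]

lemma norm_phase [simp]: "norm (phase \<theta> x) = norm x"
proof -
  have "(norm (phase \<theta> x))\<^sup>2 = (norm x)\<^sup>2" by (simp add: norm_ell2_sq norm_mult)
  then show ?thesis by simp
qed

lemma phase_add [simp]: "phase \<theta> (x + y) = phase \<theta> x + phase \<theta> y"
  by (rule ell2_eqI) (simp add: distrib_left)

lemma phase_diff [simp]: "phase \<theta> (x - y) = phase \<theta> x - phase \<theta> y"
  by (rule ell2_eqI) (simp add: right_diff_distrib)

lemma phase_phase: "phase \<theta> (phase \<eta> x) = phase (\<lambda>k. \<theta> k + \<eta> k) x"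
  by (rule ell2_eqI) (simp add: cis_mult mult.assoc[symmetric])

lemma phase_zero [simp]: "phase (\<lambda>k. 0) x = x"
  by (rule ell2_eqI) simp

lemma bounded_linear_phase: "bounded_linear (phase \<theta>)"
  by (rule bounded_linear_intro[where K = 1]) (auto intro!: ell2_eqI)

lemma norm_trunc_le: "norm (trunc S x) \<le> norm x"
proof (rule power2_le_imp_le)
  show "(norm (trunc S x))\<^sup>2 \<le> (norm x)\<^sup>2"
    unfolding norm_ell2_sq using coord_summable[of "trunc S x"]
    by (intro infsum_mono coord_summable) auto
qed simp

lemma bounded_linear_trunc: "bounded_linear (trunc S)"
  by (rule bounded_linear_intro[where K = 1]) (auto intro!: ell2_eqI simp: norm_trunc_le)

lemma norm_finite_support:
  assumes "finite S" "\<And>k. k \<notin> S \<Longrightarrow> coord x k = 0"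
  shows "(norm x)\<^sup>2 = (\<Sum>k\<in>S. (cmod (coord x k))\<^sup>2)"
proof -
  have "(norm x)\<^sup>2 = (\<Sum>\<^sub>\<infinity>k\<in>S. (cmod (coord x k))\<^sup>2)"
    unfolding norm_ell2_sq by (rule infsum_cong_neutral) (use assms in auto)
  then show ?thesis using assms(1) by simp
qed

lemma inner_finite_support:
  assumes "finite S" "\<And>k. k \<notin> S \<Longrightarrow> coord x k = 0"
  shows "y \<bullet> x = (\<Sum>k\<in>S. coord y k \<bullet> coord x k)"
proof -
  have "y \<bullet> x = (\<Sum>\<^sub>\<infinity>k\<in>S. coord y k \<bullet> coord x k)"
    unfolding inner_ell2.rep_eq by (rule infsum_cong_neutral) (use assms in auto)
  then show ?thesis using assms(1) by simp
qed

lemma tendsto_finite_support: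
  fixes f :: "'a \<Rightarrow> ell2"
  assumes S: "finite S" and supp: "\<And>a k. k \<notin> S \<Longrightarrow> coord (f a) k = 0" "\<And>k. k \<notin> S \<Longrightarrow> coord l k = 0"
    and lim: "\<And>k. k \<in> S \<Longrightarrow> ((\<lambda>a. coord (f a) k) \<longlongrightarrow> coord l k) F"
  shows "(f \<longlongrightarrow> l) F"
proof -
  have "((\<lambda>a. \<Sum>k\<in>S. (cmod (coord (f a) k - coord l k))\<^sup>2) \<longlongrightarrow> (\<Sum>k\<in>S. (cmod (coord l k - coord l k))\<^sup>2)) F"
    by (intro tendsto_intros lim)
  moreover have "(\<Sum>k\<in>S. (cmod (coord (f a) k - coord l k))\<^sup>2) = (norm (f a - l))\<^sup>2" for a
    by (subst norm_finite_support[OF S]) (auto simp: supp)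
  ultimately have "((\<lambda>a. (norm (f a - l))\<^sup>2) \<longlongrightarrow> 0) F" by simp
  from tendsto_real_sqrt[OF this] have "((\<lambda>a. norm (f a - l)) \<longlongrightarrow> 0) F" by simp
  then show ?thesis using Lim_null[of f l F] tendsto_norm_zero_iff[of "\<lambda>a. f a - l" F] by simp
qed

lemma has_vector_derivative_finite_support:
  fixes f :: "real \<Rightarrow> ell2"
  assumes S: "finite S" and supp: "\<And>a k. k \<notin> S \<Longrightarrow> coord (f a) k = 0" "\<And>k. k \<notin> S \<Longrightarrow> coord d k = 0"
    and der: "\<And>k. k \<in> S \<Longrightarrow> ((\<lambda>a. coord (f a) k) has_vector_derivative coord d k) (at t)"
  shows "(f has_vector_derivative d) (at t)"
proof -
  have "((\<lambda>y. (f y - f t - (y - t) *\<^sub>R d) /\<^sub>R norm (y - t)) \<longlongrightarrow> 0) (at t)"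
  proof (rule tendsto_finite_support[OF S])
    fix k assume "k \<in> S"
    then show "((\<lambda>y. coord ((f y - f t - (y - t) *\<^sub>R d) /\<^sub>R norm (y - t)) k) \<longlongrightarrow> coord 0 k) (at t)"
      using der[of k] by (simp add: has_vector_derivative_def has_derivative_at_within divide_inverse_commute
          has_derivative_iff_norm[where s = UNIV] has_derivative_within diff_diff_eq divide_inverse)
  qed (auto simp: supp)
  then show ?thesis
    by (simp add: has_vector_derivative_def has_derivative_within bounded_linear_scaleR_left diff_diff_eq divide_inverse)
qed

lemma norm_sub_trunc_sq:
  assumes "finite S"
  shows "(norm (x - trunc S x))\<^sup>2 = (norm x)\<^sup>2 - (\<Sum>k\<in>S. (cmod (coord x k))\<^sup>2)"
proof -
  have "(norm (x - trunc S x))\<^sup>2 = (\<Sum>\<^sub>\<infinity>k\<in>UNIV - S. (cmod (coord x k))\<^sup>2)"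
    unfolding norm_ell2_sq by (rule infsum_cong_neutral) auto
  also have "\<dots> = (norm x)\<^sup>2 - (\<Sum>k\<in>S. (cmod (coord x k))\<^sup>2)"
    using assms by (subst infsum_Diff) (auto intro: coord_summable simp: norm_ell2_sq)
  finally show ?thesis .
qed

lemma trunc_tendsto: "((\<lambda>S. trunc S x) \<longlongrightarrow> x) (finite_subsets_at_top UNIV)"
proof -
  have "((\<lambda>S. (norm x)\<^sup>2 - (\<Sum>k\<in>S. (cmod (coord x k))\<^sup>2)) \<longlongrightarrow> (norm x)\<^sup>2 - (norm x)\<^sup>2) (finite_subsets_at_top UNIV)"
    by (intro tendsto_intros) (auto simp: norm_ell2_sq intro: infsum_tendsto coord_summable)
  moreover have "\<forall>\<^sub>F S in finite_subsets_at_top UNIV. (norm x)\<^sup>2 - (\<Sum>k\<in>S. (cmod (coord x k))\<^sup>2) = (norm (trunc S x - x))\<^sup>2"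
    by (rule eventually_finite_subsets_at_top_weakI) (metis norm_sub_trunc_sq norm_minus_commute)
  ultimately have "((\<lambda>S. (norm (trunc S x - x))\<^sup>2) \<longlongrightarrow> (norm x)\<^sup>2 - (norm x)\<^sup>2) (finite_subsets_at_top UNIV)"
    by (rule Lim_transform_eventually)
  then have "((\<lambda>S. (norm (trunc S x - x))\<^sup>2) \<longlongrightarrow> 0) (finite_subsets_at_top UNIV)"
    by (simp only: diff_self)
  from tendsto_real_sqrt[OF this] have "((\<lambda>S. norm (trunc S x - x)) \<longlongrightarrow> 0) (finite_subsets_at_top UNIV)" by simp
  then show ?thesis
    using Lim_null[of "\<lambda>S. trunc S x" x "finite_subsets_at_top UNIV"]
      tendsto_norm_zero_iff[of "\<lambda>S. trunc S x - x" "finite_subsets_at_top UNIV"] by simp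
qed

text \<open>The sets of vectors that a given truncation approximates are open and cover the compact set. The union of a finite
subcover works for all vectors at once, because larger truncations approximate better.\<close>

lemma trunc_uniform_on_compact:
  assumes K: "compact K" and e: "e > 0"
  obtains S where "finite S" "\<And>x. x \<in> K \<Longrightarrow> norm (x - trunc S x) < e"
proof -
  define V where "V = (\<lambda>S. {x. norm (x - trunc S x) < e})"
  have op: "open (V S)" for S unfolding V_def
    by (intro open_Collect_less continuous_intros bounded_linear.continuous_on[OF bounded_linear_trunc])
  have cov: "K \<subseteq> (\<Union>S\<in>Collect finite. V S)"
  proof
    fix x :: ell2
    have "\<forall>\<^sub>F S in finite_subsets_at_top UNIV. dist (trunc S x) x < e"
      using trunc_tendsto e by (rule tendstoD)
    then obtain S where "finite S" "dist (trunc S x) x < e"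
      unfolding eventually_finite_subsets_at_top by blast
    then show "x \<in> (\<Union>S\<in>Collect finite. V S)"
      by (auto simp: V_def dist_norm norm_minus_commute)
  qed
  obtain D where D: "D \<subseteq> Collect finite" "finite D" "K \<subseteq> (\<Union>S\<in>D. V S)"
    by (rule compactE_image[OF K _ cov]) (auto simp: op)
  have "norm (x - trunc (\<Union>D) x) < e" if "x \<in> K" for x
  proof -
    obtain S where S: "S \<in> D" "norm (x - trunc S x) < e" using D(3) \<open>x \<in> K\<close> by (auto simp: V_def)
    have "(norm (x - trunc (\<Union>D) x))\<^sup>2 \<le> (norm (x - trunc S x))\<^sup>2"
      using S(1) D by (subst (1 2) norm_sub_trunc_sq) (auto intro!: sum_mono2)
    then have "norm (x - trunc (\<Union>D) x) \<le> norm (x - trunc S x)" by (rule power2_le_imp_le) simp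
    then show ?thesis using S(2) by simp
  qed
  moreover have "finite (\<Union>D)" using D by auto
  ultimately show ?thesis using that by blast
qed

text \<open>The phases \<open>\<theta>\<close> may be unbounded, so the flow is continuous in time only when it is applied to a vector; on truncated
vectors this is a statement about finitely many coordinates.\<close>

lemma continuous_on_phase:
  assumes w: "continuous_on A w"
  shows "continuous_on A (\<lambda>t. phase (\<lambda>k. t * \<theta> k) (w t))"
proof -
  have fin: "((\<lambda>t. phase (\<lambda>k. t * \<theta> k) (trunc S x)) \<longlongrightarrow> phase (\<lambda>k. r * \<theta> k) (trunc S x)) (at r within A)"
    if "finite S" for S x r
    by (rule tendsto_finite_support[OF that]) (auto intro!: tendsto_intros isCont_tendsto_compose[where g = cis])
  show ?thesis unfolding continuous_on_def
  proof
    fix r assume r: "r \<in> A"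
    show "((\<lambda>t. phase (\<lambda>k. t * \<theta> k) (w t)) \<longlongrightarrow> phase (\<lambda>k. r * \<theta> k) (w r)) (at r within A)"
    proof (rule tendstoI)
      fix e :: real assume e: "e > 0"
      obtain S where S: "finite S" "norm (w r - trunc S (w r)) < e / 4"
        using trunc_uniform_on_compact[of "{w r}" "e/4"] e by auto
      have "\<forall>\<^sub>F t in at r within A. dist (w t) (w r) < e / 4"
        using w r e by (intro tendstoD) (auto simp: continuous_on_def)
      moreover have "\<forall>\<^sub>F t in at r within A.
          dist (phase (\<lambda>k. t * \<theta> k) (trunc S (w r))) (phase (\<lambda>k. r * \<theta> k) (trunc S (w r))) < e / 4"
        using e by (intro tendstoD fin S) auto
      ultimately show "\<forall>\<^sub>F t in at r within A. dist (phase (\<lambda>k. t * \<theta> k) (w t)) (phase (\<lambda>k. r * \<theta> k) (w r)) < e"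
      proof eventually_elim
        case (elim t)
        let ?U = "\<lambda>t. phase (\<lambda>k. t * \<theta> k)"
        have "?U t (w t) - ?U r (w r) = ?U t (w t - w r) + ?U t (w r - trunc S (w r))
            + (?U t (trunc S (w r)) - ?U r (trunc S (w r))) - ?U r (w r - trunc S (w r))" by simp
        also have "norm \<dots> \<le> norm (w t - w r) + norm (w r - trunc S (w r))
            + norm (?U t (trunc S (w r)) - ?U r (trunc S (w r))) + norm (w r - trunc S (w r))"
        proof -
          have tri: "norm (a + b + c - d) \<le> norm a + norm b + norm c + norm d" for a b c d :: ell2
            using norm_triangle_ineq4[of "a + b + c" d] norm_triangle_ineq[of "a + b" c] norm_triangle_ineq[of a b]
            by linarith
          show ?thesis
            using tri[of "?U t (w t - w r)" "?U t (w r - trunc S (w r))" "?U t (trunc S (w r)) - ?U r (trunc S (w r))"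
                "?U r (w r - trunc S (w r))"]
            by (simp only: norm_phase)
        qed
        also have "\<dots> < e" using elim S(2) by (simp add: dist_norm)
        finally show ?case by (simp add: dist_norm)
      qed
    qed
  qed
qed

section \<open>Linear evolution equations with bounded, strongly continuous coefficients\<close>

text \<open>The function \<open>(f x + b / a) e\<^bsup>- a x\<^esup>\<close> is nonincreasing. It is used with \<open>a > 0\<close> for uniqueness and with \<open>a < 0\<close> for decay.\<close>

lemma gronwall_affine:
  fixes f :: "real \<Rightarrow> real"
  assumes t: "0 \<le> t" and a: "a \<noteq> 0" and cont: "continuous_on {0..t} f"
    and der: "\<And>x. 0 < x \<Longrightarrow> x < t \<Longrightarrow> \<exists>y. (f has_real_derivative y) (at x) \<and> y \<le> a * f x + b"
  shows "f t + b / a \<le> (f 0 + b / a) * exp (a * t)"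
proof -
  define h where "h = (\<lambda>x. (f x + b / a) * exp (- (a * x)))"
  have "h t \<le> h 0"
  proof (rule DERIV_nonpos_imp_decreasing_open[OF t])
    fix x assume x: "0 < x" "x < t"
    then obtain y where y: "(f has_real_derivative y) (at x)" "y \<le> a * f x + b" using der by blast
    have "(h has_real_derivative (y - (a * f x + b)) * exp (- (a * x))) (at x)"
      unfolding h_def using a by (auto intro!: derivative_eq_intros y(1) simp: field_simps)
    then show "\<exists>y. (h has_real_derivative y) (at x) \<and> y \<le> 0"
      using y(2) by (intro exI[of _ "(y - (a * f x + b)) * exp (- (a * x))"]) (simp add: mult_nonpos_nonneg)
  next
    show "continuous_on {0..t} h" unfolding h_def by (intro continuous_intros cont)
  qed
  then have "h t * exp (a * t) \<le> h 0 * exp (a * t)" by (intro mult_right_mono) auto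
  then show ?thesis by (simp add: h_def mult.assoc flip: exp_add)
qed

lemma continuous_on_half_line:
  fixes f :: "real \<Rightarrow> 'a::metric_space"
  assumes "\<And>T. 0 \<le> T \<Longrightarrow> continuous_on {0..T} f"
  shows "continuous_on {0..} f"
  unfolding continuous_on_iff
proof (intro ballI allI impI)
  fix x e :: real assume x: "x \<in> {0..}" and "e > 0"
  then obtain d where d: "d > 0" "\<And>y. y \<in> {0..x+1} \<Longrightarrow> dist y x < d \<Longrightarrow> dist (f y) (f x) < e"
    using assms[of "x + 1"] unfolding continuous_on_iff by (metis atLeastAtMost_iff atLeast_iff add_increasing2 le_add_same_cancel1 zero_le_one)
  show "\<exists>d>0. \<forall>x'\<in>{0..}. dist x' x < d \<longrightarrow> dist (f x') (f x) < e"
    using d by (intro exI[of _ "min d 1"]) (auto simp: dist_real_def)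
qed

lemma integral_from_zero_continuous:
  fixes F :: "real \<Rightarrow> 'a::banach"
  assumes "continuous_on {0..} F"
  shows "continuous_on {0..} (\<lambda>t. integral {0..t} F)"
  by (rule continuous_on_half_line, rule indefinite_integral_continuous_1, rule integrable_continuous_real)
     (rule continuous_on_subset[OF assms], auto)

lemma integral_from_zero_derivative:
  fixes F :: "real \<Rightarrow> 'a::banach"
  assumes "continuous_on {0..} F" "0 < x"
  shows "((\<lambda>t. integral {0..t} F) has_vector_derivative F x) (at x)"
proof -
  have "((\<lambda>t. integral {0..t} F) has_vector_derivative F x) (at x within {0..x+1})"
    by (rule integral_has_vector_derivative) (use assms in \<open>auto intro: continuous_on_subset\<close>)
  moreover have "at x within {0..x+1} = at x" using assms(2) by (intro at_within_interior) auto
  ultimately show ?thesis by simp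
qed

text \<open>Picard iteration: the \<open>n\<close>-th iterate is bounded by \<open>\<bar>x0\<bar> (C t)\<^sup>n / n!\<close>. Continuity of the coefficients is assumed only along
continuous curves, since conjugation with an unbounded flow destroys continuity in the operator norm.\<close>

lemma linear_evolution_exists:
  fixes A :: "real \<Rightarrow> 'a::banach \<Rightarrow> 'a"
  assumes lin: "\<And>t. linear (A t)" and bd: "\<And>t x. norm (A t x) \<le> C * norm x"
    and cont: "\<And>w. continuous_on {0..} w \<Longrightarrow> continuous_on {0..} (\<lambda>t. A t (w t))"
  obtains v where "continuous_on {0..} v"
    "\<And>t. 0 \<le> t \<Longrightarrow> v t = x0 + integral {0..t} (\<lambda>r. A r (v r))"
proof -
  define C' where "C' = \<bar>C\<bar>"
  have bd': "norm (A t x) \<le> C' * norm x" "0 \<le> C'" for t x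
    using bd[of t x] mult_right_mono[of C "\<bar>C\<bar>" "norm x"] by (auto simp: C'_def intro: order_trans)
  define p where "p = rec_nat (\<lambda>t::real. x0) (\<lambda>_ q t. integral {0..t} (\<lambda>r. A r (q r)))"
  have p0: "p 0 = (\<lambda>t. x0)" and pS: "p (Suc n) = (\<lambda>t. integral {0..t} (\<lambda>r. A r (p n r)))" for n
    by (simp_all add: p_def)
  have pc: "continuous_on {0..} (p n)" for n
    by (induction n) (auto simp: p0 pS intro!: integral_from_zero_continuous cont)
  have int: "(\<lambda>r. A r (p n r)) integrable_on {0..t}" for n t
    by (rule integrable_continuous_real) (rule continuous_on_subset[OF cont[OF pc]], auto)
  have pb: "norm (p n t) \<le> norm x0 * (C' * t) ^ n / fact n" if "0 \<le> t" for n t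
    using that
  proof (induction n arbitrary: t)
    case (Suc n)
    let ?g = "\<lambda>r. norm x0 * C' ^ Suc n * r ^ n / fact n"
    have "((\<lambda>r. r ^ n) has_integral t ^ Suc n / (Suc n) - 0 ^ Suc n / (Suc n)) {0..t}"
      by (rule fundamental_theorem_of_calculus)
         (use Suc.prems in \<open>auto intro!: derivative_eq_intros simp: has_real_derivative_iff_has_vector_derivative[symmetric] simp del: power_Suc\<close>)
    from has_integral_mult_right[OF this, of "norm x0 * C' ^ Suc n / fact n"]
    have g: "(?g has_integral norm x0 * (C' * t) ^ Suc n / fact (Suc n)) {0..t}"
      by (simp add: field_simps power_mult_distrib)
    have "norm (integral {0..t} (\<lambda>r. A r (p n r))) \<le> integral {0..t} ?g"
    proof (rule integral_norm_bound_integral[OF int])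
      show "?g integrable_on {0..t}" using g by (rule has_integral_integrable)
      fix r assume r: "r \<in> {0..t}"
      have "norm (A r (p n r)) \<le> C' * norm (p n r)" by (rule bd')
      also have "\<dots> \<le> C' * (norm x0 * (C' * r) ^ n / fact n)"
        using r by (intro mult_left_mono Suc.IH bd') auto
      finally show "norm (A r (p n r)) \<le> ?g r" by (simp add: power_mult_distrib mult_ac)
    qed
    also have "\<dots> = norm x0 * (C' * t) ^ Suc n / fact (Suc n)" using g by (rule integral_unique)
    finally show ?case by (simp only: pS)
  qed (simp add: p0)
  define P where "P = (\<lambda>n t. \<Sum>i<n. p i t)"
  define v where "v = (\<lambda>t. \<Sum>i. p i t)"
  have ul: "uniform_limit {0..T} P v sequentially" if "0 \<le> T" for T
    unfolding P_def v_def
  proof (rule Weierstrass_m_test)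
    fix n t assume t: "t \<in> {0..T}"
    have "norm (p n t) \<le> norm x0 * (C' * t) ^ n / fact n" using t by (intro pb) auto
    also have "\<dots> \<le> norm x0 * (C' * T) ^ n / fact n"
      using t bd'(2) by (intro divide_right_mono mult_left_mono power_mono) auto
    finally show "norm (p n t) \<le> norm x0 * ((C' * T) ^ n / fact n)" by simp
  next
    show "summable (\<lambda>n. norm x0 * ((C' * T) ^ n / fact n))"
      using summable_exp[of "C' * T"] by (intro summable_mult) (simp add: field_simps)
  qed
  have Pc: "continuous_on {0..} (P n)" for n
    unfolding P_def by (intro continuous_on_sum pc)
  have vc: "continuous_on {0..} v"
    by (rule continuous_on_half_line, rule uniform_limit_theorem[OF _ ul])
       (auto intro!: always_eventually continuous_on_subset[OF Pc])
  have AP: "A r (P n r) = (\<Sum>i<n. A r (p i r))" for r n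
    unfolding P_def by (rule linear_sum[OF lin])
  have step: "P (Suc n) t = x0 + integral {0..t} (\<lambda>r. A r (P n r))" for n t
    unfolding AP by (simp add: P_def sum.lessThan_Suc_shift p0 pS integral_sum int del: sum.lessThan_Suc)
  have "v t = x0 + integral {0..t} (\<lambda>r. A r (v r))" if t: "0 \<le> t" for t
  proof -
    have u2: "uniform_limit {0..t} (\<lambda>n r. A r (P n r)) (\<lambda>r. A r (v r)) sequentially"
      unfolding uniform_limit_iff
    proof (intro allI impI)
      fix e :: real assume e: "e > 0"
      have "e / (C' + 1) > 0" using e bd'(2) by simp
      from uniform_limitD[OF ul[OF t] this]
      show "\<forall>\<^sub>F n in sequentially. \<forall>r\<in>{0..t}. dist (A r (P n r)) (A r (v r)) < e"
      proof eventually_elim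
        case (elim n)
        show ?case
        proof
          fix r assume "r \<in> {0..t}"
          then have *: "norm (P n r - v r) * (C' + 1) < e" 
            using elim bd'(2) by (simp add: dist_norm pos_less_divide_eq)
          have "dist (A r (P n r)) (A r (v r)) = norm (A r (P n r - v r))"
            by (simp add: dist_norm linear_diff[OF lin])
          also have "\<dots> \<le> C' * norm (P n r - v r)" by (rule bd')
          also have "\<dots> \<le> norm (P n r - v r) * (C' + 1)" by (simp add: algebra_simps)
          finally show "dist (A r (P n r)) (A r (v r)) < e" using * by simp
        qed
      qed
    qed
    obtain I J where IJ: "\<And>n. ((\<lambda>r. A r (P n r)) has_integral I n) {0..t}"
      "((\<lambda>r. A r (v r)) has_integral J) {0..t}" "I \<longlonglongrightarrow> J"
      by (rule uniform_limit_integral[OF u2]) (auto intro: continuous_on_subset[OF cont[OF Pc]])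
    have "(\<lambda>n. P (Suc n) t) \<longlonglongrightarrow> v t"
      using tendsto_uniform_limitI[OF ul[OF t], of t] t by (intro LIMSEQ_Suc) auto
    moreover have "(\<lambda>n. P (Suc n) t) \<longlonglongrightarrow> x0 + J"
      unfolding step integral_unique[OF IJ(1)] by (intro tendsto_intros IJ(3))
    ultimately have "v t = x0 + J" by (rule LIMSEQ_unique)
    then show ?thesis using IJ(2) by (simp add: integral_unique)
  qed
  then show ?thesis using that vc by blast
qed

lemma linear_evolution_unique:
  fixes w :: "real \<Rightarrow> 'a::{real_inner,banach}"
  assumes bd: "\<And>t x. norm (A t x) \<le> C * norm x"
    and wc: "continuous_on {0..} w" and Ac: "continuous_on {0..} (\<lambda>t. A t (w t))"
    and w: "\<And>t. 0 \<le> t \<Longrightarrow> w t = integral {0..t} (\<lambda>r. A r (w r))" and t: "0 \<le> t"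
  shows "w t = 0"
proof -
  define a where "a = 2 * (\<bar>C\<bar> + 1)"
  have "w t \<bullet> w t + 0 / a \<le> (w 0 \<bullet> w 0 + 0 / a) * exp (a * t)"
  proof (rule gronwall_affine[OF t])
    show "a \<noteq> 0" by (simp add: a_def)
    show "continuous_on {0..t} (\<lambda>t. w t \<bullet> w t)"
      by (intro continuous_intros continuous_on_subset[OF wc]) auto
    fix x assume x: "0 < x" "x < t"
    have "(w has_vector_derivative A x (w x)) (at x)"
    proof (rule has_vector_derivative_transform_within_open)
      show "((\<lambda>t. integral {0..t} (\<lambda>r. A r (w r))) has_vector_derivative A x (w x)) (at x)"
        by (rule integral_from_zero_derivative[OF Ac x(1)])
    qed (use x w in \<open>auto intro: open_greaterThan[of 0]\<close>)
    then have "((\<lambda>t. w t \<bullet> w t) has_real_derivative 2 * (w x \<bullet> A x (w x))) (at x)"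
      unfolding has_vector_derivative_def has_field_derivative_def
      by (auto intro!: derivative_eq_intros simp: inner_commute algebra_simps)
    moreover have "2 * (w x \<bullet> A x (w x)) \<le> a * (w x \<bullet> w x)"
    proof -
      have "w x \<bullet> A x (w x) \<le> norm (w x) * norm (A x (w x))" by (rule norm_cauchy_schwarz)
      also have "\<dots> \<le> norm (w x) * (C * norm (w x))" by (intro mult_left_mono bd) auto
      also have "\<dots> = C * (w x \<bullet> w x)" by (simp add: power2_norm_eq_inner[symmetric] power2_eq_square)
      also have "\<dots> \<le> (\<bar>C\<bar> + 1) * (w x \<bullet> w x)" by (intro mult_right_mono) auto
      finally show ?thesis unfolding a_def mult.assoc by linarith
    qed
    ultimately show "\<exists>y. ((\<lambda>t. w t \<bullet> w t) has_real_derivative y) (at x) \<and> y \<le> a * (w x \<bullet> w x) + 0" by auto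
  qed
  moreover have "w 0 = 0" using w[of 0] by simp
  ultimately have "w t \<bullet> w t \<le> 0" by simp
  then show ?thesis by (metis inner_eq_zero_iff inner_ge_zero order_antisym)
qed

section \<open>Sums of few exponentials on a short interval\<close>

text \<open>The quotient \<open>sin y / y\<close> attains its maximum on a compact interval, where it is less than \<open>1\<close>, and is at most \<open>1/2\<close> beyond it.\<close>

lemma sin_le_contraction:
  fixes \<eta> :: real
  assumes "\<eta> > 0"
  obtains \<rho> where "\<rho> < 1" "\<And>y. y \<ge> \<eta> \<Longrightarrow> sin y \<le> \<rho> * y"
proof -
  have "\<exists>y0\<in>{\<eta>..max \<eta> 2}. \<forall>y\<in>{\<eta>..max \<eta> 2}. sin y / y \<le> sin y0 / y0"
    by (rule continuous_attains_sup) (use assms in \<open>auto intro!: continuous_intros\<close>)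
  then obtain y0 where y0: "y0 \<ge> \<eta>" "\<And>y. y \<in> {\<eta>..max \<eta> 2} \<Longrightarrow> sin y / y \<le> sin y0 / y0" by auto
  have "sin y0 < y0"
  proof (cases "y0 \<le> 2")
    case True
    have "0 < sin (y0 / 2)" "cos (y0 / 2) < 1" "sin (y0 / 2) \<le> y0 / 2"
      using True y0(1) assms pi_gt3 cos_monotone_0_pi[of 0 "y0 / 2"] sin_x_le_x[of "y0 / 2"]
      by (auto intro!: sin_gt_zero)
    then have "sin (y0 / 2) * cos (y0 / 2) < sin (y0 / 2) * 1" by (intro mult_strict_left_mono) auto
    then show ?thesis using \<open>sin (y0 / 2) \<le> y0 / 2\<close> sin_double[of "y0 / 2"] by simp
  next
    case False
    then show ?thesis using sin_le_one[of y0] by linarith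
  qed
  then have lt: "sin y0 / y0 < 1" using y0(1) assms by simp
  show thesis
  proof (rule that[of "max (1/2) (sin y0 / y0)"])
    show "max (1/2) (sin y0 / y0) < 1" using lt by simp
    fix y :: real assume y: "y \<ge> \<eta>"
    show "sin y \<le> max (1/2) (sin y0 / y0) * y"
    proof (cases "y \<le> max \<eta> 2")
      case True
      then have "sin y / y \<le> max (1/2) (sin y0 / y0)" using y0(2)[of y] y by auto
      then show ?thesis using y assms by (simp add: divide_le_eq)
    next
      case False
      then have "sin y \<le> 1/2 * y" using sin_le_one[of y] by linarith
      also have "\<dots> \<le> max (1/2) (sin y0 / y0) * y" using y assms by (intro mult_right_mono) auto
      finally show ?thesis .
    qed
  qed
qed

text \<open>Averaging \<open>\<bar>e\<^bsup>i m h\<^esup> - 1\<bar>\<^sup>2\<close> over shifts \<open>h\<close> gives a bound that does not see the integer \<open>m \<noteq> 0\<close>.\<close>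

lemma shift_average_lower_bound:
  fixes \<eta> :: real
  assumes "\<eta> > 0"
  obtains \<kappa> where "\<kappa> > 0"
    "\<And>m::int. m \<noteq> 0 \<Longrightarrow> \<kappa> \<le> integral {0..\<eta>} (\<lambda>h. (cmod (cis (of_int m * h) - 1))\<^sup>2)"
proof -
  obtain \<rho> where \<rho>: "\<rho> < 1" "\<And>y. y \<ge> \<eta> \<Longrightarrow> sin y \<le> \<rho> * y" using sin_le_contraction[OF assms] by blast
  have "2 * (1 - \<rho>) * \<eta> \<le> integral {0..\<eta>} (\<lambda>h. (cmod (cis (of_int m * h) - 1))\<^sup>2)" if m: "m \<noteq> 0" for m :: int
  proof -
    have sq: "(cmod (cis y - 1))\<^sup>2 = 2 - 2 * cos y" for y
      by (simp add: cmod_power2 power2_diff)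
    have "((\<lambda>h. 2 - 2 * cos (of_int m * h)) has_integral
        (2 * \<eta> - 2 * sin (of_int m * \<eta>) / of_int m) - (2 * 0 - 2 * sin (of_int m * 0) / of_int m)) {0..\<eta>}"
      by (rule fundamental_theorem_of_calculus)
         (use assms m in \<open>auto intro!: derivative_eq_intros simp: has_real_derivative_iff_has_vector_derivative[symmetric]\<close>)
    then have I: "integral {0..\<eta>} (\<lambda>h. (cmod (cis (of_int m * h) - 1))\<^sup>2) = 2 * \<eta> - 2 * sin (of_int m * \<eta>) / of_int m"
      unfolding sq by (simp add: integral_unique)
    define M where "M = \<bar>real_of_int m\<bar>"
    have M: "M \<ge> 1" using m by (simp add: M_def)
    have "sin (of_int m * \<eta>) / of_int m = sin (M * \<eta>) / M"
      by (cases "m > 0") (auto simp: M_def abs_if)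
    also have "\<dots> \<le> \<rho> * \<eta>"
      using \<rho>(2)[of "M * \<eta>"] M assms by (simp add: pos_divide_le_eq mult_ac)
    finally show ?thesis unfolding I by (simp add: algebra_simps)
  qed
  then show thesis using that[of "2 * (1 - \<rho>) * \<eta>"] \<rho>(1) assms by simp
qed

definition trig_sum :: "int set \<Rightarrow> (int \<Rightarrow> complex) \<Rightarrow> real \<Rightarrow> complex" where
  "trig_sum S \<xi> x = (\<Sum>k\<in>S. \<xi> k * cis (of_int k * x))"

lemma continuous_on_trig_sum [continuous_intros]: "continuous_on A (trig_sum S \<xi>)"
  unfolding trig_sum_def by (intro continuous_intros)

lemma trig_sum_sq_integrable: "(\<lambda>x. (cmod (trig_sum S \<xi> x))\<^sup>2) integrable_on {a..b}"
  by (intro integrable_continuous_real continuous_intros)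

text \<open>Subtracting a shifted and demodulated copy removes the frequency \<open>k0\<close>.\<close>

lemma trig_sum_shift_difference:
  assumes "finite S" "k0 \<in> S"
  shows "trig_sum S \<xi> (x + h) * cis (- of_int k0 * h) - trig_sum S \<xi> x
    = trig_sum (S - {k0}) (\<lambda>k. \<xi> k * (cis (of_int (k - k0) * h) - 1)) x"
proof -
  have "trig_sum S \<xi> (x + h) * cis (- of_int k0 * h) - trig_sum S \<xi> x
     = trig_sum S (\<lambda>k. \<xi> k * (cis (of_int (k - k0) * h) - 1)) x"
    unfolding trig_sum_def sum_distrib_right sum_subtractf[symmetric]
  proof (rule sum.cong)
    fix k assume "k \<in> S"
    have "cis (of_int k * (x + h)) * cis (- of_int k0 * h) = cis (of_int (k - k0) * h) * cis (of_int k * x)"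
      unfolding cis_mult by (simp add: algebra_simps)
    then show "\<xi> k * cis (of_int k * (x + h)) * cis (- of_int k0 * h) - \<xi> k * cis (of_int k * x)
       = \<xi> k * (cis (of_int (k - k0) * h) - 1) * cis (of_int k * x)"
      by (simp add: algebra_simps)
  qed simp
  also have "\<dots> = trig_sum (S - {k0}) (\<lambda>k. \<xi> k * (cis (of_int (k - k0) * h) - 1)) x"
    unfolding trig_sum_def using assms by (subst sum.remove[of S k0]) auto
  finally show ?thesis .
qed

text \<open>The sum without the frequency \<open>k0\<close> is bounded on the shorter interval by the full sum on the longer one, for each shift
\<open>h\<close>; averaging over \<open>h\<close> replaces the factors \<open>e\<^bsup>i (k - k0) h\<^esup> - 1\<close> by the constant \<open>\<kappa>\<close>.\<close>

lemma trig_sum_drop_one: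
  assumes ab: "a < b" and \<eta>: "\<eta> = (b - a) / 2" and S: "finite S" "k0 \<in> S"
    and c: "c > 0" "\<And>\<xi>. c * (\<Sum>k\<in>S - {k0}. (cmod (\<xi> k))\<^sup>2) \<le> integral {a..b - \<eta>} (\<lambda>x. (cmod (trig_sum (S - {k0}) \<xi> x))\<^sup>2)"
    and \<kappa>: "\<And>m::int. m \<noteq> 0 \<Longrightarrow> \<kappa> \<le> integral {0..\<eta>} (\<lambda>h. (cmod (cis (of_int m * h) - 1))\<^sup>2)"
  shows "c * \<kappa> * (\<Sum>k\<in>S - {k0}. (cmod (\<xi> k))\<^sup>2) \<le> 4 * \<eta> * integral {a..b} (\<lambda>x. (cmod (trig_sum S \<xi> x))\<^sup>2)"
proof -
  define J where "J = integral {a..b} (\<lambda>x. (cmod (trig_sum S \<xi> x))\<^sup>2)"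
  let ?p = "\<lambda>x. (cmod (trig_sum S \<xi> x))\<^sup>2"
  have \<eta>0: "\<eta> > 0" using ab \<eta> by simp
  have one: "c * (\<Sum>k\<in>S - {k0}. (cmod (\<xi> k))\<^sup>2 * (cmod (cis (of_int (k - k0) * h) - 1))\<^sup>2) \<le> 4 * J"
    if h: "h \<in> {0..\<eta>}" for h
  proof -
    let ?\<zeta> = "\<lambda>k. \<xi> k * (cis (of_int (k - k0) * h) - 1)"
    have sub: "integral {c..d} ?p \<le> J" if "a \<le> c" "d \<le> b" for c d
      unfolding J_def by (rule integral_subset_le) (use that in \<open>auto intro!: trig_sum_sq_integrable\<close>)
    have sh: "integral {a..b - \<eta>} (\<lambda>x. ?p (x + h)) = integral {a + h..b - \<eta> + h} ?p"
      using integral_shift_Icc_real[of a "b - \<eta>" ?p h] by (simp add: o_def add.commute)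
    have shi: "(\<lambda>x. ?p (x + h)) integrable_on {a..b - \<eta>}"
      unfolding trig_sum_def by (intro integrable_continuous_real continuous_intros)
    have "c * (\<Sum>k\<in>S - {k0}. (cmod (?\<zeta> k))\<^sup>2) \<le> integral {a..b - \<eta>} (\<lambda>x. (cmod (trig_sum (S - {k0}) ?\<zeta> x))\<^sup>2)"
      by (rule c)
    also have "\<dots> \<le> integral {a..b - \<eta>} (\<lambda>x. 2 * ?p (x + h) + 2 * ?p x)"
    proof (rule integral_le)
      fix x
      have "cmod (trig_sum (S - {k0}) ?\<zeta> x) \<le> cmod (trig_sum S \<xi> (x + h)) + cmod (trig_sum S \<xi> x)"
        unfolding trig_sum_shift_difference[OF S, symmetric]
        by (rule order_trans[OF norm_triangle_ineq4]) (simp add: norm_mult)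
      then have "(cmod (trig_sum (S - {k0}) ?\<zeta> x))\<^sup>2 \<le> (cmod (trig_sum S \<xi> (x + h)) + cmod (trig_sum S \<xi> x))\<^sup>2"
        by (rule power_mono) simp
      also have "\<dots> \<le> 2 * ?p (x + h) + 2 * ?p x"
        using sum_squares_bound[of "cmod (trig_sum S \<xi> (x + h))" "cmod (trig_sum S \<xi> x)"] by (simp add: power2_sum)
      finally show "(cmod (trig_sum (S - {k0}) ?\<zeta> x))\<^sup>2 \<le> 2 * ?p (x + h) + 2 * ?p x" .
    qed (intro trig_sum_sq_integrable integrable_add integrable_on_mult_right shi)+
    also have "\<dots> = 2 * integral {a + h..b - \<eta> + h} ?p + 2 * integral {a..b - \<eta>} ?p"
      by (subst integral_add) (auto intro!: integrable_on_mult_right shi trig_sum_sq_integrable simp: sh)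
    also have "\<dots> \<le> 4 * J"
      using sub[of "a + h" "b - \<eta> + h"] sub[of a "b - \<eta>"] h \<eta>0 by auto
    finally show ?thesis by (simp add: norm_mult power_mult_distrib)
  qed
  let ?F = "\<lambda>k h. (cmod (\<xi> k))\<^sup>2 * (cmod (cis (of_int (k - k0) * h) - 1))\<^sup>2"
  have Fi: "?F k integrable_on {0..\<eta>}" for k
    by (intro integrable_continuous_real continuous_intros)
  have "c * \<kappa> * (\<Sum>k\<in>S - {k0}. (cmod (\<xi> k))\<^sup>2) = c * (\<Sum>k\<in>S - {k0}. (cmod (\<xi> k))\<^sup>2 * \<kappa>)"
    by (simp add: sum_distrib_left[symmetric] mult_ac)
  also have "\<dots> \<le> c * (\<Sum>k\<in>S - {k0}. integral {0..\<eta>} (?F k))"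
    using c(1) \<kappa> by (intro mult_left_mono sum_mono) (auto intro!: mult_left_mono simp del: of_int_diff)
  also have "\<dots> = integral {0..\<eta>} (\<lambda>h. c * (\<Sum>k\<in>S - {k0}. ?F k h))"
    using S Fi by (simp add: integral_sum)
  also have "\<dots> \<le> integral {0..\<eta>} (\<lambda>h. 4 * J)"
  proof (rule integral_le)
    show "(\<lambda>h. c * (\<Sum>k\<in>S - {k0}. ?F k h)) integrable_on {0..\<eta>}"
      using S(1) by (intro integrable_on_mult_right integrable_sum Fi) auto
  qed (use one in auto)
  also have "\<dots> = 4 * \<eta> * J" using \<eta>0 by simp
  finally show ?thesis by (simp add: J_def)
qed

text \<open>An inequality of Turan's type: the constant depends on the interval and on the number of frequencies, but not on the
frequencies. By induction, dropping one frequency bounds the coefficients of all others; doing so for two different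
frequencies bounds every coefficient.\<close>

lemma trig_sum_interval_lower_bound:
  fixes a b :: real
  assumes "a < b"
  shows "\<exists>c>0. \<forall>S \<xi>. finite S \<longrightarrow> card S \<le> n \<longrightarrow>
    c * (\<Sum>k\<in>S. (cmod (\<xi> k))\<^sup>2) \<le> integral {a..b} (\<lambda>x. (cmod (trig_sum S \<xi> x))\<^sup>2)"
  using assms
proof (induction n arbitrary: b)
  case 0
  show ?case by (intro exI[of _ 1]) (auto simp: trig_sum_def)
next
  case (Suc n)
  define \<eta> where "\<eta> = (b - a) / 2"
  have \<eta>0: "\<eta> > 0" and "a < b - \<eta>" using Suc.prems by (auto simp: \<eta>_def field_simps)
  from Suc.IH[OF this(2)] obtain c where c: "c > 0" "\<And>(S::int set) \<xi>. finite S \<Longrightarrow> card S \<le> n \<Longrightarrow>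
    c * (\<Sum>k\<in>S. (cmod (\<xi> k))\<^sup>2) \<le> integral {a..b - \<eta>} (\<lambda>x. (cmod (trig_sum S \<xi> x))\<^sup>2)" by blast
  obtain \<kappa> where \<kappa>: "\<kappa> > 0"
    "\<And>m::int. m \<noteq> 0 \<Longrightarrow> \<kappa> \<le> integral {0..\<eta>} (\<lambda>h. (cmod (cis (of_int m * h) - 1))\<^sup>2)"
    using shift_average_lower_bound[OF \<eta>0] by blast
  define c' where "c' = min (b - a) (c * \<kappa> / (8 * \<eta>))"
  show ?case
  proof (intro exI[of _ c'] conjI allI impI)
    show "c' > 0" using c(1) \<kappa>(1) \<eta>0 Suc.prems by (simp add: c'_def)
    fix S :: "int set" and \<xi> :: "int \<Rightarrow> complex"
    assume S: "finite S" "card S \<le> Suc n"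
    let ?J = "integral {a..b} (\<lambda>x. (cmod (trig_sum S \<xi> x))\<^sup>2)"
    have drop: "c * \<kappa> * (\<Sum>k\<in>S - {k0}. (cmod (\<xi> k))\<^sup>2) \<le> 4 * \<eta> * ?J" if "k0 \<in> S" for k0
      by (rule trig_sum_drop_one[OF Suc.prems \<eta>_def S(1) that c(1) c(2) \<kappa>(2)]) (use S that in auto)
    consider "S = {}" | k where "S = {k}" | k0 k1 where "k0 \<in> S" "k1 \<in> S" "k0 \<noteq> k1"
      using is_singletonI'[of S] unfolding is_singleton_def by metis
    then show "c' * (\<Sum>k\<in>S. (cmod (\<xi> k))\<^sup>2) \<le> ?J"
    proof cases
      case 1
      then show ?thesis by (simp add: trig_sum_def)
    next
      case 2
      then show ?thesis using Suc.prems
        by (auto simp: trig_sum_def norm_mult c'_def intro!: mult_right_mono)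
    next
      case 3
      have "(\<Sum>k\<in>S. (cmod (\<xi> k))\<^sup>2) \<le> (\<Sum>k\<in>S - {k0}. (cmod (\<xi> k))\<^sup>2) + (\<Sum>k\<in>S - {k1}. (cmod (\<xi> k))\<^sup>2)"
        using 3 S(1) sum_mono2[of "S - {k1}" "{k0}" "\<lambda>k. (cmod (\<xi> k))\<^sup>2"] by (subst sum.remove[of S k0]) auto
      then have "c * \<kappa> * (\<Sum>k\<in>S. (cmod (\<xi> k))\<^sup>2)
          \<le> c * \<kappa> * ((\<Sum>k\<in>S - {k0}. (cmod (\<xi> k))\<^sup>2) + (\<Sum>k\<in>S - {k1}. (cmod (\<xi> k))\<^sup>2))"
        using c(1) \<kappa>(1) by (intro mult_left_mono) auto
      also have "\<dots> \<le> 8 * \<eta> * ?J" using drop[OF 3(1)] drop[OF 3(2)] by (simp add: distrib_left)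
      finally have "c * \<kappa> / (8 * \<eta>) * (\<Sum>k\<in>S. (cmod (\<xi> k))\<^sup>2) \<le> ?J" using \<eta>0 by (simp add: field_simps)
      moreover have "c' * (\<Sum>k\<in>S. (cmod (\<xi> k))\<^sup>2) \<le> c * \<kappa> / (8 * \<eta>) * (\<Sum>k\<in>S. (cmod (\<xi> k))\<^sup>2)"
        by (intro mult_right_mono sum_nonneg) (auto simp: c'_def)
      ultimately show ?thesis by linarith
    qed
  qed
qed

section \<open>Clusters of the dispersion relation\<close>

text \<open>The free flow multiplies the \<open>k\<close>-th Fourier coefficient by \<open>e\<^bsup>i t dispersion \<alpha> k\<^esup>\<close>; this is \<open>\<alpha> k \<bar>k\<bar> - k\<^sup>3\<close>.\<close>

definition dispersion :: "real \<Rightarrow> int \<Rightarrow> real" where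
  "dispersion \<alpha> k = (of_int k)\<^sup>2 * (\<alpha> * sgn (of_int k) - of_int k)"

text \<open>With four points the first and second divided differences of the cubic would be at most \<open>1\<close> in absolute value, while
their difference quotient, the third divided difference, equals \<open>-1\<close> whatever \<open>\<alpha>\<close> is.\<close>

lemma cubic_window_card:
  fixes \<alpha> \<omega> :: real
  assumes T: "finite T" "\<And>k. k \<in> T \<Longrightarrow> \<bar>\<alpha> * (of_int k)\<^sup>2 - (of_int k) ^ 3 - \<omega>\<bar> \<le> 1 / 2"
  shows "card T \<le> 3"
proof (rule ccontr)
  define P where "P = (\<lambda>k::int. \<alpha> * (of_int k)\<^sup>2 - (of_int k) ^ 3)"
  assume "\<not> card T \<le> 3"
  then have len: "4 \<le> length (sorted_list_of_set T)" by simp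
  have "\<exists>a b c d r. L = a # b # c # d # r" if "4 \<le> length L" for L :: "int list"
    using that by (auto simp: Suc_le_length_iff numeral_eq_Suc)
  from this[OF len] obtain a b c d r where L: "sorted_list_of_set T = a # b # c # d # r" by blast
  have "set (sorted_list_of_set T) = T" "sorted_wrt (<) (sorted_list_of_set T)" using T(1) by auto
  then have mem: "a \<in> T" "b \<in> T" "c \<in> T" "d \<in> T" and lt: "a < b" "b < c" "c < d" unfolding L by auto
  have first: "\<bar>\<alpha> * (of_int x + of_int y) - (of_int x ^ 2 + of_int x * of_int y + of_int y ^ 2)\<bar> \<le> 1"
    if "x \<in> T" "y \<in> T" "x < y" for x y :: int
  proof -
    let ?u = "\<alpha> * (of_int x + of_int y) - (of_int x ^ 2 + of_int x * of_int y + of_int y ^ 2)"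
    have "(of_int y - of_int x) * ?u = P y - P x"
      by (simp add: P_def power2_eq_square power3_eq_cube algebra_simps)
    moreover have "\<bar>P y - P x\<bar> \<le> 1" using T(2)[OF that(1)] T(2)[OF that(2)] unfolding P_def by linarith
    ultimately have "(of_int y - of_int x) * \<bar>?u\<bar> \<le> 1" using that(3) by (simp add: abs_mult[symmetric] flip: abs_of_nonneg)
    moreover have "1 * \<bar>?u\<bar> \<le> (of_int y - of_int x) * \<bar>?u\<bar>" using that(3) by (intro mult_right_mono) linarith+
    ultimately have "1 * \<bar>?u\<bar> \<le> 1" by (rule order_trans[rotated])
    then show ?thesis by (simp only: mult_1)
  qed
  have second: "\<bar>\<alpha> - (of_int x + of_int y + of_int z)\<bar> \<le> 1"
    if "x \<in> T" "y \<in> T" "z \<in> T" "x < y" "y < z" for x y z :: int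
  proof -
    let ?u = "\<alpha> - (of_int x + of_int y + of_int z)"
    have "\<bar>(of_int z - of_int x) * ?u\<bar> \<le> 2"
    proof -
      have "(of_int z - of_int x) * ?u =
        (\<alpha> * (of_int y + of_int z) - (of_int y ^ 2 + of_int y * of_int z + of_int z ^ 2)) -
        (\<alpha> * (of_int x + of_int y) - (of_int x ^ 2 + of_int x * of_int y + of_int y ^ 2))"
        by (simp add: power2_eq_square algebra_simps)
      then show ?thesis using first[OF that(1,2,4)] first[OF that(2,3,5)] by linarith
    qed
    moreover have "2 * \<bar>?u\<bar> \<le> \<bar>(of_int z - of_int x) * ?u\<bar>"
      unfolding abs_mult using that(4,5) by (intro mult_right_mono) linarith+
    ultimately have "2 * \<bar>?u\<bar> \<le> 2" by (rule order_trans[rotated])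
    then show ?thesis by simp
  qed
  have "real_of_int d - of_int a \<le> 2"
    using second[OF mem(1,2,3) lt(1,2)] second[OF mem(2,3,4) lt(2,3)] by linarith
  then show False using lt by linarith
qed

text \<open>The dispersion relation is an odd function that is a cubic on each half-line, so the bound for cubics applies to the positive
and to the negative frequencies.\<close>

lemma dispersion_window_card:
  assumes S: "finite S" "0 \<notin> S" "\<And>k. k \<in> S \<Longrightarrow> \<bar>dispersion \<alpha> k - \<omega>\<bar> \<le> 1 / 2"
  shows "card S \<le> 6"
proof -
  have "card (S \<inter> {0<..}) \<le> 3"
  proof (rule cubic_window_card)
    fix k assume "k \<in> S \<inter> {0<..}"
    then show "\<bar>\<alpha> * (of_int k)\<^sup>2 - (of_int k) ^ 3 - \<omega>\<bar> \<le> 1 / 2"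
      using S(3)[of k] by (simp add: dispersion_def power2_eq_square power3_eq_cube algebra_simps)
  qed (use S in auto)
  moreover have "card (uminus ` (S \<inter> {..<0})) \<le> 3"
  proof (rule cubic_window_card)
    fix k assume "k \<in> uminus ` (S \<inter> {..<0})"
    then have k: "k > 0" "- k \<in> S" by auto
    then show "\<bar>\<alpha> * (of_int k)\<^sup>2 - (of_int k) ^ 3 - (- \<omega>)\<bar> \<le> 1 / 2"
      using S(3)[of "- k"] by (simp add: dispersion_def power2_eq_square power3_eq_cube algebra_simps abs_minus_commute)
  qed (use S in auto)
  moreover have "card (uminus ` (S \<inter> {..<0})) = card (S \<inter> {..<0})" by (simp add: card_image)
  moreover have "S = (S \<inter> {0<..}) \<union> (S \<inter> {..<0})" using S(2) by (auto simp: neq_iff) (metis linorder_neqE_linordered_idom)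
  moreover have "card S \<le> card (S \<inter> {0<..}) + card (S \<inter> {..<0})"
    using calculation(4) card_Un_le by metis
  ultimately show ?thesis by linarith
qed

section \<open>Sobolev weights\<close>

definition sobolev_weight :: "real \<Rightarrow> int \<Rightarrow> real" where
  "sobolev_weight s k = (1 + (of_int k)\<^sup>2) powr (s / 2)"

lemma one_plus_square_neq0 [simp]: "1 + (real_of_int k)\<^sup>2 \<noteq> 0"
  using add_pos_nonneg[of 1 "(real_of_int k)\<^sup>2"] by simp

lemma sobolev_weight_pos [simp]: "0 < sobolev_weight s k"
  by (simp add: sobolev_weight_def)

lemma sobolev_weight_neq0 [simp]: "sobolev_weight s k \<noteq> 0"
  using sobolev_weight_pos[of s k] by linarith

lemma sobolev_weight_nonneg [simp]: "0 \<le> sobolev_weight s k"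
  using sobolev_weight_pos[of s k] by linarith

lemma sobolev_weight_ge1: "0 \<le> s \<Longrightarrow> 1 \<le> sobolev_weight s k"
  by (simp add: sobolev_weight_def ge_one_powr_ge_zero)

lemma sobolev_weight_zero [simp]: "sobolev_weight 0 k = 1" "sobolev_weight s 0 = 1"
  by (simp_all add: sobolev_weight_def)

lemma sobolev_weight_sq: "(sobolev_weight s k)\<^sup>2 = (1 + (of_int k)\<^sup>2) powr s"
  by (simp add: sobolev_weight_def power2_eq_square powr_add[symmetric])

lemma sobolev_weight_powr: "sobolev_weight s k = sobolev_weight 1 k powr s"
  by (simp add: sobolev_weight_def powr_powr)

lemma sobolev_weight_one: "sobolev_weight 1 k = sqrt (1 + (of_int k)\<^sup>2)"
  by (simp add: sobolev_weight_def powr_half_sqrt)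

lemma sobolev_weight_one_lipschitz:
  "\<bar>sobolev_weight 1 k - sobolev_weight 1 l\<bar> \<le> \<bar>real_of_int (k - l)\<bar>"
  using norm_triangle_ineq3[of "Complex 1 (of_int k)" "Complex 1 (of_int l)"]
  by (simp add: sobolev_weight_one cmod_def)

lemma sobolev_weight_one_bounds: "sobolev_weight 1 k \<le> bracket k" "bracket k \<le> 2 * sobolev_weight 1 k"
proof -
  show "sobolev_weight 1 k \<le> bracket k"
    unfolding sobolev_weight_one bracket_def by (rule real_le_lsqrt) (auto simp: power2_sum)
  have "\<bar>real_of_int k\<bar> \<le> sobolev_weight 1 k" "1 \<le> sobolev_weight 1 k"
    unfolding sobolev_weight_one by (auto intro!: real_le_rsqrt)
  then show "bracket k \<le> 2 * sobolev_weight 1 k" by (simp add: bracket_def)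
qed

lemma sobolev_weight_one_ratio: "sobolev_weight 1 k / sobolev_weight 1 l \<le> bracket (k - l)"
proof -
  have "sobolev_weight 1 k \<le> sobolev_weight 1 l + \<bar>real_of_int (k - l)\<bar>"
    using sobolev_weight_one_lipschitz[of k l] by linarith
  also have "\<dots> \<le> bracket (k - l) * sobolev_weight 1 l"
    using mult_left_mono[OF sobolev_weight_ge1[of 1 l], of "\<bar>real_of_int (k - l)\<bar>"]
    by (simp add: bracket_def distrib_right)
  finally show ?thesis by (simp add: pos_divide_le_eq)
qed

text \<open>Peetre's inequality.\<close>

lemma sobolev_weight_ratio:
  assumes "0 \<le> s"
  shows "sobolev_weight s k / sobolev_weight s l \<le> bracket (k - l) powr s"
proof -
  have "sobolev_weight s k / sobolev_weight s l = (sobolev_weight 1 k / sobolev_weight 1 l) powr s"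
    by (simp add: sobolev_weight_powr[of s] powr_divide)
  also have "\<dots> \<le> bracket (k - l) powr s"
    using assms by (intro powr_mono2 sobolev_weight_one_ratio) auto
  finally show ?thesis .
qed

text \<open>The weight varies slowly: passing from \<open>l\<close> to \<open>k\<close> changes it by a factor \<open>1 + O(1 / \<bar>l\<bar>)\<close>, with powers of
  \<open>\<bar>k - l\<bar>\<close> as constants. This is what makes the commutator of the weight with a smooth multiplication
  operator of order \<open>-1\<close>.\<close>

lemma sobolev_weight_commutator:
  assumes s: "0 \<le> s"
  shows "\<bar>sobolev_weight s k / sobolev_weight s l - 1\<bar> * bracket l \<le> 2 * s * bracket (k - l) powr (s + 2)"
proof -
  define d where "d = bracket (k - l)"
  define \<rho> where "\<rho> = sobolev_weight 1 k / sobolev_weight 1 l"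
  have d1: "1 \<le> d" by (simp add: d_def bracket_ge1)
  have \<rho>d: "\<rho> \<le> d" and "1 / \<rho> \<le> d"
    using sobolev_weight_one_ratio[of k l] sobolev_weight_one_ratio[of l k]
    by (simp_all add: \<rho>_def d_def bracket_diff_commute)
  have \<rho>0: "\<rho> > 0" by (simp add: \<rho>_def)
  then have d\<rho>: "1 / d \<le> \<rho>" using \<open>1 / \<rho> \<le> d\<close> d1 by (simp add: field_simps)
  have "norm (\<rho> powr s - 1 powr s) \<le> (s * d powr (s + 1)) * norm (\<rho> - 1)"
  proof (rule field_differentiable_bound[of "{1/d..d}"])
    fix x assume x: "x \<in> {1/d..d}"
    then have x0: "x > 0" using d1 by (auto intro: less_le_trans[of 0 "1/d"])
    show "((\<lambda>x. x powr s) has_field_derivative s * x powr (s - 1)) (at x within {1/d..d})"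
      using x0 by (auto intro!: derivative_eq_intros)
    have "x powr (s - 1) \<le> d powr (s + 1)"
    proof (cases "x \<ge> 1")
      case True
      then have "x powr (s - 1) \<le> x powr (s + 1)" by (intro powr_mono) auto
      also have "\<dots> \<le> d powr (s + 1)" using x x0 s by (intro powr_mono2) auto
      finally show ?thesis .
    next
      case False
      then have "x powr (s - 1) \<le> x powr (-1)" using x0 s by (intro powr_mono') auto
      also have "\<dots> \<le> d" using x x0 d1 by (simp add: powr_minus_divide field_simps)
      also have "d \<le> d powr (s + 1)" using powr_mono[of 1 "s + 1" d] d1 s by simp
      finally show ?thesis .
    qed
    then show "norm (s * x powr (s - 1)) \<le> s * d powr (s + 1)" using s by (simp add: abs_mult mult_left_mono)
  qed (use d\<rho> \<rho>d d1 in auto)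
  then have 1: "\<bar>\<rho> powr s - 1\<bar> \<le> s * d powr (s + 1) * \<bar>\<rho> - 1\<bar>" by simp
  have "\<bar>\<rho> - 1\<bar> = \<bar>sobolev_weight 1 k - sobolev_weight 1 l\<bar> / sobolev_weight 1 l"
    by (simp add: \<rho>_def field_simps abs_divide flip: abs_of_pos)
  also have "\<dots> \<le> d / sobolev_weight 1 l"
    using sobolev_weight_one_lipschitz[of k l] by (intro divide_right_mono) (auto simp: d_def bracket_def)
  finally have "\<bar>\<rho> - 1\<bar> * bracket l \<le> d / sobolev_weight 1 l * (2 * sobolev_weight 1 l)"
    using sobolev_weight_one_bounds[of l] d1 by (intro mult_mono) auto
  then have 2: "\<bar>\<rho> - 1\<bar> * bracket l \<le> 2 * d" by simp
  have "\<bar>\<rho> powr s - 1\<bar> * bracket l \<le> s * d powr (s + 1) * \<bar>\<rho> - 1\<bar> * bracket l"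
    using 1 by (intro mult_right_mono) auto
  also have "\<dots> = s * d powr (s + 1) * (\<bar>\<rho> - 1\<bar> * bracket l)" by simp
  also have "\<dots> \<le> s * d powr (s + 1) * (2 * d)" using 2 s by (intro mult_left_mono) auto
  also have "\<dots> = 2 * s * d powr (s + 2)" using d1 powr_add[of d "s + 1" 1] by (simp add: add.commute)
  finally show ?thesis
    by (simp add: \<rho>_def d_def sobolev_weight_powr[of s] powr_divide)
qed

text \<open>Frequencies with \<open>\<langle>l\<rangle>\<^sup>-\<^sup>2 > e\<close> are bounded, and so is the weight on them.\<close>

lemma bracket_inverse_sq_interpolation:
  assumes "0 < e" "0 \<le> s"
  shows "1 / (bracket l)\<^sup>2 \<le> e + (1 / e) powr s / (sobolev_weight s l)\<^sup>2"
proof (cases "1 / (bracket l)\<^sup>2 \<le> e")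
  case True
  then show ?thesis by (simp add: add_increasing2)
next
  case False
  have "1 + (of_int l)\<^sup>2 \<le> (bracket l)\<^sup>2" by (simp add: bracket_def power2_sum)
  also have "\<dots> \<le> 1 / e"
  proof -
    have "e < 1 / (bracket l)\<^sup>2" using False by simp
    moreover have "0 < (bracket l)\<^sup>2" by (rule zero_less_power) simp
    ultimately have "e * (bracket l)\<^sup>2 < 1" by (simp only: pos_less_divide_eq)
    then show ?thesis using assms(1) by (simp add: pos_le_divide_eq mult.commute)
  qed
  finally have "(1 + (of_int l)\<^sup>2) powr s \<le> (1 / e) powr s"
    using assms by (intro powr_mono2) auto
  then have "1 \<le> (1 / e) powr s / (sobolev_weight s l)\<^sup>2"
    by (simp add: sobolev_weight_sq add_pos_nonneg)
  moreover have "1 / (bracket l)\<^sup>2 \<le> 1" using bracket_ge1[of l] by simp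
  ultimately show ?thesis using assms(1) by linarith
qed

section \<open>A Lyapunov functional\<close>

lemma coord_mat_app_finite:
  assumes "offdiag C m" "finite S" "\<And>k. k \<notin> S \<Longrightarrow> coord x k = 0"
  shows "coord (mat_app m x) k = (\<Sum>l\<in>S. m k l * coord x l)"
proof -
  have "coord (mat_app m x) k = (\<Sum>\<^sub>\<infinity>l\<in>S. m k l * coord x l)"
    unfolding coord_mat_app[OF assms(1)] by (rule infsum_cong_neutral) (use assms in auto)
  then show ?thesis using assms(2) by simp
qed

lemma complex_inner_Re: "a \<bullet> b = Re (a * cnj b)"
  by (simp add: inner_complex_def)

lemma inner_mat_app_finite:
  assumes "offdiag C m" "finite S" "\<And>k. k \<notin> S \<Longrightarrow> coord x k = 0" "\<And>k. k \<notin> S \<Longrightarrow> coord y k = 0"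
  shows "mat_app m x \<bullet> y = (\<Sum>k\<in>S. \<Sum>l\<in>S. Re (m k l * coord x l * cnj (coord y k)))"
  by (subst inner_finite_support[of S])
     (use assms in \<open>auto simp: coord_mat_app_finite[OF assms(1-3)] complex_inner_Re sum_distrib_right\<close>)

text \<open>The properties of the matrix of \<open>G G\<^sup>*\<close> that the decay estimates use. The assumption \<open>coercive\<close> concerns only few frequencies
at a time, six being the size of a cluster of the dispersion relation; \<open>square_le\<close> is \<open>\<bar>b \<xi>\<bar>\<^sup>2 \<le> C1 \<langle>b \<xi>, \<xi>\<rangle>\<close>, as for a bounded
operator of the form \<open>G G\<^sup>*\<close>.\<close>

locale damping =
  fixes b :: "int \<Rightarrow> int \<Rightarrow> complex" and c0 C1 :: real
  assumes rapid: "\<And>n::nat. \<exists>C\<ge>0. \<forall>k l. cmod (b k l) \<le> C / bracket (k - l) ^ n"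
    and row_zero: "\<And>l. b 0 l = 0" and column_zero: "\<And>k. b k 0 = 0"
    and c0: "c0 > 0" and C1: "C1 > 0"
    and coercive: "\<And>S \<xi>. finite S \<Longrightarrow> 0 \<notin> S \<Longrightarrow> card S \<le> 6 \<Longrightarrow>
      c0 * (\<Sum>k\<in>S. (cmod (\<xi> k))\<^sup>2) \<le> (\<Sum>k\<in>S. \<Sum>l\<in>S. Re (b k l * \<xi> l * cnj (\<xi> k)))"
    and square_le: "\<And>S F \<xi>. finite S \<Longrightarrow> finite F \<Longrightarrow>
      (\<Sum>k\<in>F. (cmod (\<Sum>l\<in>S. b k l * \<xi> l))\<^sup>2) \<le> C1 * (\<Sum>k\<in>S. \<Sum>l\<in>S. Re (b k l * \<xi> l * cnj (\<xi> k)))"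
begin

definition CB :: real where "CB = (SOME C. offdiag C b)"

lemma offdiag_b: "offdiag CB b"
proof -
  obtain C where "C \<ge> 0" "\<forall>k l. cmod (b k l) \<le> C / bracket (k - l) ^ 2" using rapid[of 2] by auto
  then have "offdiag C b" by (simp add: offdiag_def)
  then show ?thesis unfolding CB_def by (rule someI)
qed

lemma offdiag_dominated:
  "(\<And>k l. cmod (m k l) \<le> cmod (b k l)) \<Longrightarrow> offdiag CB m"
  using offdiag_b unfolding offdiag_def by (meson order_trans)

text \<open>The length of the overlap of the unit intervals around the two values of the dispersion relation.\<close>

definition overlap :: "real \<Rightarrow> int \<Rightarrow> int \<Rightarrow> real" where
  "overlap \<alpha> k l = max 0 (1 - \<bar>dispersion \<alpha> k - dispersion \<alpha> l\<bar>)"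

definition near_part :: "real \<Rightarrow> int \<Rightarrow> int \<Rightarrow> complex" where
  "near_part \<alpha> k l = b k l * of_real (overlap \<alpha> k l)"

text \<open>The solution \<open>p\<close> of the commutator equation \<open>i (\<lambda>\<^sub>l - \<lambda>\<^sub>k) p\<^sub>k\<^sub>l = b\<^sub>k\<^sub>l - q\<^sub>k\<^sub>l\<close> with the near part \<open>q\<close>. For equal values of the
dispersion relation the right-hand side vanishes, and division by zero gives the entry \<open>0\<close>.\<close>

definition corrector :: "real \<Rightarrow> int \<Rightarrow> int \<Rightarrow> complex" where
  "corrector \<alpha> k l = b k l * of_real (1 - overlap \<alpha> k l) / (\<i> * of_real (dispersion \<alpha> l - dispersion \<alpha> k))"

lemma offdiag_near_part: "offdiag CB (near_part \<alpha>)"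
  by (rule offdiag_dominated) (auto simp: near_part_def norm_mult overlap_def mult_left_le)

text \<open>The tent function has slope at most one, so the small denominators cancel with no loss, uniformly in \<open>\<alpha>\<close>.\<close>

lemma offdiag_corrector: "offdiag CB (corrector \<alpha>)"
proof (rule offdiag_dominated)
  fix k l
  let ?d = "\<bar>dispersion \<alpha> l - dispersion \<alpha> k\<bar>"
  have "\<bar>1 - overlap \<alpha> k l\<bar> \<le> ?d" by (auto simp: overlap_def)
  then have "\<bar>1 - overlap \<alpha> k l\<bar> / ?d \<le> 1" by (simp add: divide_le_eq)
  then have "cmod (b k l) * (\<bar>1 - overlap \<alpha> k l\<bar> / ?d) \<le> cmod (b k l)" by (rule mult_left_le) simp
  then show "cmod (corrector \<alpha> k l) \<le> cmod (b k l)"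
    unfolding corrector_def norm_mult norm_divide by (simp del: of_real_diff)
qed

lemma corrector_commutator:
  "corrector \<alpha> k l * (\<i> * of_real (dispersion \<alpha> l - dispersion \<alpha> k)) = b k l - near_part \<alpha> k l"
proof (cases "dispersion \<alpha> l = dispersion \<alpha> k")
  case True
  then show ?thesis by (simp add: near_part_def overlap_def)
next
  case False
  then have "corrector \<alpha> k l * (\<i> * of_real (dispersion \<alpha> l - dispersion \<alpha> k)) = b k l * of_real (1 - overlap \<alpha> k l)"
    by (simp add: corrector_def del: of_real_diff)
  then show ?thesis by (simp add: near_part_def right_diff_distrib)
qed

text \<open>Writing the overlap as an integral over the position \<open>\<omega>\<close> of a window turns the form into an average of forms of \<open>b\<close>, each
restricted to the at most six frequencies in the window.\<close>

lemma near_part_coercive: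
  assumes S: "finite S" "0 \<notin> S" "\<And>k. k \<notin> S \<Longrightarrow> coord x k = 0"
  shows "c0 * (x \<bullet> x) \<le> mat_app (near_part \<alpha>) x \<bullet> x"
proof -
  define I where "I = (\<lambda>k. {dispersion \<alpha> k - 1/2 .. dispersion \<alpha> k + 1/2})"
  define r where "r = (\<lambda>k l. Re (b k l * coord x l * cnj (coord x k)))"
  have int: "integrable lborel (\<lambda>\<omega>. r k l * indicator (I k \<inter> I l) \<omega> :: real)" for k l
    by (intro integrable_mult_right integrable_real_indicator) (auto simp: I_def emeasure_lborel_Icc_eq)
  have int1: "integrable lborel (\<lambda>\<omega>. (cmod (coord x k))\<^sup>2 * indicator (I k) \<omega> :: real)" for k
    by (intro integrable_mult_right integrable_real_indicator) (auto simp: I_def emeasure_lborel_Icc_eq)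
  have ov: "measure lborel (I k \<inter> I l) = overlap \<alpha> k l" for k l
  proof -
    define a where "a = max (dispersion \<alpha> k) (dispersion \<alpha> l) - 1/2"
    define a' where "a' = min (dispersion \<alpha> k) (dispersion \<alpha> l) + 1/2"
    have "I k \<inter> I l = {a..a'}" by (auto simp: I_def a_def a'_def)
    moreover have "measure lborel {a..a'} = max 0 (a' - a)" by (cases "a \<le> a'") auto
    moreover have "a' - a = 1 - \<bar>dispersion \<alpha> k - dispersion \<alpha> l\<bar>" by (auto simp: a_def a'_def)
    ultimately show ?thesis by (simp add: overlap_def)
  qed
  have one: "measure lborel (I k) = 1" for k by (simp add: I_def)
  have "x \<bullet> x = (\<Sum>k\<in>S. (cmod (coord x k))\<^sup>2)"
    using norm_finite_support[OF S(1,3)] by (simp add: power2_norm_eq_inner)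
  also have "\<dots> = (\<integral>\<omega>. (\<Sum>k\<in>S. (cmod (coord x k))\<^sup>2 * indicator (I k) \<omega>) \<partial>lborel)"
    using int1 by (simp add: Bochner_Integration.integral_sum one)
  finally have "c0 * (x \<bullet> x) = (\<integral>\<omega>. c0 * (\<Sum>k\<in>S. (cmod (coord x k))\<^sup>2 * indicator (I k) \<omega>) \<partial>lborel)"
    by simp
  also have "\<dots> \<le> (\<integral>\<omega>. (\<Sum>k\<in>S. \<Sum>l\<in>S. r k l * indicator (I k \<inter> I l) \<omega>) \<partial>lborel)"
  proof (rule integral_mono)
    show "integrable lborel (\<lambda>\<omega>. c0 * (\<Sum>k\<in>S. (cmod (coord x k))\<^sup>2 * indicator (I k) \<omega> :: real))"
      by (intro integrable_mult_right Bochner_Integration.integrable_sum int1)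
    show "integrable lborel (\<lambda>\<omega>. \<Sum>k\<in>S. \<Sum>l\<in>S. r k l * indicator (I k \<inter> I l) \<omega> :: real)"
      by (intro Bochner_Integration.integrable_sum int)
    fix \<omega> :: real
    define T where "T = {k\<in>S. \<omega> \<in> I k}"
    have T: "finite T" "0 \<notin> T" "T \<subseteq> S" using S by (auto simp: T_def)
    have "card T \<le> 6"
    proof (rule dispersion_window_card[OF T(1,2), of \<alpha> \<omega>])
      fix k assume "k \<in> T"
      then have "dispersion \<alpha> k - 1/2 \<le> \<omega>" "\<omega> \<le> dispersion \<alpha> k + 1/2" by (auto simp: T_def I_def)
      then show "\<bar>dispersion \<alpha> k - \<omega>\<bar> \<le> 1 / 2" by linarith
    qed
    from coercive[OF T(1,2) this, of "coord x"]
    have "c0 * (\<Sum>k\<in>T. (cmod (coord x k))\<^sup>2) \<le> (\<Sum>k\<in>T. \<Sum>l\<in>T. r k l)" by (simp add: r_def)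
    moreover have "(\<Sum>k\<in>S. (cmod (coord x k))\<^sup>2 * indicator (I k) \<omega>) = (\<Sum>k\<in>T. (cmod (coord x k))\<^sup>2)"
      by (rule sum.mono_neutral_cong_right) (use S in \<open>auto simp: T_def\<close>)
    moreover have "(\<Sum>k\<in>S. \<Sum>l\<in>S. r k l * indicator (I k \<inter> I l) \<omega>) = (\<Sum>k\<in>T. \<Sum>l\<in>T. r k l)"
    proof (rule sum.mono_neutral_cong_right)
      show "\<forall>k\<in>S - T. (\<Sum>l\<in>S. r k l * indicator (I k \<inter> I l) \<omega>) = 0"
        by (auto simp: T_def intro!: sum.neutral)
      fix k assume "k \<in> T"
      then show "(\<Sum>l\<in>S. r k l * indicator (I k \<inter> I l) \<omega>) = (\<Sum>l\<in>T. r k l)"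
        by (intro sum.mono_neutral_cong_right) (use S in \<open>auto simp: T_def\<close>)
    qed (use S T in auto)
    ultimately show "c0 * (\<Sum>k\<in>S. (cmod (coord x k))\<^sup>2 * indicator (I k) \<omega>) 
        \<le> (\<Sum>k\<in>S. \<Sum>l\<in>S. r k l * indicator (I k \<inter> I l) \<omega>)" by simp
  qed
  also have "\<dots> = (\<Sum>k\<in>S. \<Sum>l\<in>S. r k l * overlap \<alpha> k l)"
    using int by (simp add: Bochner_Integration.integral_sum Bochner_Integration.integrable_sum ov)
  also have "\<dots> = mat_app (near_part \<alpha>) x \<bullet> x"
    by (subst inner_mat_app_finite[OF offdiag_near_part S(1,3,3)])
       (auto simp: r_def near_part_def algebra_simps intro!: sum.cong)
  finally show ?thesis .
qed

definition NB :: real where "NB = CB * bracket_sum"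

lemma NB_nonneg: "0 \<le> NB"
  using offdiag_b bracket_sum_nonneg by (simp add: NB_def offdiag_def)

text \<open>The factor of the energy: large enough that the dissipation \<open>2 K0 \<langle>b x, x\<rangle>\<close> pays for the terms that the corrector
produces, and that the corrector is dominated by the energy.\<close>

definition K0 :: real where "K0 = NB + 1 + (1 + 2 * NB\<^sup>2 * C1 / c0) / 2"

definition C3 :: real where "C3 = (2 * K0 + 2 * NB)\<^sup>2 / c0"

definition lyapunov :: "real \<Rightarrow> ell2 \<Rightarrow> real" where
  "lyapunov \<alpha> x = K0 * (x \<bullet> x) + mat_app (corrector \<alpha>) x \<bullet> x"

lemma inner_mat_app_bound:
  assumes "offdiag CB m"
  shows "\<bar>mat_app m x \<bullet> y\<bar> \<le> NB * norm x * norm y"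
proof -
  have "\<bar>mat_app m x \<bullet> y\<bar> \<le> norm (mat_app m x) * norm y" by (rule Cauchy_Schwarz_ineq2)
  also have "\<dots> \<le> NB * norm x * norm y"
    using mat_app_norm_le[OF assms, of x] by (intro mult_right_mono) (auto simp: NB_def)
  finally show ?thesis .
qed

lemma lyapunov_bounds: "x \<bullet> x \<le> lyapunov \<alpha> x" "lyapunov \<alpha> x \<le> (K0 + NB) * (x \<bullet> x)"
proof -
  have "\<bar>mat_app (corrector \<alpha>) x \<bullet> x\<bar> \<le> NB * (x \<bullet> x)"
    using inner_mat_app_bound[OF offdiag_corrector, of \<alpha> x x]
    by (simp add: power2_norm_eq_inner[symmetric] power2_eq_square mult.assoc)
  moreover have "(NB + 1) * (x \<bullet> x) \<le> K0 * (x \<bullet> x)"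
    using NB_nonneg C1 c0 by (intro mult_right_mono) (auto simp: K0_def)
  ultimately show "x \<bullet> x \<le> lyapunov \<alpha> x" "lyapunov \<alpha> x \<le> (K0 + NB) * (x \<bullet> x)"
    by (auto simp: lyapunov_def distrib_right)
qed

text \<open>Here \<open>d\<close> is the velocity of the truncated state \<open>x\<close>: \<open>y\<close> comes from the free flow, and \<open>r\<close> is the part of the feedback that
is not \<open>b x\<close>. The commutator of the corrector with the free flow yields \<open>\<langle>b x, x\<rangle> - \<langle>q x, x\<rangle>\<close>, and the remaining terms are
absorbed by Young's inequality.\<close>

lemma lyapunov_derivative_bound:
  assumes S: "finite S" "0 \<notin> S" "\<And>k. k \<notin> S \<Longrightarrow> coord x k = 0"
    and y: "\<And>k. coord y k = \<i> * of_real (dispersion \<alpha> k) * coord x k"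
    and d: "d = y - trunc S (mat_app b x + r)"
  shows "2 * K0 * (x \<bullet> d) + mat_app (corrector \<alpha>) x \<bullet> d + mat_app (corrector \<alpha>) d \<bullet> x
     \<le> - (c0 / 4) * (x \<bullet> x) + C3 * (norm r)\<^sup>2"
proof -
  define P where "P = mat_app (corrector \<alpha>)"
  define D where "D = mat_app b x \<bullet> x"
  define X where "X = norm x"
  define Y where "Y = norm (mat_app b x)"
  define h where "h = trunc S (mat_app b x + r)"
  have ys: "coord y k = 0" if "k \<notin> S" for k using S(3)[OF that] y[of k] by simp
  have X0: "0 \<le> X" and Y0: "0 \<le> Y" by (auto simp: X_def Y_def)
  have xx: "x \<bullet> x = X\<^sup>2" by (simp add: X_def power2_norm_eq_inner)
  have xy: "x \<bullet> y = 0"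
    by (subst inner_finite_support[OF S(1) ys]) (auto simp: y complex_inner_Re mult_ac)
  have xh: "x \<bullet> trunc S w = x \<bullet> w" for w
    by (subst (1 2) inner_commute, subst (1 2) inner_finite_support[OF S(1,3)]) auto
  note bil = inner_mat_app_finite[OF _ S(1)]
  have e1: "P x \<bullet> y = (\<Sum>k\<in>S. \<Sum>l\<in>S. Re (corrector \<alpha> k l * coord x l * cnj (coord y k)))"
    unfolding P_def by (rule bil[OF offdiag_corrector]) (auto simp: S(3) ys)
  have e2: "P y \<bullet> x = (\<Sum>k\<in>S. \<Sum>l\<in>S. Re (corrector \<alpha> k l * coord y l * cnj (coord x k)))"
    unfolding P_def by (rule bil[OF offdiag_corrector]) (auto simp: S(3) ys)
  have e3: "D = (\<Sum>k\<in>S. \<Sum>l\<in>S. Re (b k l * coord x l * cnj (coord x k)))"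
    unfolding D_def by (rule bil[OF offdiag_b]) (auto simp: S(3))
  have e4: "mat_app (near_part \<alpha>) x \<bullet> x = (\<Sum>k\<in>S. \<Sum>l\<in>S. Re (near_part \<alpha> k l * coord x l * cnj (coord x k)))"
    by (rule bil[OF offdiag_near_part]) (auto simp: S(3))
  have e5: "coord (mat_app b x) k = (\<Sum>l\<in>S. b k l * coord x l)" for k
    by (rule coord_mat_app_finite[OF offdiag_b S(1)]) (rule S(3))
  have YD: "Y\<^sup>2 \<le> C1 * D"
  proof -
    have "(\<Sum>k\<in>F. (cmod (coord (mat_app b x) k))\<^sup>2) \<le> C1 * D" if "finite F" for F
      unfolding e3 e5
      by (rule square_le[OF S(1) that])
    then show ?thesis unfolding Y_def norm_ell2_sq
      by (intro infsum_le_finite_sums) (auto intro: coord_summable)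
  qed
  have D0: "0 \<le> D" using YD C1 by (metis mult_le_cancel_left_pos mult_zero_right order_trans zero_le_power2)
  have hn: "norm h \<le> Y + norm r"
    unfolding h_def Y_def by (rule order_trans[OF norm_trunc_le norm_triangle_ineq])
  have comm: "P x \<bullet> y + P y \<bullet> x = D - mat_app (near_part \<alpha>) x \<bullet> x"
    unfolding e1 e2 e3 e4 sum.distrib[symmetric] sum_subtractf[symmetric]
  proof (intro sum.cong refl)
    fix k l
    have "corrector \<alpha> k l * coord x l * cnj (coord y k) + corrector \<alpha> k l * coord y l * cnj (coord x k)
        = corrector \<alpha> k l * (\<i> * of_real (dispersion \<alpha> l - dispersion \<alpha> k)) * (coord x l * cnj (coord x k))"
      by (simp add: y algebra_simps)
    also have "\<dots> = b k l * coord x l * cnj (coord x k) - near_part \<alpha> k l * coord x l * cnj (coord x k)"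
      unfolding corrector_commutator by (simp add: algebra_simps)
    finally show "Re (corrector \<alpha> k l * coord x l * cnj (coord y k)) + Re (corrector \<alpha> k l * coord y l * cnj (coord x k))
       = Re (b k l * coord x l * cnj (coord x k)) - Re (near_part \<alpha> k l * coord x l * cnj (coord x k))"
      by (metis minus_complex.simps(1) plus_complex.simps(1))
  qed
  have Plin: "P (u - v) = P u - P v" for u v
    unfolding P_def using bounded_linear_mat_app[OF offdiag_corrector] by (simp add: bounded_linear.linear linear_diff)
  have "2 * K0 * (x \<bullet> d) + P x \<bullet> d + P d \<bullet> x
     = - 2 * K0 * (D + x \<bullet> r) + (P x \<bullet> y + P y \<bullet> x) - P x \<bullet> h - P h \<bullet> x"
    by (simp add: d Plin inner_diff_right inner_diff_left xy xh inner_add_right D_def inner_commute h_def algebra_simps)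
  also have "\<dots> \<le> - 2 * K0 * D + 2 * K0 * (X * norm r) + D - c0 * X\<^sup>2 + 2 * (NB * X * (Y + norm r))"
  proof -
    have K0: "0 \<le> K0" using NB_nonneg C1 c0 by (simp add: K0_def)
    have "- (x \<bullet> r) \<le> X * norm r" using Cauchy_Schwarz_ineq2[of x r] by (simp add: X_def)
    from mult_left_mono[OF this K0] have 1: "- (K0 * (x \<bullet> r)) \<le> K0 * (X * norm r)" by simp
    have "c0 * X\<^sup>2 \<le> mat_app (near_part \<alpha>) x \<bullet> x"
      using near_part_coercive[OF S] by (simp add: xx)
    moreover have "\<bar>P x \<bullet> h\<bar> \<le> NB * X * (Y + norm r)" "\<bar>P h \<bullet> x\<bar> \<le> NB * X * (Y + norm r)"
    proof -
      have "NB * X * norm h \<le> NB * X * (Y + norm r)" using hn NB_nonneg X0 by (intro mult_left_mono) auto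
      then show "\<bar>P x \<bullet> h\<bar> \<le> NB * X * (Y + norm r)" "\<bar>P h \<bullet> x\<bar> \<le> NB * X * (Y + norm r)"
        using inner_mat_app_bound[OF offdiag_corrector, of \<alpha> x h] inner_mat_app_bound[OF offdiag_corrector, of \<alpha> h x]
        by (auto simp: P_def X_def mult_ac)
    qed
    ultimately show ?thesis using 1 unfolding comm by (simp add: distrib_left)
  qed
  also have "\<dots> \<le> - (c0 / 4) * X\<^sup>2 + C3 * (norm r)\<^sup>2"
  proof -
    have young: "u * v \<le> a * u\<^sup>2 / 4 + v\<^sup>2 / a" if "a > 0" for u v a :: real
    proof -
      have "0 \<le> (a * u / 2 - v)\<^sup>2 / a" using that by simp
      also have "\<dots> = a * u\<^sup>2 / 4 + v\<^sup>2 / a - u * v" using that by (simp add: power2_eq_square field_simps)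
      finally show ?thesis by simp
    qed
    have "2 * (NB * X * Y) = X * (2 * NB * Y)" by simp
    also have "\<dots> \<le> (2 * c0) * X\<^sup>2 / 4 + (2 * NB * Y)\<^sup>2 / (2 * c0)" using c0 by (intro young) auto
    also have "(2 * NB * Y)\<^sup>2 / (2 * c0) = (2 * NB\<^sup>2 / c0) * Y\<^sup>2" using c0 by (simp add: power_mult_distrib)
    also have "\<dots> \<le> (2 * NB\<^sup>2 / c0) * (C1 * D)" using YD c0 by (intro mult_left_mono) auto
    also have "\<dots> = (2 * NB\<^sup>2 * C1 / c0) * D" by simp
    finally have 1: "2 * (NB * X * Y) \<le> c0 * X\<^sup>2 / 2 + (2 * NB\<^sup>2 * C1 / c0) * D" by simp
    have "X * ((2 * K0 + 2 * NB) * norm r) \<le> c0 * X\<^sup>2 / 4 + ((2 * K0 + 2 * NB) * norm r)\<^sup>2 / c0"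
      using c0 by (rule young)
    moreover have "((2 * K0 + 2 * NB) * norm r)\<^sup>2 / c0 = C3 * (norm r)\<^sup>2"
      by (simp add: C3_def power_mult_distrib)
    moreover have "X * ((2 * K0 + 2 * NB) * norm r) = 2 * K0 * (X * norm r) + 2 * (NB * X * norm r)"
      by (simp add: algebra_simps)
    ultimately have 2: "2 * K0 * (X * norm r) + 2 * (NB * X * norm r) \<le> c0 * X\<^sup>2 / 4 + C3 * (norm r)\<^sup>2"
      by simp
    have "(1 + 2 * NB\<^sup>2 * C1 / c0) * D \<le> (2 * K0) * D"
    proof (rule mult_right_mono[OF _ D0])
      have "1 + t \<le> 2 * (NB + 1 + (1 + t) / 2)" for t :: real using NB_nonneg by (simp add: field_simps)
      then show "1 + 2 * NB\<^sup>2 * C1 / c0 \<le> 2 * K0" unfolding K0_def .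
    qed
    then have 3: "D + (2 * NB\<^sup>2 * C1 / c0) * D \<le> 2 * K0 * D" by (simp add: distrib_right)
    show ?thesis using 1 2 3 by (simp add: distrib_left)
  qed
  finally show ?thesis by (simp add: P_def xx)
qed

end

section \<open>Decay in weighted spaces\<close>

text \<open>Passing from coordinates of \<open>H\<^sup>s\<close> to coordinates of \<open>L\<^sup>2\<close>. The value for negative \<open>s\<close> is a default that makes the operator
total.\<close>

lift_definition weight_down :: "real \<Rightarrow> ell2 \<Rightarrow> ell2" is
  "\<lambda>s f k. if 0 \<le> s then f k / of_real (sobolev_weight s k) else 0"
proof -
  fix s :: real and f :: "int \<Rightarrow> complex" assume f: "(\<lambda>k. (cmod (f k))\<^sup>2) summable_on UNIV"
  have "(\<lambda>k. (cmod ((if 0 \<le> s then 1 / of_real (sobolev_weight s k) else 0) * f k))\<^sup>2) summable_on UNIV"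
    by (rule square_summable_mult_bounded[OF f, of _ 1])
       (use sobolev_weight_ge1[of s] in \<open>auto simp: norm_divide\<close>)
  then show "(\<lambda>k. (cmod (if 0 \<le> s then f k / of_real (sobolev_weight s k) else 0))\<^sup>2) summable_on UNIV"
    by (rule back_subst[of "\<lambda>g. g summable_on UNIV"]) auto
qed

lemma coord_weight_down [simp]:
  "0 \<le> s \<Longrightarrow> coord (weight_down s x) k = coord x k / of_real (sobolev_weight s k)"
  by (simp add: weight_down.rep_eq)

lemma norm_weight_down_le:
  assumes "0 \<le> s"
  shows "norm (weight_down s x) \<le> norm x"
proof (rule ell2_norm_leI)
  fix F :: "int set" assume F: "finite F"
  have "cmod (coord (weight_down s x) k) \<le> cmod (coord x k)" for k
    using sobolev_weight_ge1[OF assms, of k] mult_left_mono[of 1 "sobolev_weight s k" "cmod (coord x k)"]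
    by (simp add: assms norm_divide divide_le_eq)
  then have "(\<Sum>k\<in>F. (cmod (coord (weight_down s x) k))\<^sup>2) \<le> (\<Sum>k\<in>F. (cmod (coord x k))\<^sup>2)"
    by (intro sum_mono power_mono) auto
  then show "(\<Sum>k\<in>F. (cmod (coord (weight_down s x) k))\<^sup>2) \<le> (norm x)\<^sup>2"
    using ell2_finite_sum_le[OF F, of x] by linarith
qed simp

lemma bounded_linear_weight_down: "0 \<le> s \<Longrightarrow> bounded_linear (weight_down s)"
  by (rule bounded_linear_intro[where K = 1])
     (auto intro!: ell2_eqI simp: norm_weight_down_le add_divide_distrib scaleR_conv_of_real)

text \<open>An error of order \<open>-1\<close> costs an arbitrarily small part of the \<open>H\<^sup>s\<close> norm at the price of a multiple of the \<open>L\<^sup>2\<close> norm.\<close>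

lemma weight_down_bracket_interpolation:
  assumes s: "0 \<le> s" and e: "0 < e"
  shows "(norm (weight_down 1 x))\<^sup>2 \<le> 4 * (e * (norm x)\<^sup>2 + (1 / e) powr s * (norm (weight_down s x))\<^sup>2)"
  unfolding norm_ell2_sq[of "weight_down 1 x"]
proof (rule infsum_le_finite_sums)
  fix F :: "int set" assume F: "finite F"
  have "(cmod (coord (weight_down 1 x) k))\<^sup>2
      \<le> 4 * (e * (cmod (coord x k))\<^sup>2 + (1 / e) powr s * (cmod (coord (weight_down s x) k))\<^sup>2)" for k
  proof -
    have "(cmod (coord (weight_down 1 x) k))\<^sup>2 = (cmod (coord x k))\<^sup>2 * (1 / (sobolev_weight 1 k)\<^sup>2)"
      by (simp add: norm_divide power_divide)
    also have "1 / (sobolev_weight 1 k)\<^sup>2 \<le> 4 * (1 / (bracket k)\<^sup>2)"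
    proof -
      have "(bracket k)\<^sup>2 \<le> (2 * sobolev_weight 1 k)\<^sup>2" by (intro power_mono sobolev_weight_one_bounds) auto
      moreover have "0 < (bracket k)\<^sup>2" "0 < (sobolev_weight 1 k)\<^sup>2" by (rule zero_less_power, simp)+
      ultimately show ?thesis by (simp add: field_simps)
    qed
    also have "\<dots> \<le> 4 * (e + (1 / e) powr s / (sobolev_weight s k)\<^sup>2)"
      using bracket_inverse_sq_interpolation[OF e s] by (intro mult_left_mono) auto
    finally have "(cmod (coord (weight_down 1 x) k))\<^sup>2
        \<le> (cmod (coord x k))\<^sup>2 * (4 * (e + (1 / e) powr s / (sobolev_weight s k)\<^sup>2))"
      by (simp add: mult_left_mono)
    also have "\<dots> = 4 * (e * (cmod (coord x k))\<^sup>2 + (1 / e) powr s * (cmod (coord (weight_down s x) k))\<^sup>2)"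
      using s by (simp add: norm_divide power_divide algebra_simps)
    finally show ?thesis .
  qed
  then have "(\<Sum>k\<in>F. (cmod (coord (weight_down 1 x) k))\<^sup>2)
      \<le> (\<Sum>k\<in>F. 4 * (e * (cmod (coord x k))\<^sup>2 + (1 / e) powr s * (cmod (coord (weight_down s x) k))\<^sup>2))"
    by (intro sum_mono)
  also have "\<dots> = 4 * (e * (\<Sum>k\<in>F. (cmod (coord x k))\<^sup>2) + (1 / e) powr s * (\<Sum>k\<in>F. (cmod (coord (weight_down s x) k))\<^sup>2))"
    by (simp add: sum_distrib_left sum.distrib)
  also have "\<dots> \<le> 4 * (e * (norm x)\<^sup>2 + (1 / e) powr s * (norm (weight_down s x))\<^sup>2)"
    using e by (intro mult_left_mono add_mono ell2_finite_sum_le F) auto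
  finally show "(\<Sum>k\<in>F. (cmod (coord (weight_down 1 x) k))\<^sup>2)
      \<le> 4 * (e * (norm x)\<^sup>2 + (1 / e) powr s * (norm (weight_down s x))\<^sup>2)" .
qed (rule coord_summable)

lemma exists_vector_with_finite_support:
  assumes "finite S"
  obtains d where "\<And>k. coord d k = (if k \<in> S then f k else 0)"
proof -
  have "(\<lambda>k. (cmod (if k \<in> S then f k else 0))\<^sup>2) summable_on UNIV"
  proof (rule square_summableI)
    fix F :: "int set" assume "finite F"
    then have "(\<Sum>k\<in>F. (cmod (if k \<in> S then f k else 0))\<^sup>2) = (\<Sum>k\<in>F \<inter> S. (cmod (f k))\<^sup>2)"
      by (intro sum.mono_neutral_cong_right) auto
    also have "\<dots> \<le> (\<Sum>k\<in>S. (cmod (f k))\<^sup>2)" by (intro sum_mono2 assms) auto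
    finally show "(\<Sum>k\<in>F. (cmod (if k \<in> S then f k else 0))\<^sup>2) \<le> (\<Sum>k\<in>S. (cmod (f k))\<^sup>2)" .
  qed
  then show thesis by (intro that[of "Abs_ell2 (\<lambda>k. if k \<in> S then f k else 0)"]) (simp add: coord_Abs_ell2)
qed

context damping
begin

text \<open>The feedback in the coordinates of \<open>H\<^sup>s\<close>.\<close>

definition weighted :: "real \<Rightarrow> int \<Rightarrow> int \<Rightarrow> complex" where
  "weighted s k l = of_real (sobolev_weight s k / sobolev_weight s l) * b k l"

text \<open>The factor \<open>\<langle>l\<rangle>\<close> expresses that the commutator of the feedback with the weight gains one derivative.\<close>

definition commutator :: "real \<Rightarrow> int \<Rightarrow> int \<Rightarrow> complex" where
  "commutator s k l = (weighted s k l - b k l) * of_real (sobolev_weight 1 l)"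

lemma rapid_powr:
  assumes "0 \<le> s"
  shows "\<exists>C\<ge>0. \<forall>k l. bracket (k - l) powr s * cmod (b k l) \<le> C / (bracket (k - l))\<^sup>2"
proof -
  obtain n :: nat where n: "s \<le> real n" using real_arch_simple by blast
  obtain C where C: "C \<ge> 0" "\<And>k l. cmod (b k l) \<le> C / bracket (k - l) ^ (n + 2)" using rapid[of "n + 2"] by blast
  have "bracket (k - l) powr s * cmod (b k l) \<le> C / (bracket (k - l))\<^sup>2" for k l
  proof -
    have "bracket (k - l) powr s \<le> bracket (k - l) powr real n" using n bracket_ge1 by (rule powr_mono)
    also have "\<dots> = bracket (k - l) ^ n" by (simp add: powr_realpow)
    finally have "bracket (k - l) powr s * cmod (b k l) \<le> bracket (k - l) ^ n * (C / bracket (k - l) ^ (n + 2))"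
      using C(2)[of k l] by (intro mult_mono) auto
    also have "\<dots> = C / (bracket (k - l))\<^sup>2"
      using bracket_pos[of "k - l"] by (simp add: power_add power2_eq_square del: bracket_pos)
    finally show ?thesis .
  qed
  then show ?thesis using C(1) by blast
qed

lemma offdiag_weighted:
  assumes s: "0 \<le> s"
  shows "\<exists>C. offdiag C (weighted s)"
proof -
  obtain C where C: "C \<ge> 0" "\<And>k l. bracket (k - l) powr s * cmod (b k l) \<le> C / (bracket (k - l))\<^sup>2"
    using rapid_powr[OF s] by blast
  have "cmod (weighted s k l) \<le> bracket (k - l) powr s * cmod (b k l)" for k l
  proof -
    have "cmod (weighted s k l) = sobolev_weight s k / sobolev_weight s l * cmod (b k l)"
      by (simp add: weighted_def norm_mult norm_divide)
    then show ?thesis using sobolev_weight_ratio[OF s, of k l] by (simp only: mult_right_mono norm_ge_zero)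
  qed
  then have "offdiag C (weighted s)" using C unfolding offdiag_def by (meson order_trans)
  then show ?thesis by blast
qed

lemma offdiag_commutator:
  assumes s: "0 \<le> s"
  shows "\<exists>C. offdiag C (commutator s)"
proof -
  obtain C where C: "C \<ge> 0" "\<And>k l. bracket (k - l) powr (s + 2) * cmod (b k l) \<le> C / (bracket (k - l))\<^sup>2"
    using rapid_powr[of "s + 2"] s by auto
  have "cmod (commutator s k l) \<le> 2 * s * C / (bracket (k - l))\<^sup>2" for k l
  proof -
    have "commutator s k l = of_real ((sobolev_weight s k / sobolev_weight s l - 1) * sobolev_weight 1 l) * b k l"
      by (simp add: commutator_def weighted_def algebra_simps)
    then have "cmod (commutator s k l) = \<bar>sobolev_weight s k / sobolev_weight s l - 1\<bar> * sobolev_weight 1 l * cmod (b k l)"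
      by (simp only: norm_mult norm_of_real abs_mult) simp
    also have "\<dots> \<le> \<bar>sobolev_weight s k / sobolev_weight s l - 1\<bar> * bracket l * cmod (b k l)"
      by (intro mult_right_mono mult_left_mono sobolev_weight_one_bounds) auto
    also have "\<dots> \<le> 2 * s * bracket (k - l) powr (s + 2) * cmod (b k l)"
      by (intro mult_right_mono sobolev_weight_commutator s) auto
    also have "\<dots> \<le> 2 * s * (C / (bracket (k - l))\<^sup>2)"
      using C(2)[of k l] mult_left_mono[OF C(2)[of k l], of "2 * s"] s by (simp add: mult.assoc)
    finally show ?thesis by simp
  qed
  then have "offdiag (2 * s * C) (commutator s)" using s C(1) by (simp add: offdiag_def)
  then show ?thesis by blast
qed

lemma weighted_zero [simp]: "weighted 0 = b"
  by (intro ext) (simp add: weighted_def)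

lemma mat_app_weighted_down:
  assumes s: "0 \<le> s"
  shows "weight_down s (mat_app (weighted s) x) = mat_app b (weight_down s x)"
proof (rule ell2_eqI)
  fix k
  obtain C where C: "offdiag C (weighted s)" using offdiag_weighted[OF s] by blast
  have "coord (weight_down s (mat_app (weighted s) x)) k = (\<Sum>\<^sub>\<infinity>l. weighted s k l * coord x l / of_real (sobolev_weight s k))"
    using s by (simp add: coord_mat_app[OF C] divide_inverse infsum_cmult_left')
  also have "\<dots> = coord (mat_app b (weight_down s x)) k"
    unfolding coord_mat_app[OF offdiag_b]
    by (intro infsum_cong) (use s in \<open>simp add: weighted_def field_simps\<close>)
  finally show "coord (weight_down s (mat_app (weighted s) x)) k = coord (mat_app b (weight_down s x)) k" .
qed

lemma mat_app_weighted_split: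
  assumes s: "0 \<le> s"
  shows "mat_app (weighted s) x = mat_app b x + mat_app (commutator s) (weight_down 1 x)"
proof (rule ell2_eqI)
  fix k
  obtain C C' where C: "offdiag C (weighted s)" "offdiag C' (commutator s)"
    using offdiag_weighted[OF s] offdiag_commutator[OF s] by blast
  have "coord (mat_app b x + mat_app (commutator s) (weight_down 1 x)) k
     = (\<Sum>\<^sub>\<infinity>l. b k l * coord x l + commutator s k l * coord (weight_down 1 x) l)"
    by (simp add: coord_mat_app[OF offdiag_b] coord_mat_app[OF C(2)] infsum_add
        offdiag_row_summable[OF offdiag_b] offdiag_row_summable[OF C(2), of k "weight_down 1 x", simplified])
  also have "\<dots> = coord (mat_app (weighted s) x) k"
    unfolding coord_mat_app[OF C(1)] by (intro infsum_cong) (simp add: commutator_def algebra_simps)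
  finally show "coord (mat_app (weighted s) x) k = coord (mat_app b x + mat_app (commutator s) (weight_down 1 x)) k" ..
qed

text \<open>The equation is imposed on each coordinate, because a trajectory need not be differentiable as a curve in the Hilbert
space: the dispersion relation is unbounded.\<close>

definition trajectory :: "real \<Rightarrow> real \<Rightarrow> (real \<Rightarrow> ell2) \<Rightarrow> bool" where
  "trajectory \<alpha> s z \<longleftrightarrow> continuous_on {0..} z \<and> (\<forall>t\<ge>0. coord (z t) 0 = 0) \<and>
     (\<forall>t>0. \<forall>k. ((\<lambda>t. coord (z t) k) has_vector_derivative
        \<i> * of_real (dispersion \<alpha> k) * coord (z t) k - coord (mat_app (weighted s) (z t)) k) (at t))"

text \<open>A trajectory in \<open>H\<^sup>s\<close> is one in \<open>L\<^sup>2\<close>, to which the unweighted Lyapunov estimate applies.\<close>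

lemma trajectory_weight_down:
  assumes s: "0 \<le> s" and z: "trajectory \<alpha> s z"
  shows "trajectory \<alpha> 0 (\<lambda>t. weight_down s (z t))"
  unfolding trajectory_def
proof (intro conjI allI impI)
  show "continuous_on {0..} (\<lambda>t. weight_down s (z t))"
    using z by (intro bounded_linear.continuous_on[OF bounded_linear_weight_down[OF s]]) (simp add: trajectory_def)
  show "coord (weight_down s (z t)) 0 = 0" if "0 \<le> t" for t using z that s by (simp add: trajectory_def)
  fix t :: real and k assume "0 < t"
  then have "((\<lambda>t. coord (z t) k) has_vector_derivative
        \<i> * of_real (dispersion \<alpha> k) * coord (z t) k - coord (mat_app (weighted s) (z t)) k) (at t)"
    using z by (simp add: trajectory_def)
  from bounded_linear.has_vector_derivative[OF bounded_linear_divide[of "of_real (sobolev_weight s k)"] this]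
  show "((\<lambda>t. coord (weight_down s (z t)) k) has_vector_derivative
        \<i> * of_real (dispersion \<alpha> k) * coord (weight_down s (z t)) k -
        coord (mat_app (weighted 0) (weight_down s (z t))) k) (at t)"
    using s by (simp add: mat_app_weighted_down[OF s, symmetric] diff_divide_distrib)
qed

text \<open>The functional is evaluated on finitely many frequencies, where it is differentiable in time. The truncation enters the
estimate only through the difference of the two feedback terms.\<close>

lemma lyapunov_along_trajectory:
  assumes s: "0 \<le> s" and z: "trajectory \<alpha> s z" and S: "finite S" "0 \<notin> S" and t: "0 < t"
  shows "\<exists>y. ((\<lambda>t. lyapunov \<alpha> (trunc S (z t))) has_real_derivative y) (at t) \<and>
    y \<le> - (c0 / 4) * (trunc S (z t) \<bullet> trunc S (z t))
      + C3 * (norm (mat_app (weighted s) (z t) - mat_app b (trunc S (z t))))\<^sup>2"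
proof -
  define x where "x = (\<lambda>t. trunc S (z t))"
  define r where "r = mat_app (weighted s) (z t) - mat_app b (x t)"
  obtain y where y: "\<And>k. coord y k = (if k \<in> S then \<i> * of_real (dispersion \<alpha> k) * coord (z t) k else 0)"
    using exists_vector_with_finite_support[OF S(1), of "\<lambda>k. \<i> * of_real (dispersion \<alpha> k) * coord (z t) k"] by blast
  define d where "d = y - trunc S (mat_app b (x t) + r)"
  have "(x has_vector_derivative d) (at t)"
    by (rule has_vector_derivative_finite_support[OF S(1)])
       (use z t in \<open>auto simp: x_def d_def y r_def trajectory_def\<close>)
  then have dx: "(x has_derivative (\<lambda>h. h *\<^sub>R d)) (at t)" by (simp add: has_vector_derivative_def)
  have lin: "bounded_linear (mat_app (corrector \<alpha>))" by (rule bounded_linear_mat_app[OF offdiag_corrector])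
  have "((\<lambda>t. lyapunov \<alpha> (x t)) has_real_derivative
     2 * K0 * (x t \<bullet> d) + mat_app (corrector \<alpha>) (x t) \<bullet> d + mat_app (corrector \<alpha>) d \<bullet> x t) (at t)"
    unfolding lyapunov_def has_field_derivative_def
    by (rule derivative_eq_intros bounded_linear.has_derivative[OF lin] dx refl)+
       (simp add: fun_eq_iff inner_commute bounded_linear.linear[OF lin] linear_scale algebra_simps)
  moreover have "2 * K0 * (x t \<bullet> d) + mat_app (corrector \<alpha>) (x t) \<bullet> d + mat_app (corrector \<alpha>) d \<bullet> x t
     \<le> - (c0 / 4) * (x t \<bullet> x t) + C3 * (norm r)\<^sup>2"
    by (rule lyapunov_derivative_bound[OF S _ _ d_def]) (auto simp: x_def y)
  ultimately show ?thesis unfolding x_def r_def by blast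
qed

definition N0 :: real where "N0 = K0 + NB"

lemma N0_pos: "0 < N0"
proof -
  have "0 \<le> 2 * NB\<^sup>2 * C1 / c0" using c0 C1 by simp
  moreover have "0 < NB + 1 + (1 + t) / 2 + NB" if "0 \<le> t" for t
    using NB_nonneg divide_nonneg_pos[of "1 + t" 2] that by linarith
  ultimately show ?thesis unfolding N0_def K0_def by blast
qed

definition decay_rate :: real where "decay_rate = c0 / (8 * N0)"

lemma decay_rate_pos: "0 < decay_rate"
  using N0_pos c0 by (simp add: decay_rate_def)

text \<open>The functional is \<open>W = V(z) + L V(u)\<close>, where \<open>u\<close> is the trajectory seen in \<open>L\<^sup>2\<close> and \<open>V\<close> is the Lyapunov functional on
truncated states. The commutator error in \<open>V(z)\<close> splits into a part below the decay of \<open>V(z)\<close> and a part that the decay of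
\<open>L V(u)\<close> absorbs. The truncation error is uniformly small on compact time intervals, by compactness of the
trajectory.\<close>

lemma trajectory_decay:
  assumes s: "0 \<le> s"
  shows "\<exists>M>0. \<forall>\<alpha> z. trajectory \<alpha> s z \<longrightarrow>
    (\<forall>t\<ge>0. (norm (z t))\<^sup>2 \<le> M * exp (- decay_rate * t) * (norm (z 0))\<^sup>2)"
proof -
  obtain C C' where C: "offdiag C (weighted s)" and C': "offdiag C' (commutator s)"
    using offdiag_weighted[OF s] offdiag_commutator[OF s] by blast
  define A where "A = C * bracket_sum"
  define A' where "A' = C' * bracket_sum"
  have A0: "0 \<le> A" "0 \<le> A'" using C C' bracket_sum_nonneg by (auto simp: A_def A'_def offdiag_def)
  have C3: "0 \<le> C3" using c0 by (simp add: C3_def)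
  \<comment> \<open>The interpolation parameter: half of the decay of the weighted functional covers the commutator.\<close>
  define e where "e = c0 / (8 * (8 * C3 * A'\<^sup>2 + 1))"
  have den: "0 < 8 * C3 * A'\<^sup>2 + 1" using C3 by (intro add_nonneg_pos) auto
  have e: "0 < e" using c0 den by (simp add: e_def)
  have eb: "8 * C3 * A'\<^sup>2 * e \<le> c0 / 8"
  proof -
    have "8 * C3 * A'\<^sup>2 * e \<le> (8 * C3 * A'\<^sup>2 + 1) * e" using e by (simp add: distrib_right)
    also have "\<dots> = c0 / 8"
    proof -
      have "d * (c0 / (8 * d)) = c0 / 8" if "0 < d" for d :: real using that by simp
      from this[OF den] show ?thesis unfolding e_def .
    qed
    finally show ?thesis .
  qed
  \<comment> \<open>The commutator error in the unweighted norm equals half of the decay of \<open>L\<close> times the unweighted functional.\<close>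
  define L where "L = 8 * (8 * C3 * A'\<^sup>2 * (1 / e) powr s) / c0"
  have L0: "0 \<le> L" using C3 c0 by (simp add: L_def)
  have Lb: "8 * C3 * A'\<^sup>2 * (1 / e) powr s = L * c0 / 8" using c0 by (simp add: L_def)
  define R where "R = C3 * (2 * A\<^sup>2 + L * NB\<^sup>2)"
  have R0: "0 \<le> R" using C3 L0 by (simp add: R_def)
  define M where "M = N0 * (1 + L)"
  have M: "0 < M" using N0_pos L0 by (simp add: M_def)
  have "(norm (z t))\<^sup>2 \<le> M * exp (- decay_rate * t) * (norm (z 0))\<^sup>2"
    if z: "trajectory \<alpha> s z" and t: "0 \<le> t" for \<alpha> z t
  proof (rule field_le_epsilon)
    fix \<epsilon> :: real assume \<epsilon>: "0 < \<epsilon>"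
    define q where "q = 1 + R / decay_rate"
    have q: "q > 0" using R0 decay_rate_pos by (simp add: q_def add_pos_nonneg)
    \<comment> \<open>The truncation error accumulates to at most \<open>q \<delta>\<^sup>2\<close>.\<close>
    define \<delta> where "\<delta> = sqrt (\<epsilon> / q)"
    have \<delta>: "\<delta> > 0" "\<delta>\<^sup>2 = \<epsilon> / q" using \<epsilon> q by (auto simp: \<delta>_def)
    have zc: "continuous_on {0..} z" and z0: "\<And>t. 0 \<le> t \<Longrightarrow> coord (z t) 0 = 0"
      using z by (auto simp: trajectory_def)
    have "compact (z ` {0..t})"
      by (rule compact_continuous_image) (auto intro: continuous_on_subset[OF zc])
    from trunc_uniform_on_compact[OF this \<delta>(1)] obtain S0 where S0: "finite S0"
      "\<And>x. x \<in> z ` {0..t} \<Longrightarrow> norm (x - trunc S0 x) < \<delta>" by blast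
    \<comment> \<open>The coordinate \<open>0\<close> of a trajectory vanishes, so it may be removed from the truncation.\<close>
    define S where "S = S0 - {0}"
    have S: "finite S" "0 \<notin> S" using S0 by (auto simp: S_def)
    have Se: "norm (z r - trunc S (z r)) \<le> \<delta>" if "r \<in> {0..t}" for r
    proof -
      have "trunc S (z r) = trunc S0 (z r)" by (rule ell2_eqI) (use z0[of r] that in \<open>auto simp: S_def\<close>)
      then show ?thesis using S0(2)[of "z r"] that by simp
    qed
    define u where "u = (\<lambda>t. weight_down s (z t))"
    have u: "trajectory \<alpha> 0 u" unfolding u_def by (rule trajectory_weight_down[OF s z])
    define W where "W = (\<lambda>t. lyapunov \<alpha> (trunc S (z t)) + L * lyapunov \<alpha> (trunc S (u t)))"
    have "W t + R * \<delta>\<^sup>2 / (- decay_rate) \<le> (W 0 + R * \<delta>\<^sup>2 / (- decay_rate)) * exp (- decay_rate * t)"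
    proof (rule gronwall_affine[OF t])
      show "- decay_rate \<noteq> 0" using decay_rate_pos by simp
      have uc: "continuous_on {0..} u" using u by (simp add: trajectory_def)
      have "continuous_on {0..t} z" "continuous_on {0..t} u"
        by (auto intro: continuous_on_subset[OF zc] continuous_on_subset[OF uc])
      then show "continuous_on {0..t} W" unfolding W_def lyapunov_def
        by (intro continuous_intros bounded_linear.continuous_on[OF bounded_linear_trunc]
            bounded_linear.continuous_on[OF bounded_linear_mat_app[OF offdiag_corrector]])
      fix r assume r: "0 < r" "r < t"
      define x where "x = trunc S (z r)"
      define x0 where "x0 = trunc S (u r)"
      have x0: "x0 = weight_down s x" unfolding x0_def x_def u_def by (rule ell2_eqI) (use s in auto)
      obtain y1 where y1: "((\<lambda>t. lyapunov \<alpha> (trunc S (z t))) has_real_derivative y1) (at r)"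
        "y1 \<le> - (c0 / 4) * (x \<bullet> x) + C3 * (norm (mat_app (weighted s) (z r) - mat_app b x))\<^sup>2"
        using lyapunov_along_trajectory[OF s z S r(1)] unfolding x_def by blast
      obtain y2 where y2: "((\<lambda>t. lyapunov \<alpha> (trunc S (u t))) has_real_derivative y2) (at r)"
        "y2 \<le> - (c0 / 4) * (x0 \<bullet> x0) + C3 * (norm (mat_app b (u r) - mat_app b x0))\<^sup>2"
        using lyapunov_along_trajectory[OF order_refl u S r(1)] unfolding x0_def by auto
      have zx: "norm (z r - x) \<le> \<delta>" using Se[of r] r by (simp add: x_def)
      have "norm (mat_app (weighted s) (z r) - mat_app b x)
         = norm (mat_app (weighted s) (z r - x) + mat_app (commutator s) (weight_down 1 x))"
        by (subst linear_diff[OF bounded_linear.linear[OF bounded_linear_mat_app[OF C]]])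
           (simp add: mat_app_weighted_split[OF s, of x])
      also have "\<dots> \<le> A * norm (z r - x) + A' * norm (weight_down 1 x)"
        unfolding A_def A'_def by (intro order_trans[OF norm_triangle_ineq] add_mono mat_app_norm_le C C')
      also have "\<dots> \<le> A * \<delta> + A' * norm (weight_down 1 x)"
        using zx A0 by (intro add_right_mono mult_left_mono) auto
      finally have "(norm (mat_app (weighted s) (z r) - mat_app b x))\<^sup>2 \<le> (A * \<delta> + A' * norm (weight_down 1 x))\<^sup>2"
        by (rule power_mono) simp
      also have "\<dots> \<le> 2 * A\<^sup>2 * \<delta>\<^sup>2 + 2 * A'\<^sup>2 * (norm (weight_down 1 x))\<^sup>2"
        using sum_squares_bound[of "A * \<delta>" "A' * norm (weight_down 1 x)"] by (simp add: power2_sum power_mult_distrib)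
      also have "\<dots> \<le> 2 * A\<^sup>2 * \<delta>\<^sup>2 + 2 * A'\<^sup>2 * (4 * (e * (norm x)\<^sup>2 + (1 / e) powr s * (norm x0)\<^sup>2))"
        unfolding x0 by (intro add_left_mono mult_left_mono weight_down_bracket_interpolation s e) auto
      finally have "C3 * (norm (mat_app (weighted s) (z r) - mat_app b x))\<^sup>2
         \<le> C3 * (2 * A\<^sup>2 * \<delta>\<^sup>2 + 2 * A'\<^sup>2 * (4 * (e * (norm x)\<^sup>2 + (1 / e) powr s * (norm x0)\<^sup>2)))"
        using C3 by (rule mult_left_mono)
      also have "\<dots> = C3 * 2 * A\<^sup>2 * \<delta>\<^sup>2 + (8 * C3 * A'\<^sup>2 * e) * (norm x)\<^sup>2 + (8 * C3 * A'\<^sup>2 * (1 / e) powr s) * (norm x0)\<^sup>2"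
        by (simp add: algebra_simps)
      also have "\<dots> \<le> C3 * 2 * A\<^sup>2 * \<delta>\<^sup>2 + (c0 / 8) * (norm x)\<^sup>2 + (L * c0 / 8) * (norm x0)\<^sup>2"
        unfolding Lb by (intro add_mono mult_right_mono eb order_refl) auto
      finally have b1: "C3 * (norm (mat_app (weighted s) (z r) - mat_app b x))\<^sup>2
        \<le> C3 * 2 * A\<^sup>2 * \<delta>\<^sup>2 + (c0 / 8) * (norm x)\<^sup>2 + (L * c0 / 8) * (norm x0)\<^sup>2" .
      have "norm (mat_app b (u r) - mat_app b x0) \<le> NB * \<delta>"
      proof -
        have "mat_app b (u r) - mat_app b x0 = mat_app b (weight_down s (z r - x))"
          unfolding x0 u_def
          by (simp add: linear_diff[OF bounded_linear.linear[OF bounded_linear_mat_app[OF offdiag_b]]]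
              linear_diff[OF bounded_linear.linear[OF bounded_linear_weight_down[OF s]]])
        also have "norm \<dots> \<le> NB * norm (weight_down s (z r - x))"
          unfolding NB_def by (rule mat_app_norm_le[OF offdiag_b])
        also have "\<dots> \<le> NB * \<delta>"
          using norm_weight_down_le[OF s, of "z r - x"] zx NB_nonneg by (intro mult_left_mono) auto
        finally show ?thesis .
      qed
      then have "(norm (mat_app b (u r) - mat_app b x0))\<^sup>2 \<le> (NB * \<delta>)\<^sup>2" by (rule power_mono) simp
      then have "C3 * (norm (mat_app b (u r) - mat_app b x0))\<^sup>2 \<le> C3 * (NB\<^sup>2 * \<delta>\<^sup>2)"
        using C3 by (intro mult_left_mono) (auto simp: power_mult_distrib)
      with y2(2) have "y2 \<le> - (c0 / 4) * (x0 \<bullet> x0) + C3 * (NB\<^sup>2 * \<delta>\<^sup>2)" by linarith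
      then have Ly2: "L * y2 \<le> L * (- (c0 / 4) * (x0 \<bullet> x0) + C3 * (NB\<^sup>2 * \<delta>\<^sup>2))"
        using L0 by (rule mult_left_mono)
      have "y1 + L * y2 \<le> - (c0 / 4) * (x \<bullet> x) + (C3 * 2 * A\<^sup>2 * \<delta>\<^sup>2 + (c0 / 8) * (norm x)\<^sup>2 + (L * c0 / 8) * (norm x0)\<^sup>2)
          + L * (- (c0 / 4) * (x0 \<bullet> x0) + C3 * (NB\<^sup>2 * \<delta>\<^sup>2))"
        using y1(2) b1 Ly2 by linarith
      also have "\<dots> = - (c0 / 8) * (x \<bullet> x + L * (x0 \<bullet> x0)) + R * \<delta>\<^sup>2"
        by (simp add: power2_norm_eq_inner R_def algebra_simps)
      also have "\<dots> \<le> - decay_rate * W r + R * \<delta>\<^sup>2"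
      proof -
        have "W r \<le> N0 * (x \<bullet> x) + L * (N0 * (x0 \<bullet> x0))"
          using lyapunov_bounds(2)[of \<alpha> x] mult_left_mono[OF lyapunov_bounds(2)[of \<alpha> x0] L0]
          by (simp add: W_def N0_def x_def x0_def)
        then have "decay_rate * W r \<le> decay_rate * (N0 * (x \<bullet> x) + L * (N0 * (x0 \<bullet> x0)))"
          using decay_rate_pos by (intro mult_left_mono) auto
        also have "\<dots> = (decay_rate * N0) * (x \<bullet> x + L * (x0 \<bullet> x0))" by (simp add: algebra_simps)
        also have "decay_rate * N0 = c0 / 8" using N0_pos by (simp add: decay_rate_def)
        finally show ?thesis by simp
      qed
      finally show "\<exists>y. (W has_real_derivative y) (at r) \<and> y \<le> - decay_rate * W r + R * \<delta>\<^sup>2"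
        unfolding W_def using y1(1) y2(1)
        by (intro exI[of _ "y1 + L * y2"]) (auto intro!: derivative_eq_intros)
    qed
    then have "W t - R * \<delta>\<^sup>2 / decay_rate \<le> W 0 * exp (- decay_rate * t) - R * \<delta>\<^sup>2 / decay_rate * exp (- decay_rate * t)"
      by (simp add: left_diff_distrib)
    moreover have "0 \<le> R * \<delta>\<^sup>2 / decay_rate * exp (- decay_rate * t)" using R0 decay_rate_pos by simp
    ultimately have Wt: "W t \<le> W 0 * exp (- decay_rate * t) + R * \<delta>\<^sup>2 / decay_rate" by linarith
    have W0: "W 0 \<le> M * (norm (z 0))\<^sup>2"
    proof -
      have "norm (trunc S (u 0)) \<le> norm (z 0)"
        unfolding u_def by (rule order_trans[OF norm_trunc_le norm_weight_down_le[OF s]])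
      then have "trunc S (u 0) \<bullet> trunc S (u 0) \<le> (norm (z 0))\<^sup>2" by (simp flip: power2_norm_eq_inner)
      moreover have "trunc S (z 0) \<bullet> trunc S (z 0) \<le> (norm (z 0))\<^sup>2"
        using norm_trunc_le[of S "z 0"] by (simp flip: power2_norm_eq_inner)
      ultimately have "N0 * (trunc S (z 0) \<bullet> trunc S (z 0)) + L * (N0 * (trunc S (u 0) \<bullet> trunc S (u 0)))
          \<le> N0 * (norm (z 0))\<^sup>2 + L * (N0 * (norm (z 0))\<^sup>2)"
        using N0_pos L0 by (intro add_mono mult_left_mono) auto
      moreover have "W 0 \<le> N0 * (trunc S (z 0) \<bullet> trunc S (z 0)) + L * (N0 * (trunc S (u 0) \<bullet> trunc S (u 0)))"
        using lyapunov_bounds(2)[of \<alpha> "trunc S (z 0)"] mult_left_mono[OF lyapunov_bounds(2)[of \<alpha> "trunc S (u 0)"] L0]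
        by (simp add: W_def N0_def)
      ultimately show ?thesis by (simp add: M_def algebra_simps)
    qed
    have "(norm (z t))\<^sup>2 = (norm (trunc S (z t)))\<^sup>2 + (norm (z t - trunc S (z t)))\<^sup>2"
      using norm_sub_trunc_sq[OF S(1), of "z t"] norm_finite_support[OF S(1), of "trunc S (z t)"] by simp
    also have "\<dots> \<le> W t + \<delta>\<^sup>2"
    proof (rule add_mono)
      show "(norm (z t - trunc S (z t)))\<^sup>2 \<le> \<delta>\<^sup>2" using Se[of t] t by (intro power_mono) auto
      have "0 \<le> lyapunov \<alpha> (trunc S (u t))" by (rule order_trans[OF inner_ge_zero lyapunov_bounds(1)])
      then show "(norm (trunc S (z t)))\<^sup>2 \<le> W t"
        using lyapunov_bounds(1)[of "trunc S (z t)" \<alpha>] L0 by (simp add: W_def power2_norm_eq_inner add_increasing2)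
    qed
    also have "\<dots> \<le> M * (norm (z 0))\<^sup>2 * exp (- decay_rate * t) + R * \<delta>\<^sup>2 / decay_rate + \<delta>\<^sup>2"
    proof -
      have "W 0 * exp (- decay_rate * t) \<le> M * (norm (z 0))\<^sup>2 * exp (- decay_rate * t)"
        by (rule mult_right_mono[OF W0]) simp
      then show ?thesis using Wt by linarith
    qed
    also have "\<dots> = M * (norm (z 0))\<^sup>2 * exp (- decay_rate * t) + q * \<delta>\<^sup>2" by (simp add: q_def algebra_simps)
    also have "q * \<delta>\<^sup>2 = \<epsilon>" using q by (simp add: \<delta>(2))
    finally show "(norm (z t))\<^sup>2 \<le> M * exp (- decay_rate * t) * (norm (z 0))\<^sup>2 + \<epsilon>" by (simp add: mult_ac)
  qed
  then show ?thesis using M by blast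
qed

end

section \<open>Mild solutions in coordinates\<close>

lemma has_vector_derivative_cis:
  "((\<lambda>t. cis (a * t)) has_vector_derivative \<i> * of_real a * cis (a * t)) (at t within A)"
proof -
  have "((\<lambda>z. exp (\<i> * of_real a * z)) has_field_derivative exp (\<i> * of_real a * of_real t) * (\<i> * of_real a)) (at (of_real t))"
    by (auto intro!: derivative_eq_intros)
  from has_vector_derivative_real_field[OF this, of A] show ?thesis
    by (simp add: cis_conv_exp mult_ac)
qed

context damping
begin

abbreviation flow :: "real \<Rightarrow> real \<Rightarrow> ell2 \<Rightarrow> ell2" where
  "flow \<alpha> t \<equiv> phase (\<lambda>k. t * dispersion \<alpha> k)"

lemma flow_inverse [simp]: "flow \<alpha> t (flow \<alpha> (- t) x) = x" "flow \<alpha> (- t) (flow \<alpha> t x) = x"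
  by (simp_all add: phase_phase)

definition mild :: "real \<Rightarrow> real \<Rightarrow> ell2 \<Rightarrow> (real \<Rightarrow> ell2) \<Rightarrow> bool" where
  "mild \<alpha> s z0 z \<longleftrightarrow> continuous_on {0..} z \<and>
     (\<forall>t\<ge>0. \<exists>J. ((\<lambda>r. flow \<alpha> (t - r) (mat_app (weighted s) (z r))) has_integral J) {0..t} \<and>
       z t = flow \<alpha> t z0 - J)"

definition rotated :: "real \<Rightarrow> real \<Rightarrow> real \<Rightarrow> ell2 \<Rightarrow> ell2" where
  "rotated \<alpha> s t x = - flow \<alpha> (- t) (mat_app (weighted s) (flow \<alpha> t x))"

lemma bounded_linear_weighted: "0 \<le> s \<Longrightarrow> bounded_linear (mat_app (weighted s))"
  using offdiag_weighted bounded_linear_mat_app by blast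

lemma linear_rotated:
  assumes "0 \<le> s"
  shows "linear (rotated \<alpha> s t)"
  unfolding rotated_def
  by (intro linear_compose_neg bounded_linear.linear bounded_linear_compose[OF bounded_linear_phase]
      bounded_linear_compose[OF bounded_linear_weighted[OF assms]] bounded_linear_phase)

lemma rotated_bound:
  assumes "0 \<le> s"
  shows "\<exists>C. \<forall>t x. norm (rotated \<alpha> s t x) \<le> C * norm x"
proof -
  obtain C where "offdiag C (weighted s)" using offdiag_weighted[OF assms] by blast
  from mat_app_norm_le[OF this] have "norm (rotated \<alpha> s t x) \<le> C * bracket_sum * norm x" for t x
    by (metis norm_minus_cancel norm_phase rotated_def)
  then show ?thesis by blast
qed

lemma rotated_continuous:
  assumes s: "0 \<le> s" and w: "continuous_on {0..} w"
  shows "continuous_on {0..} (\<lambda>t. rotated \<alpha> s t (w t))"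
  unfolding rotated_def
  using continuous_on_phase[OF bounded_linear.continuous_on[OF bounded_linear_weighted[OF s]
      continuous_on_phase[OF w, of "dispersion \<alpha>"]], of "\<lambda>k. - dispersion \<alpha> k"]
  by (intro continuous_on_minus) simp

text \<open>Undoing the free flow turns the mild equation into a linear equation with bounded coefficients.\<close>

lemma mild_iff_rotated:
  assumes s: "0 \<le> s"
  shows "mild \<alpha> s z0 z \<longleftrightarrow> continuous_on {0..} z \<and>
    (\<forall>t\<ge>0. flow \<alpha> (- t) (z t) = z0 + integral {0..t} (\<lambda>r. rotated \<alpha> s r (flow \<alpha> (- r) (z r))))"
proof (cases "continuous_on {0..} z")
  case zc: True
  let ?B = "mat_app (weighted s)"
  have "(\<exists>J. ((\<lambda>r. flow \<alpha> (t - r) (?B (z r))) has_integral J) {0..t} \<and> z t = flow \<alpha> t z0 - J) \<longleftrightarrow>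
    flow \<alpha> (- t) (z t) = z0 + integral {0..t} (\<lambda>r. rotated \<alpha> s r (flow \<alpha> (- r) (z r)))"
    if t: "0 \<le> t" for t
  proof -
    have Bc: "continuous_on {0..t} (\<lambda>r. ?B (z r))"
      using bounded_linear.continuous_on[OF bounded_linear_weighted[OF s] zc] by (rule continuous_on_subset) auto
    have rot: "rotated \<alpha> s r (flow \<alpha> (- r) (z r)) = - flow \<alpha> (- r) (?B (z r))" for r
      by (simp add: rotated_def phase_phase)
    define I where "I = integral {0..t} (\<lambda>r. flow \<alpha> (- r) (?B (z r)))"
    have I: "((\<lambda>r. flow \<alpha> (- r) (?B (z r))) has_integral I) {0..t}"
      unfolding I_def using continuous_on_phase[OF Bc, of "\<lambda>k. - dispersion \<alpha> k"]
      by (intro integrable_integral integrable_continuous_real) simp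
    from has_integral_linear[OF this bounded_linear_phase, of "\<lambda>k. t * dispersion \<alpha> k"]
    have J: "((\<lambda>r. flow \<alpha> (t - r) (?B (z r))) has_integral flow \<alpha> t I) {0..t}"
      by (simp add: o_def phase_phase left_diff_distrib)
    have "(\<exists>J. ((\<lambda>r. flow \<alpha> (t - r) (?B (z r))) has_integral J) {0..t} \<and> z t = flow \<alpha> t z0 - J)
      \<longleftrightarrow> z t = flow \<alpha> t z0 - flow \<alpha> t I"
      using J has_integral_unique by blast
    also have "\<dots> \<longleftrightarrow> flow \<alpha> (- t) (z t) = z0 - I"
      by (metis flow_inverse phase_diff)
    also have "\<dots> \<longleftrightarrow> flow \<alpha> (- t) (z t) = z0 + integral {0..t} (\<lambda>r. rotated \<alpha> s r (flow \<alpha> (- r) (z r)))"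
      unfolding rot by (simp add: I_def)
    finally show ?thesis .
  qed
  then show ?thesis using zc by (simp add: mild_def)
qed (simp add: mild_def)

lemma mild_exists:
  assumes s: "0 \<le> s"
  obtains z where "mild \<alpha> s z0 z"
proof -
  obtain C where C: "\<And>t x. norm (rotated \<alpha> s t x) \<le> C * norm x" using rotated_bound[OF s] by blast
  obtain v where v: "continuous_on {0..} v"
    "\<And>t. 0 \<le> t \<Longrightarrow> v t = z0 + integral {0..t} (\<lambda>r. rotated \<alpha> s r (v r))"
    using linear_evolution_exists[of "rotated \<alpha> s" C z0, OF linear_rotated[OF s] C rotated_continuous[OF s]] by blast
  have "mild \<alpha> s z0 (\<lambda>t. flow \<alpha> t (v t))"
    unfolding mild_iff_rotated[OF s] flow_inverse using v continuous_on_phase[OF v(1)] by blast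
  then show thesis using that by blast
qed

lemma mild_unique:
  assumes s: "0 \<le> s" and z: "mild \<alpha> s z0 z" and z': "mild \<alpha> s z0 z'" and t: "0 \<le> t"
  shows "z t = z' t"
proof -
  define v where "v = (\<lambda>t. flow \<alpha> (- t) (z t))"
  define v' where "v' = (\<lambda>t. flow \<alpha> (- t) (z' t))"
  obtain C where C: "\<And>t x. norm (rotated \<alpha> s t x) \<le> C * norm x" using rotated_bound[OF s] by blast
  have v: "continuous_on {0..} v" "\<And>t. 0 \<le> t \<Longrightarrow> v t = z0 + integral {0..t} (\<lambda>r. rotated \<alpha> s r (v r))"
    using z continuous_on_phase[of "{0..}" z "\<lambda>k. - dispersion \<alpha> k"] unfolding mild_iff_rotated[OF s] v_def by auto
  have v': "continuous_on {0..} v'" "\<And>t. 0 \<le> t \<Longrightarrow> v' t = z0 + integral {0..t} (\<lambda>r. rotated \<alpha> s r (v' r))"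
    using z' continuous_on_phase[of "{0..}" z' "\<lambda>k. - dispersion \<alpha> k"] unfolding mild_iff_rotated[OF s] v'_def by auto
  have int: "(\<lambda>r. rotated \<alpha> s r (w r)) integrable_on {0..t}" if "continuous_on {0..} w" for w t
    by (rule integrable_continuous_real) (rule continuous_on_subset[OF rotated_continuous[OF s that]], auto)
  have wc: "continuous_on {0..} (\<lambda>t. v t - v' t)" using v(1) v'(1) by (rule continuous_on_diff)
  have "v t - v' t = 0"
  proof (rule linear_evolution_unique[OF C wc rotated_continuous[OF s wc] _ t])
    fix t :: real assume "0 \<le> t"
    then show "v t - v' t = integral {0..t} (\<lambda>r. rotated \<alpha> s r (v r - v' r))"
      by (simp add: v(2)[of t] v'(2)[of t] linear_diff[OF linear_rotated[OF s]] integral_diff int v(1) v'(1)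
          del: integral_diff) (simp add: integral_diff int v(1) v'(1))
  qed
  then have "flow \<alpha> (- t) (z t) = flow \<alpha> (- t) (z' t)" by (simp add: v_def v'_def)
  then show ?thesis by (metis flow_inverse(1))
qed

lemma mild_coordinate_derivative:
  assumes s: "0 \<le> s" and z: "mild \<alpha> s z0 z" and t: "0 < t"
  shows "((\<lambda>t. coord (z t) k) has_vector_derivative
    \<i> * of_real (dispersion \<alpha> k) * coord (z t) k - coord (mat_app (weighted s) (z t)) k) (at t)"
proof -
  define v where "v = (\<lambda>t. flow \<alpha> (- t) (z t))"
  have vc: "continuous_on {0..} v" and v: "\<And>t. 0 \<le> t \<Longrightarrow> v t = z0 + integral {0..t} (\<lambda>r. rotated \<alpha> s r (v r))"
    using z continuous_on_phase[of "{0..}" z "\<lambda>k. - dispersion \<alpha> k"] unfolding mild_iff_rotated[OF s] v_def by auto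
  have "((\<lambda>t. z0 + integral {0..t} (\<lambda>r. rotated \<alpha> s r (v r))) has_vector_derivative 0 + rotated \<alpha> s t (v t)) (at t)"
    by (intro has_vector_derivative_add has_vector_derivative_const
        integral_from_zero_derivative[OF rotated_continuous[OF s vc] t])
  then have "(v has_vector_derivative 0 + rotated \<alpha> s t (v t)) (at t)"
    by (rule has_vector_derivative_transform_within_open[where S = "{0<..}"]) (use t v[symmetric] in auto)
  then have "(v has_vector_derivative rotated \<alpha> s t (v t)) (at t)" by simp
  from bounded_linear.has_vector_derivative[OF bounded_linear_coord this, of k]
  have dv: "((\<lambda>t. coord (v t) k) has_vector_derivative coord (rotated \<alpha> s t (v t)) k) (at t)" .
  have "((\<lambda>t. cis (t * dispersion \<alpha> k)) has_vector_derivative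
      \<i> * of_real (dispersion \<alpha> k) * cis (t * dispersion \<alpha> k)) (at t)"
    using has_vector_derivative_cis[of "dispersion \<alpha> k" t UNIV] by (simp only: mult.commute[of "dispersion \<alpha> k"])
  from has_vector_derivative_mult[OF this dv]
  have "((\<lambda>t. cis (t * dispersion \<alpha> k) * coord (v t) k) has_vector_derivative
     cis (t * dispersion \<alpha> k) * coord (rotated \<alpha> s t (v t)) k +
     \<i> * of_real (dispersion \<alpha> k) * cis (t * dispersion \<alpha> k) * coord (v t) k) (at t)" .
  moreover have "cis (t * dispersion \<alpha> k) * coord (v t) k = coord (z t) k" for t
    by (simp add: v_def cis_mult mult.assoc[symmetric])
  moreover have "cis (t * dispersion \<alpha> k) * coord (rotated \<alpha> s t (v t)) k = - coord (mat_app (weighted s) (z t)) k"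
    by (simp add: v_def rotated_def phase_phase cis_mult mult.assoc[symmetric])
  ultimately show ?thesis by (simp add: mult.assoc)
qed

lemma mild_initial: "mild \<alpha> s z0 z \<Longrightarrow> z 0 = z0"
  by (auto simp: mild_def dest!: spec[of _ 0] dest: has_integral_unique[OF _ has_integral_refl(2)])

lemma coord_weighted_zero: "0 \<le> s \<Longrightarrow> coord (mat_app (weighted s) x) 0 = 0"
  using offdiag_weighted[of s] by (auto simp: coord_mat_app weighted_def row_zero)

lemma mild_mean_conserved:
  assumes s: "0 \<le> s" and z: "mild \<alpha> s z0 z" and t: "0 \<le> t"
  shows "coord (z t) 0 = coord z0 0"
proof -
  obtain J where J: "((\<lambda>r. flow \<alpha> (t - r) (mat_app (weighted s) (z r))) has_integral J) {0..t}"
    "z t = flow \<alpha> t z0 - J" using z t by (auto simp: mild_def)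
  from has_integral_linear[OF J(1) bounded_linear_coord[of 0]]
  have "((\<lambda>r. 0) has_integral coord J 0) {0..t}" by (simp add: o_def coord_weighted_zero[OF s])
  then have "coord J 0 = 0" by (simp add: has_integral_0_eq)
  then show ?thesis by (simp add: J(2) dispersion_def)
qed

text \<open>Removing the mean value commutes with the evolution because row and column \<open>0\<close> of the feedback vanish.\<close>

lemma mild_trajectory:
  assumes s: "0 \<le> s" and z: "mild \<alpha> s z0 z"
  shows "trajectory \<alpha> s (\<lambda>t. trunc (- {0}) (z t))"
  unfolding trajectory_def
proof (intro conjI allI impI)
  show "continuous_on {0..} (\<lambda>t. trunc (- {0}) (z t))"
    using z by (intro bounded_linear.continuous_on[OF bounded_linear_trunc]) (simp add: mild_def)
  show "coord (trunc (- {0}) (z t)) 0 = 0" for t by simp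
  fix t :: real and k assume t: "0 < t"
  obtain C where C: "offdiag C (weighted s)" using offdiag_weighted[OF s] by blast
  have "mat_app (weighted s) (trunc (- {0}) x) = mat_app (weighted s) x" for x
    by (rule ell2_eqI) (auto simp: coord_mat_app[OF C] weighted_def column_zero intro!: infsum_cong)
  then show "((\<lambda>t. coord (trunc (- {0}) (z t)) k) has_vector_derivative
        \<i> * of_real (dispersion \<alpha> k) * coord (trunc (- {0}) (z t)) k -
        coord (mat_app (weighted s) (trunc (- {0}) (z t))) k) (at t)"
    using mild_coordinate_derivative[OF s z t, of k] s
    by (cases "k = 0") (auto simp: coord_weighted_zero)
qed

lemma mild_decay:
  assumes s: "0 \<le> s"
  shows "\<exists>M>0. \<forall>\<alpha> z0 z. mild \<alpha> s z0 z \<longrightarrow>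
    (\<forall>t\<ge>0. norm (trunc (- {0}) (z t)) \<le> M * exp (- (decay_rate / 2) * t) * norm (trunc (- {0}) z0))"
proof -
  obtain M where M: "M > 0" "\<And>\<alpha> z t. trajectory \<alpha> s z \<Longrightarrow> 0 \<le> t \<Longrightarrow>
    (norm (z t))\<^sup>2 \<le> M * exp (- decay_rate * t) * (norm (z 0))\<^sup>2"
    using trajectory_decay[OF s] by blast
  have "norm (trunc (- {0}) (z t)) \<le> sqrt M * exp (- (decay_rate / 2) * t) * norm (trunc (- {0}) z0)"
    if z: "mild \<alpha> s z0 z" and t: "0 \<le> t" for \<alpha> z0 z t
  proof (rule power2_le_imp_le)
    have "(norm (trunc (- {0}) (z t)))\<^sup>2 \<le> M * exp (- decay_rate * t) * (norm (trunc (- {0}) z0))\<^sup>2"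
      using M(2)[OF mild_trajectory[OF s z] t] mild_initial[OF z] by simp
    also have "\<dots> = (sqrt M * exp (- (decay_rate / 2) * t) * norm (trunc (- {0}) z0))\<^sup>2"
      using M(1) by (simp add: power_mult_distrib exp_double[symmetric])
    finally show "(norm (trunc (- {0}) (z t)))\<^sup>2 \<le> (sqrt M * exp (- (decay_rate / 2) * t) * norm (trunc (- {0}) z0))\<^sup>2" .
  qed (use M(1) in auto)
  then show ?thesis using M(1) by (intro exI[of _ "sqrt M"]) auto
qed

end

section \<open>Smooth periodic functions\<close>

lemma nderiv_0 [simp]: "nderiv 0 f = f" by (simp add: nderiv_def)

lemma nderiv_Suc: "nderiv (Suc n) f = (\<lambda>x. vector_derivative (nderiv n f) (at x))"
  by (simp add: nderiv_def)

lemma nderiv_nderiv: "nderiv n (nderiv m f) = nderiv (n + m) f"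
  by (simp add: nderiv_def funpow_add)

text \<open>Smoothness is the largest property that is stable under differentiation.\<close>

lemma smooth_coinduct:
  assumes "f \<in> X" and step: "\<And>f. f \<in> X \<Longrightarrow> (\<forall>x. f differentiable at x) \<and> (\<lambda>x. vector_derivative f (at x)) \<in> X"
  shows "smooth f"
proof -
  have "nderiv n f \<in> X" for n
    by (induction n) (use assms in \<open>auto simp: nderiv_Suc\<close>)
  then show ?thesis using step by (auto simp: smooth_def)
qed

lemma smooth_nderiv: "smooth f \<Longrightarrow> smooth (nderiv n f)"
  by (simp add: smooth_def nderiv_nderiv)

lemma smooth_has_derivative:
  assumes "smooth f"
  shows "(nderiv n f has_vector_derivative nderiv (Suc n) f x) (at x within A)"
  using assms by (simp add: smooth_def nderiv_Suc vector_derivative_works[symmetric] has_vector_derivative_at_within)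

lemma smooth_continuous: "smooth f \<Longrightarrow> continuous_on A f"
  using smooth_has_derivative[of f 0] by (force intro: has_vector_derivative_continuous simp: continuous_on_eq_continuous_within)

lemma derivative_everywhere:
  assumes "\<And>x. (f has_vector_derivative F x) (at x)"
  shows "(\<forall>x. f differentiable at x) \<and> (\<lambda>x. vector_derivative f (at x)) = F"
  using assms by (auto simp: fun_eq_iff intro: vector_derivative_at differentiableI_vector)

text \<open>Closing the smooth functions under sums and products gives a class that is visibly stable under differentiation, hence
consists of smooth functions; this replaces Leibniz' formula for higher derivatives.\<close>

inductive smooth_closure :: "(real \<Rightarrow> complex) \<Rightarrow> bool" where
  base: "smooth f \<Longrightarrow> smooth_closure f"
| add: "smooth_closure f \<Longrightarrow> smooth_closure h \<Longrightarrow> smooth_closure (\<lambda>x. f x + h x)"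
| mult: "smooth_closure f \<Longrightarrow> smooth_closure h \<Longrightarrow> smooth_closure (\<lambda>x. f x * h x)"

lemma smooth_closure_derivative:
  "smooth_closure f \<Longrightarrow> (\<forall>x. f differentiable at x) \<and> smooth_closure (\<lambda>x. vector_derivative f (at x))"
proof (induction rule: smooth_closure.induct)
  case (base f)
  then show ?case using smooth_nderiv[of f 1] smooth_closure.base
    by (auto simp: nderiv_Suc) (metis nderiv_0 smooth_def)
next
  case (add f h)
  then show ?case by (auto intro!: smooth_closure.add)
next
  case (mult f h)
  then show ?case by (auto intro!: smooth_closure.add smooth_closure.mult)
qed

lemma smooth_closure_smooth: "smooth_closure f \<Longrightarrow> smooth f"
  by (rule smooth_coinduct[of _ "Collect smooth_closure"]) (use smooth_closure_derivative in auto)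

lemma smooth_add: "smooth f \<Longrightarrow> smooth h \<Longrightarrow> smooth (\<lambda>x. f x + h x)" for f :: "real \<Rightarrow> complex"
  by (rule smooth_closure_smooth, rule smooth_closure.add; rule smooth_closure.base)

lemma smooth_mult: "smooth f \<Longrightarrow> smooth h \<Longrightarrow> smooth (\<lambda>x. f x * h x)" for f :: "real \<Rightarrow> complex"
  by (rule smooth_closure_smooth, rule smooth_closure.mult; rule smooth_closure.base)

lemma smooth_cis: "smooth (\<lambda>x. c * cis (a * x))"
proof (rule smooth_coinduct[of _ "{f. \<exists>c. f = (\<lambda>x. c * cis (a * x))}"])
  fix f assume "f \<in> {f. \<exists>c. f = (\<lambda>x. c * cis (a * x))}"
  then obtain c where f: "f = (\<lambda>x. c * cis (a * x))" by blast
  have "(f has_vector_derivative (c * (\<i> * of_real a)) * cis (a * x)) (at x)" for x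
    unfolding f using has_vector_derivative_mult_right[OF has_vector_derivative_cis[of a x UNIV], of c]
    by (simp add: mult.assoc)
  from derivative_everywhere[OF this]
  show "(\<forall>x. f differentiable at x) \<and> (\<lambda>x. vector_derivative f (at x)) \<in> {f. \<exists>c. f = (\<lambda>x. c * cis (a * x))}"
    by blast
qed auto

lemma smooth_const: "smooth (\<lambda>x. c :: complex)"
  using smooth_cis[of c 0] by simp

lemma smooth_of_real:
  assumes "smooth g"
  shows "smooth (\<lambda>x. complex_of_real (g x))"
proof (rule smooth_coinduct[of _ "{\<lambda>x. complex_of_real (h x) |h. smooth h}"])
  fix f assume "f \<in> {\<lambda>x. complex_of_real (h x) |h. smooth h}"
  then obtain h where f: "f = (\<lambda>x. complex_of_real (h x))" "smooth h" by blast
  have "(f has_vector_derivative of_real (nderiv 1 h x)) (at x)" for x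
    unfolding f using bounded_linear.has_vector_derivative[OF bounded_linear_of_real smooth_has_derivative[OF f(2), of 0]] by simp
  from derivative_everywhere[OF this]
  show "(\<forall>x. f differentiable at x) \<and> (\<lambda>x. vector_derivative f (at x)) \<in> {\<lambda>x. complex_of_real (h x) |h. smooth h}"
    using smooth_nderiv[OF f(2), of 1] by blast
qed (use assms in auto)

lemma nderiv_add:
  assumes "smooth f" "smooth h"
  shows "nderiv n (\<lambda>x. f x + h x) = (\<lambda>x. nderiv n f x + nderiv n h x)"
proof (induction n)
  case (Suc n)
  then show ?case using assms by (simp add: nderiv_Suc smooth_def)
qed simp

lemma nderiv_cmult:
  fixes f :: "real \<Rightarrow> complex"
  assumes "smooth f"
  shows "nderiv n (\<lambda>x. c * f x) = (\<lambda>x. c * nderiv n f x)"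
proof (induction n)
  case (Suc n)
  have "((\<lambda>x. c * nderiv n f x) has_vector_derivative c * nderiv (Suc n) f x) (at x)" for x
    by (intro has_vector_derivative_mult_right smooth_has_derivative assms)
  from derivative_everywhere[OF this] show ?case by (simp only: nderiv_Suc Suc)
qed simp

lemma smooth_sum:
  fixes f :: "'k \<Rightarrow> real \<Rightarrow> complex"
  assumes "finite F" "\<And>k. k \<in> F \<Longrightarrow> smooth (f k)"
  shows "smooth (\<lambda>x. \<Sum>k\<in>F. f k x) \<and> nderiv n (\<lambda>x. \<Sum>k\<in>F. f k x) = (\<lambda>x. \<Sum>k\<in>F. nderiv n (f k) x)"
  using assms
proof (induction F rule: finite_induct)
  case empty
  have "nderiv n (\<lambda>x. 0 :: complex) = (\<lambda>x. 0)" by (induction n) (auto simp: nderiv_Suc)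
  then show ?case by (simp add: smooth_const)
qed (simp_all add: smooth_add nderiv_add)

definition ex :: "int \<Rightarrow> real \<Rightarrow> complex" where "ex k x = cis (of_int k * x)"

lemma ex_0 [simp]: "ex 0 x = 1" by (simp add: ex_def)
lemma norm_ex [simp]: "cmod (ex k x) = 1" by (simp add: ex_def)
lemma ex_mult: "ex k x * ex l x = ex (k + l) x" by (simp add: ex_def cis_mult distrib_right)
lemma cnj_ex: "cnj (ex k x) = ex (- k) x" by (simp add: ex_def cis_cnj)
lemma continuous_on_ex [continuous_intros]: "continuous_on A (ex k)" unfolding ex_def by (intro continuous_intros)

lemma smooth_ex: "smooth (ex k)"
  using smooth_cis[of 1 "of_int k"] by (simp add: ex_def[abs_def])

lemma ex_periodic: "ex k (x + 2 * pi) = ex k x"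
proof -
  have "cis (of_int k * (2 * pi)) = 1" using cis_multiple_2pi[of "of_int k"] by (simp add: mult_ac)
  then show ?thesis by (simp add: ex_def distrib_left cis_mult[symmetric])
qed

lemma test_fun_ex: "test_fun (ex k)"
  by (simp add: test_fun_def smooth_ex periodic_def ex_periodic)

lemma nderiv_ex: "nderiv n (ex k) = (\<lambda>x. (\<i> * of_int k) ^ n * ex k x)"
proof (induction n)
  case (Suc n)
  have "((\<lambda>x. (\<i> * of_int k) ^ n * ex k x) has_vector_derivative (\<i> * of_int k) ^ n * (\<i> * of_int k * ex k x)) (at x)" for x
    unfolding ex_def using has_vector_derivative_cis[of "of_int k" x UNIV] by (intro has_vector_derivative_mult_right) simp
  from derivative_everywhere[OF this] show ?case by (simp add: nderiv_Suc Suc mult_ac)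
qed simp

lemma test_fun_add: "test_fun f \<Longrightarrow> test_fun h \<Longrightarrow> test_fun (\<lambda>x. f x + h x)"
  by (simp add: test_fun_def periodic_def smooth_add)

lemma test_fun_mult: "test_fun f \<Longrightarrow> test_fun h \<Longrightarrow> test_fun (\<lambda>x. f x * h x)"
  by (simp add: test_fun_def periodic_def smooth_mult)

lemma test_fun_const: "test_fun (\<lambda>x. c)"
  by (simp add: test_fun_def periodic_def smooth_const)

lemma test_fun_cmult: "test_fun f \<Longrightarrow> test_fun (\<lambda>x. c * f x)"
  by (intro test_fun_mult test_fun_const)

lemma test_fun_diff: "test_fun f \<Longrightarrow> test_fun h \<Longrightarrow> test_fun (\<lambda>x. f x - h x)"
  using test_fun_add[OF _ test_fun_cmult[of h "-1"]] by simp

lemma test_fun_sum: "finite F \<Longrightarrow> (\<And>k. k \<in> F \<Longrightarrow> test_fun (f k)) \<Longrightarrow> test_fun (\<lambda>x. \<Sum>k\<in>F. f k x)"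
  using smooth_sum[of F f] by (auto simp: test_fun_def periodic_def)

lemma test_fun_nderiv:
  assumes "test_fun f"
  shows "test_fun (nderiv n f)"
proof -
  have sm: "smooth f" using assms by (simp add: test_fun_def)
  have "nderiv n f (x + 2 * pi) = nderiv n f x" for x
  proof (induction n arbitrary: x)
    case 0
    then show ?case using assms by (simp add: test_fun_def periodic_def)
  next
    case (Suc n)
    have "((\<lambda>x. x + 2 * pi) has_vector_derivative 1) (at x)"
      by (auto intro!: derivative_eq_intros)
    from vector_diff_chain_at[OF this smooth_has_derivative[OF sm, of n]]
    have "(nderiv n f has_vector_derivative nderiv (Suc n) f (x + 2 * pi)) (at x)"
      by (simp add: o_def Suc)
    then show ?case using smooth_has_derivative[OF sm, of n x UNIV] vector_derivative_at by metis
  qed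
  then show ?thesis using sm by (simp add: test_fun_def periodic_def smooth_nderiv)
qed

lemma test_fun_continuous: "test_fun f \<Longrightarrow> continuous_on A f"
  by (simp add: test_fun_def smooth_continuous)

lemma periodic_int_shift:
  fixes f :: "real \<Rightarrow> 'a"
  assumes "periodic f"
  shows "f (x + 2 * pi * of_int n) = f x"
proof -
  have nat: "f (y + 2 * pi * real m) = f y" for y m
  proof (induction m)
    case (Suc m)
    have "f (y + 2 * pi * real (Suc m)) = f ((y + 2 * pi * real m) + 2 * pi)" by (simp add: algebra_simps)
    then show ?case using assms Suc by (simp add: periodic_def)
  qed simp
  show ?thesis
  proof (cases n)
    case (nonneg m)
    then show ?thesis using nat[of x m] by simp
  next
    case (neg m)
    have "x + 2 * pi * of_int n + 2 * pi * real (Suc m) = x" by (simp add: neg algebra_simps)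
    then show ?thesis using nat[of "x + 2 * pi * of_int n" "Suc m"] by (simp only:)
  qed
qed

lemma shift_near_zero:
  fixes y :: real
  obtains n :: int where "\<bar>y + 2 * pi * of_int n\<bar> \<le> pi"
proof -
  define n where "n = - round (y / (2 * pi))"
  have "\<bar>y / (2 * pi) - of_int (round (y / (2 * pi)))\<bar> \<le> 1 / 2"
    using of_int_round_abs_le[of "y / (2 * pi)"] by (simp only: abs_minus_commute)
  then have "\<bar>y / (2 * pi) + of_int n\<bar> * (2 * pi) \<le> 1 / 2 * (2 * pi)"
    by (intro mult_right_mono) (auto simp: n_def)
  then have "\<bar>(y / (2 * pi) + of_int n) * (2 * pi)\<bar> \<le> pi" by (simp add: abs_mult)
  moreover have "(y / (2 * pi) + of_int n) * (2 * pi) = y + 2 * pi * of_int n" by (simp add: field_simps)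
  ultimately show thesis using that[of n] by simp
qed

lemma test_fun_bounded:
  assumes "test_fun f"
  obtains M where "M \<ge> 0" "\<And>x. cmod (f x) \<le> M"
proof -
  have "bounded (f ` {-pi..pi})"
    by (intro compact_imp_bounded compact_continuous_image test_fun_continuous[OF assms]) auto
  then obtain M where M: "\<And>x. x \<in> {-pi..pi} \<Longrightarrow> cmod (f x) \<le> M" unfolding bounded_iff by blast
  show thesis
  proof (rule that[of M])
    show "M \<ge> 0" using order_trans[OF norm_ge_zero M[of 0]] by simp
    fix x
    obtain n :: int where n: "\<bar>x + 2 * pi * of_int n\<bar> \<le> pi" by (rule shift_near_zero)
    then have "cmod (f (x + 2 * pi * of_int n)) \<le> M" by (intro M) auto
    then show "cmod (f x) \<le> M" using periodic_int_shift[of f x n] assms by (simp add: test_fun_def)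
  qed
qed

section \<open>Fourier coefficients\<close>

text \<open>Lebesgue measure on one period, as a measure space of its own.\<close>

definition circ :: "real measure" where "circ = restrict_space lborel {0..2 * pi}"

lemma circ_integrable_iff: "integrable circ f \<longleftrightarrow> set_integrable lborel {0..2 * pi} f"
  for f :: "real \<Rightarrow> 'a::{banach, second_countable_topology}"
  by (simp add: circ_def integrable_restrict_space set_integrable_def)

lemma circ_integral: "(LBINT x:{0..2 * pi}. f x) = integral\<^sup>L circ f"
  for f :: "real \<Rightarrow> 'a::{banach, second_countable_topology}"
  by (simp add: circ_def integral_restrict_space set_lebesgue_integral_def)

lemma space_circ [simp]: "space circ = {0..2 * pi}" by (simp add: circ_def space_restrict_space)

lemma finite_measure_circ: "finite_measure circ"
  by (rule finite_measureI) (simp add: circ_def emeasure_restrict_space)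

lemma measure_circ [simp]: "measure circ {0..2 * pi} = 2 * pi"
  by (simp add: circ_def measure_restrict_space)

lemma borel_circ: "f \<in> borel_measurable borel \<Longrightarrow> f \<in> borel_measurable circ"
  unfolding circ_def by (rule measurable_restrict_space1) simp

lemma integrable_circ_const [simp]: "integrable circ (\<lambda>x. c)" for c :: "'a::{banach, second_countable_topology}"
  using finite_measure.integrable_const[OF finite_measure_circ] by blast

lemma circ_continuous:
  fixes f :: "real \<Rightarrow> 'a::euclidean_space"
  assumes "continuous_on {0..2 * pi} f"
  shows "integrable circ f" "integral\<^sup>L circ f = integral {0..2 * pi} f"
  using borel_integrable_atLeastAtMost'[OF assms]
  by (simp_all add: circ_integrable_iff circ_integral[symmetric] set_borel_integral_eq_integral)

text \<open>The Fourier coefficients of a function; those of a functional are given by \<open>fcoeff\<close>.\<close>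

definition fc :: "(real \<Rightarrow> complex) \<Rightarrow> int \<Rightarrow> complex" where
  "fc f k = integral\<^sup>L circ (\<lambda>x. f x * ex (- k) x) / (2 * pi)"

lemma borel_ex: "ex k \<in> borel_measurable borel"
  by (intro borel_measurable_continuous_onI continuous_intros)

lemma integrable_mult_ex:
  assumes "integrable circ f"
  shows "integrable circ (\<lambda>x. f x * ex k x)"
proof (rule Bochner_Integration.integrable_bound[OF assms])
  show "(\<lambda>x. f x * ex k x) \<in> borel_measurable circ"
    by (intro borel_measurable_times borel_measurable_integrable[OF assms] borel_circ[OF borel_ex])
qed (simp add: norm_mult)

lemma ex_integral: "integral\<^sup>L circ (ex k) = (if k = 0 then 2 * pi else 0)"
proof (cases "k = 0")
  case True
  then have "ex k = (\<lambda>x. 1)" by (auto simp: fun_eq_iff)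
  then show ?thesis using True by (simp add: scaleR_conv_of_real)
next
  case False
  have "(ex k has_integral (ex k (2 * pi) / (\<i> * of_int k) - ex k 0 / (\<i> * of_int k))) {0..2 * pi}"
  proof (rule fundamental_theorem_of_calculus)
    fix x
    have "((\<lambda>x. ex k x / (\<i> * of_int k)) has_vector_derivative \<i> * of_real (of_int k) * cis (of_int k * x) / (\<i> * of_int k)) (at x within {0..2 * pi})"
      unfolding ex_def by (intro has_vector_derivative_divide has_vector_derivative_cis)
    then show "((\<lambda>x. ex k x / (\<i> * of_int k)) has_vector_derivative ex k x) (at x within {0..2 * pi})"
      using False by (simp add: ex_def)
  qed simp
  moreover have "ex k (2 * pi) = ex k 0" using ex_periodic[of k 0] by simp
  ultimately show ?thesis using False circ_continuous(2)[of "ex k"]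
    by (simp add: integral_unique continuous_on_ex)
qed

lemma fc_add: "integrable circ f \<Longrightarrow> integrable circ h \<Longrightarrow> fc (\<lambda>x. f x + h x) k = fc f k + fc h k"
  by (simp add: fc_def distrib_right integrable_mult_ex add_divide_distrib)

lemma fc_diff: "integrable circ f \<Longrightarrow> integrable circ h \<Longrightarrow> fc (\<lambda>x. f x - h x) k = fc f k - fc h k"
  by (simp add: fc_def left_diff_distrib integrable_mult_ex diff_divide_distrib)

lemma fc_cmult: "fc (\<lambda>x. c * f x) k = c * fc f k"
  by (simp add: fc_def mult.assoc)

lemma fc_mult_ex: "fc (\<lambda>x. f x * ex j x) k = fc f (k - j)"
  by (simp add: fc_def mult.assoc ex_mult)

lemma fc_ex: "fc (ex l) k = (if k = l then 1 else 0)"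
  by (simp add: fc_def ex_mult ex_integral)

lemma fc_const: "fc (\<lambda>x. c) k = (if k = 0 then c else 0)"
  using fc_cmult[of c "ex 0" k] fc_ex[of 0 k] by (simp add: fun_eq_iff ex_def)

lemma fc_sum:
  assumes "finite F" "\<And>l. integrable circ (f l)"
  shows "fc (\<lambda>x. \<Sum>l\<in>F. c l * f l x) k = (\<Sum>l\<in>F. c l * fc (f l) k)"
  using assms(1)
proof (induction F rule: finite_induct)
  case empty
  show ?case by (simp add: fc_def)
next
  case (insert l F)
  have "integrable circ (\<lambda>x. \<Sum>l\<in>F. c l * f l x)"
    by (intro Bochner_Integration.integrable_sum integrable_mult_right assms(2))
  then show ?case using insert assms(2) by (simp add: fc_add fc_cmult)
qed

lemma fc_bound:
  assumes "integrable circ f" "\<And>x. cmod (f x) \<le> M"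
  shows "cmod (fc f k) \<le> M"
proof -
  have "cmod (integral\<^sup>L circ (\<lambda>x. f x * ex (- k) x)) \<le> integral\<^sup>L circ (\<lambda>x. M)"
    by (rule order_trans[OF integral_norm_bound], rule integral_mono)
       (use assms in \<open>auto simp: norm_mult intro: integrable_norm\<close>)
  then have "cmod (integral\<^sup>L circ (\<lambda>x. f x * ex (- k) x)) \<le> 2 * pi * M" by simp
  then show ?thesis by (simp add: fc_def norm_divide norm_mult pos_divide_le_eq mult.commute)
qed

lemma test_fun_integrable: "test_fun f \<Longrightarrow> integrable circ f"
  by (rule circ_continuous(1)) (rule test_fun_continuous)

lemma fc_derivative:
  assumes f: "test_fun f"
  shows "fc (nderiv (Suc 0) f) k = \<i> * of_int k * fc f k"
proof -
  let ?f' = "nderiv (Suc 0) f"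
  have f': "test_fun ?f'" by (rule test_fun_nderiv[OF f])
  have sm: "smooth f" using f by (simp add: test_fun_def)
  have "((\<lambda>x. f x * (\<i> * of_real (of_int (- k)) * cis (of_int (- k) * x)) + ?f' x * ex (- k) x) has_integral
      f (2 * pi) * ex (- k) (2 * pi) - f 0 * ex (- k) 0) {0..2 * pi}"
    unfolding ex_def
    by (rule fundamental_theorem_of_calculus)
       (use has_vector_derivative_mult[OF smooth_has_derivative[OF sm, of 0, unfolded nderiv_0] has_vector_derivative_cis[of "of_int (- k)"]]
        in auto)
  moreover have "f (2 * pi) * ex (- k) (2 * pi) - f 0 * ex (- k) 0 = 0"
    using ex_periodic[of "-k" 0] f by (auto simp: test_fun_def periodic_def dest!: spec[of _ 0])
  moreover have "(\<lambda>x. f x * (\<i> * of_real (of_int (- k)) * cis (of_int (- k) * x)) + ?f' x * ex (- k) x)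
     = (\<lambda>x. ?f' x * ex (- k) x - \<i> * of_int k * (f x * ex (- k) x))"
    by (auto simp: fun_eq_iff ex_def)
  ultimately have "integral {0..2 * pi} (\<lambda>x. ?f' x * ex (- k) x - \<i> * of_int k * (f x * ex (- k) x)) = 0"
    by (simp add: integral_unique)
  then have "integral\<^sup>L circ (\<lambda>x. ?f' x * ex (- k) x - \<i> * of_int k * (f x * ex (- k) x)) = 0"
    by (subst circ_continuous(2))
       (rule continuous_intros test_fun_continuous[OF f] test_fun_continuous[OF f'] | assumption)+
  then have "integral\<^sup>L circ (\<lambda>x. ?f' x * ex (- k) x) = \<i> * of_int k * integral\<^sup>L circ (\<lambda>x. f x * ex (- k) x)"
    using integrable_mult_ex[OF test_fun_integrable[OF f']] integrable_mult_ex[OF test_fun_integrable[OF f]]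
    by (subst (asm) Bochner_Integration.integral_diff) auto
  then show ?thesis by (simp add: fc_def)
qed

lemma fc_nderiv: "test_fun f \<Longrightarrow> fc (nderiv n f) k = (\<i> * of_int k) ^ n * fc f k"
proof (induction n)
  case (Suc n)
  then show ?case using fc_derivative[OF test_fun_nderiv[of f n], of k] nderiv_nderiv[of "Suc 0" n f] by simp
qed simp

text \<open>Each integration by parts gains a factor \<open>k\<close>.\<close>

lemma fc_rapid:
  assumes f: "test_fun f"
  shows "\<exists>C\<ge>0. \<forall>k. cmod (fc f k) \<le> C / bracket k ^ n"
proof -
  obtain M where M: "M \<ge> 0" "\<And>x. cmod (f x) \<le> M" using test_fun_bounded[OF f] by blast
  obtain M' where M': "M' \<ge> 0" "\<And>x. cmod (nderiv n f x) \<le> M'" using test_fun_bounded[OF test_fun_nderiv[OF f]] by blast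
  have "cmod (fc f k) \<le> (2 ^ n * (M + M')) / bracket k ^ n" for k
  proof -
    have 1: "cmod (fc f k) \<le> M" by (rule fc_bound[OF test_fun_integrable[OF f] M(2)])
    have "cmod (fc (nderiv n f) k) \<le> M'" by (rule fc_bound[OF test_fun_integrable[OF test_fun_nderiv[OF f]] M'(2)])
    then have 2: "\<bar>real_of_int k\<bar> ^ n * cmod (fc f k) \<le> M'"
      by (simp add: fc_nderiv[OF f] norm_mult norm_power)
    have "bracket k ^ n \<le> (2 * max 1 \<bar>real_of_int k\<bar>) ^ n" by (intro power_mono) (auto simp: bracket_def)
    also have "\<dots> = 2 ^ n * (max 1 \<bar>real_of_int k\<bar>) ^ n" by (simp add: power_mult_distrib)
    also have "(max 1 \<bar>real_of_int k\<bar>) ^ n \<le> 1 + \<bar>real_of_int k\<bar> ^ n" by (simp add: max_def)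
    finally have "bracket k ^ n * cmod (fc f k) \<le> 2 ^ n * (1 + \<bar>real_of_int k\<bar> ^ n) * cmod (fc f k)"
      by (simp add: mult_right_mono)
    also have "\<dots> = 2 ^ n * (cmod (fc f k) + \<bar>real_of_int k\<bar> ^ n * cmod (fc f k))" by (simp add: algebra_simps)
    also have "\<dots> \<le> 2 ^ n * (M + M')" using 1 2 by (intro mult_left_mono add_mono) auto
    finally show ?thesis by (simp add: pos_le_divide_eq mult.commute)
  qed
  then show ?thesis using M(1) M'(1) by (intro exI[of _ "2 ^ n * (M + M')"]) auto
qed

lemma trig_sum_ex: "trig_sum F \<xi> x = (\<Sum>k\<in>F. \<xi> k * ex k x)"
  by (simp add: trig_sum_def ex_def)

lemma trig_sum_norm_sq:
  assumes F: "finite F"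
  shows "integral\<^sup>L circ (\<lambda>x. trig_sum F \<xi> x * cnj (trig_sum F \<xi> x)) = complex_of_real (2 * pi * (\<Sum>k\<in>F. (cmod (\<xi> k))\<^sup>2))"
proof -
  have "integral\<^sup>L circ (\<lambda>x. trig_sum F \<xi> x * cnj (trig_sum F \<xi> x)) = integral\<^sup>L circ (\<lambda>x. \<Sum>k\<in>F. \<Sum>l\<in>F. \<xi> k * cnj (\<xi> l) * ex (k - l) x)"
    by (intro Bochner_Integration.integral_cong)
       (auto simp: trig_sum_ex sum_product cnj_ex ex_mult[of _ _ "- _", simplified, symmetric] mult_ac)
  also have "\<dots> = (\<Sum>k\<in>F. \<Sum>l\<in>F. \<xi> k * cnj (\<xi> l) * integral\<^sup>L circ (ex (k - l)))"
    by (subst Bochner_Integration.integral_sum, (intro Bochner_Integration.integrable_sum integrable_mult_right circ_continuous(1) continuous_intros)[1])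
       (subst Bochner_Integration.integral_sum, (intro integrable_mult_right circ_continuous(1) continuous_intros)[1], simp)
  also have "\<dots> = (\<Sum>k\<in>F. \<xi> k * cnj (\<xi> k) * (2 * pi))"
  proof (rule sum.cong)
    fix k assume k: "k \<in> F"
    have "(\<Sum>l\<in>F. \<xi> k * cnj (\<xi> l) * integral\<^sup>L circ (ex (k - l)))
        = (\<Sum>l\<in>F. if l = k then \<xi> k * cnj (\<xi> l) * (2 * pi) else 0)"
      by (intro sum.cong) (auto simp: ex_integral)
    then show "(\<Sum>l\<in>F. \<xi> k * cnj (\<xi> l) * integral\<^sup>L circ (ex (k - l))) = \<xi> k * cnj (\<xi> k) * (2 * pi)"
      using k by (simp add: sum.delta[OF F])
  qed simp
  also have "\<dots> = complex_of_real (2 * pi * (\<Sum>k\<in>F. (cmod (\<xi> k))\<^sup>2))"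
    unfolding of_real_mult of_real_sum sum_distrib_left complex_norm_square
    by (intro sum.cong refl) (simp only: mult_ac of_real_numeral)
  finally show ?thesis .
qed

lemma bessel_inequality:
  assumes f: "integrable circ f" and f2: "integrable circ (\<lambda>x. (cmod (f x))\<^sup>2)" and F: "finite F"
  shows "(\<Sum>k\<in>F. (cmod (fc f k))\<^sup>2) \<le> integral\<^sup>L circ (\<lambda>x. (cmod (f x))\<^sup>2) / (2 * pi)"
proof -
  define s where "s = (\<lambda>x. \<Sum>k\<in>F. fc f k * ex k x)"
  have sc: "continuous_on A s" for A unfolding s_def by (intro continuous_intros)
  have fx: "integrable circ (\<lambda>x. f x * cnj (s x))"
    unfolding s_def cnj_sum complex_cnj_mult cnj_ex sum_distrib_left
    using integrable_mult_ex[OF f] by (intro Bochner_Integration.integrable_sum) (simp add: mult.left_commute[of "f _"])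
  have fs: "integral\<^sup>L circ (\<lambda>x. f x * cnj (s x)) = complex_of_real (2 * pi * (\<Sum>k\<in>F. (cmod (fc f k))\<^sup>2))"
  proof -
    have "integral\<^sup>L circ (\<lambda>x. f x * cnj (s x)) = (\<Sum>k\<in>F. cnj (fc f k) * integral\<^sup>L circ (\<lambda>x. f x * ex (- k) x))"
      unfolding s_def cnj_sum complex_cnj_mult cnj_ex sum_distrib_left mult.left_commute[of "f _"]
      using integrable_mult_ex[OF f] by (subst Bochner_Integration.integral_sum) auto
    also have "\<dots> = (\<Sum>k\<in>F. 2 * complex_of_real pi * of_real ((cmod (fc f k))\<^sup>2))"
    proof (rule sum.cong)
      fix k
      have "integral\<^sup>L circ (\<lambda>x. f x * ex (- k) x) = 2 * pi * fc f k" by (simp add: fc_def)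
      then show "cnj (fc f k) * integral\<^sup>L circ (\<lambda>x. f x * ex (- k) x) = 2 * complex_of_real pi * of_real ((cmod (fc f k))\<^sup>2)"
        by (simp only: complex_norm_square mult_ac of_real_mult of_real_numeral)
    qed simp
    finally show ?thesis by (simp add: sum_distrib_left)
  qed
  have ss: "integral\<^sup>L circ (\<lambda>x. s x * cnj (s x)) = complex_of_real (2 * pi * (\<Sum>k\<in>F. (cmod (fc f k))\<^sup>2))"
    unfolding s_def trig_sum_ex[symmetric] by (rule trig_sum_norm_sq[OF F])
  have "0 \<le> integral\<^sup>L circ (\<lambda>x. (cmod (f x - s x))\<^sup>2)" by simp
  also have "\<dots> = integral\<^sup>L circ (\<lambda>x. (cmod (f x))\<^sup>2 - 2 * Re (f x * cnj (s x)) + Re (s x * cnj (s x)))"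
    by (intro Bochner_Integration.integral_cong refl) (simp add: cmod_power2, simp add: power2_eq_square algebra_simps)
  also have "\<dots> = integral\<^sup>L circ (\<lambda>x. (cmod (f x))\<^sup>2) - 2 * integral\<^sup>L circ (\<lambda>x. Re (f x * cnj (s x))) + integral\<^sup>L circ (\<lambda>x. Re (s x * cnj (s x)))"
    using fx f2 by (subst Bochner_Integration.integral_add Bochner_Integration.integral_diff,
        (auto intro!: circ_continuous(1) continuous_intros sc integrable_Re simp del: cnj.simps times_complex.simps))+
  also have "\<dots> = integral\<^sup>L circ (\<lambda>x. (cmod (f x))\<^sup>2) - 2 * pi * (\<Sum>k\<in>F. (cmod (fc f k))\<^sup>2)"
  proof -
    have "integral\<^sup>L circ (\<lambda>x. Re (f x * cnj (s x))) = 2 * pi * (\<Sum>k\<in>F. (cmod (fc f k))\<^sup>2)"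
      using integral_Re[OF fx] by (simp only: fs Re_complex_of_real)
    moreover have "integral\<^sup>L circ (\<lambda>x. Re (s x * cnj (s x))) = 2 * pi * (\<Sum>k\<in>F. (cmod (fc f k))\<^sup>2)"
    proof -
      have "integrable circ (\<lambda>x. s x * cnj (s x))" by (intro circ_continuous(1) continuous_intros sc)
      from integral_Re[OF this] show ?thesis by (simp only: ss Re_complex_of_real)
    qed
    ultimately show ?thesis by simp
  qed
  finally show ?thesis by (simp add: pos_le_divide_eq mult.commute)
qed

section \<open>Fourier series of test functions\<close>

lemma sin_lower_bound:
  fixes t :: real
  assumes "\<bar>t\<bar> \<le> pi / 2"
  shows "\<bar>t\<bar> / 2 \<le> \<bar>sin t\<bar>"
proof -
  have "\<bar>sin t - (\<Sum>m<3. sin_coeff m * t ^ m)\<bar> \<le> inverse (fact 3) * \<bar>t\<bar> ^ 3"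
    by (rule Maclaurin_sin_bound)
  moreover have "(\<Sum>m<3. sin_coeff m * t ^ m) = t" by (simp add: eval_nat_numeral sin_coeff_def)
  ultimately have 1: "\<bar>sin t - t\<bar> \<le> \<bar>t\<bar> ^ 3 / 6" by (simp add: fact_numeral field_simps)
  \<comment> \<open>\<open>\<pi> / 2 < 8 / 5\<close>, and \<open>(8 / 5)\<^sup>2 < 3\<close>.\<close>
  have "\<bar>t\<bar>\<^sup>2 \<le> (8 / 5)\<^sup>2" using assms pi_less_4 pi_approx by (intro power_mono) auto
  then have "\<bar>t\<bar> * \<bar>t\<bar>\<^sup>2 \<le> \<bar>t\<bar> * 3" by (intro mult_left_mono) (auto simp: power2_eq_square)
  then have "\<bar>t\<bar> ^ 3 / 6 \<le> \<bar>t\<bar> / 2" by (simp add: power2_eq_square power3_eq_cube)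
  then show ?thesis using 1 by linarith
qed

lemma cis_minus_one_lower_bound:
  assumes "\<bar>y\<bar> \<le> pi"
  shows "\<bar>y\<bar> / 2 \<le> cmod (cis y - 1)"
proof -
  have "(cmod (cis y - 1))\<^sup>2 = 2 - 2 * cos y" by (simp add: cmod_power2 power2_diff)
  also have "\<dots> = (2 * sin (y / 2))\<^sup>2"
    using cos_double_sin[of "y / 2"] by (simp add: power_mult_distrib)
  finally have "(cmod (cis y - 1))\<^sup>2 = \<bar>2 * sin (y / 2)\<bar>\<^sup>2" by simp
  then have "cmod (cis y - 1) = \<bar>2 * sin (y / 2)\<bar>" by (rule power2_eq_imp_eq) auto
  then show ?thesis using sin_lower_bound[of "y / 2"] assms by simp
qed

text \<open>Riemann and Lebesgue's lemma, from Bessel's inequality.\<close>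

lemma fc_tendsto_zero:
  assumes f: "integrable circ f" "integrable circ (\<lambda>x. (cmod (f x))\<^sup>2)" and i: "inj (i :: nat \<Rightarrow> int)"
  shows "(\<lambda>n. fc f (i n)) \<longlonglongrightarrow> 0"
proof -
  have "summable (\<lambda>n. (cmod (fc f (i n)))\<^sup>2)"
  proof (rule summableI_nonneg_bounded)
    fix n
    have "(\<Sum>m<n. (cmod (fc f (i m)))\<^sup>2) = (\<Sum>k\<in>i ` {..<n}. (cmod (fc f k))\<^sup>2)"
      using i by (subst sum.reindex) (auto intro: inj_on_subset)
    also have "\<dots> \<le> integral\<^sup>L circ (\<lambda>x. (cmod (f x))\<^sup>2) / (2 * pi)" by (intro bessel_inequality f) auto
    finally show "(\<Sum>m<n. (cmod (fc f (i m)))\<^sup>2) \<le> integral\<^sup>L circ (\<lambda>x. (cmod (f x))\<^sup>2) / (2 * pi)" .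
  qed simp
  then have "(\<lambda>n. (cmod (fc f (i n)))\<^sup>2) \<longlonglongrightarrow> 0" by (rule summable_LIMSEQ_zero)
  from tendsto_real_sqrt[OF this] show ?thesis by (simp add: tendsto_norm_zero_iff)
qed

text \<open>Modulo \<open>2 \<pi>\<close> the point \<open>x\<close> is \<open>x0 + y\<close> with \<open>\<bar>y\<bar> \<le> \<pi>\<close>. The numerator is at most a multiple of \<open>\<bar>y\<bar>\<close> by the mean value theorem, and
the denominator is at least \<open>\<bar>y\<bar> / 2\<close>.\<close>

lemma test_fun_difference_quotient_bounded:
  assumes f: "test_fun f"
  obtains M where "\<And>x. cmod ((f x - f x0) / (ex 1 (x - x0) - 1)) \<le> M"
proof -
  obtain M where M: "M \<ge> 0" "\<And>x. cmod (nderiv 1 f x) \<le> M" using test_fun_bounded[OF test_fun_nderiv[OF f]] by blast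
  have "cmod ((f x - f x0) / (ex 1 (x - x0) - 1)) \<le> 2 * M" for x
  proof -
    obtain n :: int where n: "\<bar>(x - x0) + 2 * pi * of_int n\<bar> \<le> pi" by (rule shift_near_zero)
    define y where "y = (x - x0) + 2 * pi * of_int n"
    have p: "periodic f" "periodic (ex 1)" using f test_fun_ex by (auto simp: test_fun_def)
    have "f x = f (x0 + y)" using periodic_int_shift[OF p(1), of x n] by (simp add: y_def algebra_simps)
    moreover have "norm (f (x0 + y) - f x0) \<le> M * norm ((x0 + y) - x0)"
    proof (rule differentiable_bound[OF convex_UNIV])
      fix z
      show "(f has_derivative (\<lambda>h. h *\<^sub>R nderiv 1 f z)) (at z within UNIV)"
        using smooth_has_derivative[of f 0 z UNIV] f by (simp add: test_fun_def has_vector_derivative_def)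
      show "onorm (\<lambda>h. h *\<^sub>R nderiv 1 f z) \<le> M"
        using M(2)[of z] by (intro onorm_bound M(1)) (auto simp: mult.commute[of M] intro!: mult_left_mono)
    qed auto
    ultimately have "cmod (f x - f x0) \<le> M * \<bar>y\<bar>" by simp
    moreover have "ex 1 (x - x0) = cis y"
      using periodic_int_shift[OF p(2), of "x - x0" n] by (simp add: y_def ex_def)
    then have "\<bar>y\<bar> / 2 \<le> cmod (ex 1 (x - x0) - 1)" using cis_minus_one_lower_bound[of y] n by (simp add: y_def)
    then have "M * \<bar>y\<bar> \<le> 2 * M * cmod (ex 1 (x - x0) - 1)"
      using M(1) mult_left_mono[of "\<bar>y\<bar> / 2" _ "2 * M"] by simp
    ultimately have "cmod (f x - f x0) \<le> 2 * M * cmod (ex 1 (x - x0) - 1)" by linarith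
    then show ?thesis using M(1)
      by (cases "cmod (ex 1 (x - x0) - 1) = 0") (auto simp: norm_divide pos_divide_le_eq)
  qed
  then show thesis using that by blast
qed

text \<open>Chernoff's argument: \<open>f - f x\<^sub>0 = (e\<^bsup>i (x - x\<^sub>0)\<^esup> - 1) h\<close> with a bounded \<open>h\<close>, so that the partial sums of the Fourier series
  at \<open>x\<^sub>0\<close> telescope to two coefficients of \<open>h\<close>.\<close>

lemma fourier_partial_sums:
  assumes f: "test_fun f"
  shows "(\<lambda>N::nat. \<Sum>k\<in>{- int N..int N}. fc f k * ex k x0) \<longlonglongrightarrow> f x0"
proof -
  define h where "h = (\<lambda>x. (f x - f x0) / (ex 1 (x - x0) - 1))"
  obtain M where M: "\<And>x. cmod (h x) \<le> M" using test_fun_difference_quotient_bounded[OF f] unfolding h_def by blast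
  have fm: "f \<in> borel_measurable borel"
    by (intro borel_measurable_continuous_onI test_fun_continuous f)
  have em: "(\<lambda>x. ex 1 (x - x0)) \<in> borel_measurable borel"
    unfolding ex_def by (intro borel_measurable_continuous_onI continuous_intros)
  have "h \<in> borel_measurable borel"
    unfolding h_def by (rule borel_measurable_divide; rule borel_measurable_diff; rule fm em borel_measurable_const)
  then have hm: "h \<in> borel_measurable circ" by (rule borel_circ)
  have hi: "integrable circ h"
  proof (rule Bochner_Integration.integrable_bound[OF integrable_circ_const[of "M::real"] hm])
    show "AE x in circ. cmod (h x) \<le> norm M" using M by (intro AE_I2) (metis abs_ge_self order_trans real_norm_def)
  qed
  have h2: "integrable circ (\<lambda>x. (cmod (h x))\<^sup>2)"
  proof (rule Bochner_Integration.integrable_bound[OF integrable_circ_const[of "M\<^sup>2::real"]])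
    show "(\<lambda>x. (cmod (h x))\<^sup>2) \<in> borel_measurable circ"
      by (rule measurable_compose[OF hm], intro borel_measurable_continuous_onI continuous_intros)
    show "AE x in circ. norm ((cmod (h x))\<^sup>2) \<le> norm (M\<^sup>2)"
      by (intro AE_I2) (simp add: power_mono[OF M])
  qed
  have fact: "f x - f x0 = ex (-1) x0 * (h x * ex 1 x) - h x" for x
  proof (cases "ex 1 (x - x0) = 1")
    case True
    then obtain n where n: "x - x0 = 2 * pi * of_int n"
      by (auto simp: ex_def complex_eq_iff cos_one_2pi_int mult_ac)
    then have "f x = f x0" using periodic_int_shift[of f x0 n] f by (simp add: test_fun_def algebra_simps)
    then show ?thesis using True by (simp add: h_def)
  next
    case False
    have "ex 1 (x - x0) = ex (-1) x0 * ex 1 x" by (simp add: ex_def cis_mult algebra_simps)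
    then have "ex (-1) x0 * (h x * ex 1 x) - h x = h x * (ex 1 (x - x0) - 1)" by (simp add: algebra_simps)
    also have "\<dots> = f x - f x0" using False by (simp add: h_def)
    finally show ?thesis ..
  qed
  define a where "a = (\<lambda>k. ex k x0 * fc h k)"
  have co: "(fc f k - (if k = 0 then f x0 else 0)) * ex k x0 = a (k - 1) - a k" for k
  proof -
    have "fc f k - (if k = 0 then f x0 else 0) = fc (\<lambda>x. f x - f x0) k"
      by (simp add: fc_diff test_fun_integrable[OF f] fc_const)
    also have "\<dots> = ex (-1) x0 * fc h (k - 1) - fc h k"
      unfolding fact by (subst fc_diff) (auto intro!: integrable_mult_right integrable_mult_ex hi simp: fc_cmult fc_mult_ex)
    finally have eq: "fc f k - (if k = 0 then f x0 else 0) = ex (-1) x0 * fc h (k - 1) - fc h k" .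
    have "(fc f k - (if k = 0 then f x0 else 0)) * ex k x0 = (ex k x0 * ex (-1) x0) * fc h (k - 1) - ex k x0 * fc h k"
      unfolding eq by (simp add: algebra_simps)
    also have "\<dots> = a (k - 1) - a k" by (simp add: a_def ex_mult)
    finally show ?thesis .
  qed
  have tel: "(\<Sum>k\<in>{- int N..int N}. a (k - 1) - a k) = a (- 1 - int N) - a (int N)" for N
  proof (induction N)
    case (Suc N)
    have "{- int (Suc N)..int (Suc N)} = insert (- int (Suc N)) (insert (int (Suc N)) {- int N..int N})" by auto
    then show ?case using Suc by simp
  qed simp
  have S: "(\<Sum>k\<in>{- int N..int N}. fc f k * ex k x0) = f x0 + (a (- 1 - int N) - a (int N))" for N
  proof -
    have "(\<Sum>k\<in>{- int N..int N}. fc f k * ex k x0) 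
       = (\<Sum>k\<in>{- int N..int N}. (if k = 0 then f x0 else 0) + (a (k - 1) - a k))"
      unfolding co[symmetric] by (intro sum.cong) (auto simp: algebra_simps)
    also have "\<dots> = f x0 + (a (- 1 - int N) - a (int N))" unfolding sum.distrib tel by simp
    finally show ?thesis .
  qed
  have lim: "(\<lambda>N. a (i N)) \<longlonglongrightarrow> 0" if "inj i" for i :: "nat \<Rightarrow> int"
  proof (rule tendsto_norm_zero_cancel)
    show "(\<lambda>N. cmod (a (i N))) \<longlonglongrightarrow> 0"
      using tendsto_norm_zero[OF fc_tendsto_zero[OF hi h2 that]] by (simp add: a_def norm_mult)
  qed
  have "(\<lambda>N. a (- 1 - int N)) \<longlonglongrightarrow> 0" "(\<lambda>N. a (int N)) \<longlonglongrightarrow> 0"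
    by (rule lim, simp add: inj_def)+
  from tendsto_add[OF tendsto_const tendsto_diff[OF this]] show ?thesis unfolding S by simp
qed

lemma rapid_summable:
  assumes f: "test_fun f"
  shows "(\<lambda>k. \<bar>of_int k\<bar> ^ n * cmod (fc f k)) summable_on A"
proof -
  obtain C where C: "\<And>k. cmod (fc f k) \<le> C / bracket k ^ (n + 2)" using fc_rapid[OF f] by blast
  have "(\<lambda>k. \<bar>of_int k\<bar> ^ n * cmod (fc f k)) summable_on UNIV"
  proof (rule summable_on_comparison_test[where f = "\<lambda>k. C * (1 / (bracket k)\<^sup>2)"])
    show "(\<lambda>k. C * (1 / (bracket k)\<^sup>2)) summable_on UNIV" by (intro summable_on_cmult_right bracket_summable)
    fix k
    have "\<bar>of_int k\<bar> ^ n * cmod (fc f k) \<le> bracket k ^ n * (C / bracket k ^ (n + 2))"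
      using C[of k] by (intro mult_mono power_mono) (auto simp: bracket_def)
    also have "\<dots> = C * (1 / (bracket k)\<^sup>2)" using bracket_pos[of k] by (simp add: power_add power2_eq_square del: bracket_pos)
    finally show "\<bar>of_int k\<bar> ^ n * cmod (fc f k) \<le> C * (1 / (bracket k)\<^sup>2)" .
  qed auto
  then show ?thesis by (rule summable_on_subset_banach) auto
qed

lemma fourier_abs_summable: "test_fun f \<Longrightarrow> (\<lambda>k. norm (fc f k * ex k x)) summable_on A"
  using rapid_summable[of f 0] by (simp add: norm_mult)

lemma symmetric_intervals_at_top: "filterlim (\<lambda>N::nat. {- int N..int N}) (finite_subsets_at_top UNIV) sequentially"
  unfolding filterlim_iff
proof (intro allI impI)
  fix P assume "eventually P (finite_subsets_at_top (UNIV :: int set))"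
  then obtain X where X: "finite X" "\<And>Y. finite Y \<Longrightarrow> X \<subseteq> Y \<Longrightarrow> P Y"
    by (auto simp: eventually_finite_subsets_at_top)
  obtain N where N: "\<And>k. k \<in> X \<Longrightarrow> nat \<bar>k\<bar> \<le> N"
    using finite_nat_set_iff_bounded_le[of "(\<lambda>k. nat \<bar>k\<bar>) ` X"] X(1) by auto
  show "\<forall>\<^sub>F N in sequentially. P {- int N..int N}"
  proof (rule eventually_sequentiallyI[of N])
    fix n assume "N \<le> n"
    then have "X \<subseteq> {- int n..int n}" using N by fastforce
    then show "P {- int n..int n}" by (intro X(2)) auto
  qed
qed

text \<open>The coefficients are absolutely summable, so the symmetric partial sums determine the unconditional sum.\<close>

lemma fourier_has_sum:
  assumes f: "test_fun f"
  shows "((\<lambda>k. fc f k * ex k x) has_sum f x) UNIV"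
proof -
  have s: "(\<lambda>k. fc f k * ex k x) summable_on UNIV"
    by (rule abs_summable_summable[OF fourier_abs_summable[OF f]])
  have "(\<lambda>N. \<Sum>k\<in>{- int N..int N}. fc f k * ex k x) \<longlonglongrightarrow> (\<Sum>\<^sub>\<infinity>k. fc f k * ex k x)"
    using filterlim_compose[OF infsum_tendsto[OF s] symmetric_intervals_at_top] by simp
  then have "(\<Sum>\<^sub>\<infinity>k. fc f k * ex k x) = f x" using fourier_partial_sums[OF f] LIMSEQ_unique by blast
  then show ?thesis using has_sum_infsum[OF s] by simp
qed

text \<open>The Fourier coefficients of a derivative are again those of a test function, so each derivative of the remainder is the tail of
an absolutely convergent series.\<close>

lemma fourier_remainder_bound:
  assumes f: "test_fun f" and F: "finite F"
  shows "cmod (nderiv n (\<lambda>x. f x - (\<Sum>k\<in>F. fc f k * ex k x)) x) \<le> (\<Sum>\<^sub>\<infinity>k\<in>-F. \<bar>of_int k\<bar> ^ n * cmod (fc f k))"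
proof -
  let ?c = "\<lambda>k. (\<i> * of_int k) ^ n * fc f k * ex k x"
  have sm: "smooth f" using f by (simp add: test_fun_def)
  have smk: "smooth (\<lambda>x. fc f k * ex k x)" for k using test_fun_cmult[OF test_fun_ex] by (simp add: test_fun_def)
  have ss: "smooth (\<lambda>x. \<Sum>k\<in>F. fc f k * ex k x)"
    and ns: "nderiv n (\<lambda>x. \<Sum>k\<in>F. fc f k * ex k x) = (\<lambda>x. \<Sum>k\<in>F. nderiv n (\<lambda>x. fc f k * ex k x) x)"
    using smooth_sum[OF F, of "\<lambda>k x. fc f k * ex k x" n] smk by blast+
  have "nderiv n (\<lambda>x. f x + (-1) * (\<Sum>k\<in>F. fc f k * ex k x)) x
      = nderiv n f x + (-1) * (\<Sum>k\<in>F. fc f k * ((\<i> * of_int k) ^ n * ex k x))"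
    unfolding nderiv_add[OF sm smooth_mult[OF smooth_const ss]] nderiv_cmult[OF ss] ns nderiv_cmult[OF smooth_ex] nderiv_ex ..
  then have "nderiv n (\<lambda>x. f x + (-1) * (\<Sum>k\<in>F. fc f k * ex k x)) x = nderiv n f x - (\<Sum>k\<in>F. ?c k)"
    by (simp add: mult_ac)
  then have "nderiv n (\<lambda>x. f x - (\<Sum>k\<in>F. fc f k * ex k x)) x = nderiv n f x - (\<Sum>k\<in>F. ?c k)" by simp
  also have "(?c has_sum nderiv n f x) UNIV"
    using fourier_has_sum[OF test_fun_nderiv[OF f], of n x] by (simp add: fc_nderiv[OF f])
  then have s: "?c summable_on UNIV" and e: "nderiv n f x = (\<Sum>\<^sub>\<infinity>k. ?c k)"
    by (auto simp: has_sum_imp_summable infsumI)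
  have "nderiv n f x - (\<Sum>k\<in>F. ?c k) = (\<Sum>\<^sub>\<infinity>k\<in>UNIV - F. ?c k)"
    unfolding e using F s by (subst infsum_Diff) auto
  also have "cmod \<dots> \<le> (\<Sum>\<^sub>\<infinity>k\<in>UNIV - F. cmod (?c k))"
    using rapid_summable[OF f, of n] by (intro norm_infsum_bound) (simp add: norm_mult norm_power)
  finally show ?thesis by (simp add: norm_mult norm_power Compl_eq_Diff_UNIV)
qed

section \<open>Periodic distributions and their Fourier coefficients\<close>

lemma fcoeff_ex: "fcoeff T k = T (ex (- k)) / (2 * pi)"
proof -
  have "(\<lambda>x. exp (- \<i> * of_int k * of_real x)) = ex (- k)"
    by (auto simp: ex_def cis_conv_exp fun_eq_iff mult.assoc)
  then show ?thesis by (simp add: fcoeff_def)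
qed

lemma mean_eq_fcoeff: "mean T = fcoeff T 0"
  by (simp add: mean_def fcoeff_def)

lemma distribution_add: "periodic_distribution T \<Longrightarrow> test_fun f \<Longrightarrow> test_fun h \<Longrightarrow> T (\<lambda>x. f x + h x) = T f + T h"
  by (simp add: periodic_distribution_def)

lemma distribution_cmult: "periodic_distribution T \<Longrightarrow> test_fun f \<Longrightarrow> T (\<lambda>x. c * f x) = c * T f"
  by (simp add: periodic_distribution_def)

lemma distribution_sum:
  assumes T: "periodic_distribution T" and F: "finite F" "\<And>k. k \<in> F \<Longrightarrow> test_fun (f k)"
  shows "T (\<lambda>x. \<Sum>k\<in>F. f k x) = (\<Sum>k\<in>F. T (f k))"
  using F
proof (induction F rule: finite_induct)
  case empty
  show ?case using distribution_cmult[OF T test_fun_const, of 0 0] by simp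
next
  case (insert k F)
  then show ?case using distribution_add[OF T, of "f k" "\<lambda>x. \<Sum>k\<in>F. f k x"] by (simp add: test_fun_sum)
qed

text \<open>The Fourier series of a test function converges in the topology of test functions.\<close>

lemma distribution_expansion:
  assumes T: "periodic_distribution T" and f: "test_fun f"
  shows "((\<lambda>k. fc f k * T (ex k)) has_sum T f) UNIV"
proof -
  obtain C N where CN: "\<And>\<phi>. test_fun \<phi> \<Longrightarrow> cmod (T \<phi>) \<le> C * (\<Sum>n\<le>(N::nat). SUP x\<in>{0..2 * pi}. cmod (nderiv n \<phi> x))"
    using T unfolding periodic_distribution_def by blast
  define R where "R = (\<lambda>F n. (\<Sum>\<^sub>\<infinity>k\<in>-F. \<bar>of_int k\<bar> ^ n * cmod (fc f k)))"
  have bound: "cmod (T f - (\<Sum>k\<in>F. fc f k * T (ex k))) \<le> \<bar>C\<bar> * (\<Sum>n\<le>N. R F n)" if F: "finite F" for F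
  proof -
    let ?s = "\<lambda>x. \<Sum>k\<in>F. fc f k * ex k x"
    have ts: "test_fun ?s" by (intro test_fun_sum F test_fun_cmult test_fun_ex)
    have "T ?s = (\<Sum>k\<in>F. fc f k * T (ex k))"
      by (subst distribution_sum[OF T F]) (auto intro: test_fun_cmult test_fun_ex simp: distribution_cmult[OF T test_fun_ex])
    moreover have "T (\<lambda>x. f x - ?s x) = T f - T ?s"
      using distribution_add[OF T f test_fun_cmult[OF ts], of "-1"] distribution_cmult[OF T ts, of "-1"] by simp
    ultimately have "cmod (T f - (\<Sum>k\<in>F. fc f k * T (ex k))) \<le> C * (\<Sum>n\<le>N. SUP x\<in>{0..2 * pi}. cmod (nderiv n (\<lambda>x. f x - ?s x) x))"
      using CN[OF test_fun_diff[OF f ts]] by simp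
    also have "\<dots> \<le> \<bar>C\<bar> * (\<Sum>n\<le>N. SUP x\<in>{0..2 * pi}. cmod (nderiv n (\<lambda>x. f x - ?s x) x))"
    proof (intro mult_right_mono sum_nonneg)
      fix n
      have "bdd_above ((\<lambda>x. cmod (nderiv n (\<lambda>x. f x - ?s x) x)) ` {0..2 * pi})"
        using fourier_remainder_bound[OF f F] by (intro bdd_aboveI2)
      then show "0 \<le> (SUP x\<in>{0..2 * pi}. cmod (nderiv n (\<lambda>x. f x - ?s x) x))"
        by (rule cSUP_upper2[where x = 0]) auto
    qed auto
    also have "\<dots> \<le> \<bar>C\<bar> * (\<Sum>n\<le>N. R F n)"
      unfolding R_def by (intro mult_left_mono sum_mono cSUP_least fourier_remainder_bound f F) auto
    finally show ?thesis .
  qed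
  have R0: "((\<lambda>F. R F n) \<longlongrightarrow> 0) (finite_subsets_at_top UNIV)" for n
  proof -
    let ?a = "\<lambda>k. \<bar>of_int k\<bar> ^ n * cmod (fc f k)"
    have "((\<lambda>F. infsum ?a UNIV - sum ?a F) \<longlongrightarrow> infsum ?a UNIV - infsum ?a UNIV) (finite_subsets_at_top UNIV)"
      by (intro tendsto_intros infsum_tendsto rapid_summable f)
    moreover have "\<forall>\<^sub>F F in finite_subsets_at_top UNIV. infsum ?a UNIV - sum ?a F = R F n"
    proof (rule eventually_finite_subsets_at_top_weakI)
      fix F :: "int set" assume "finite F"
      then show "infsum ?a UNIV - sum ?a F = R F n"
        unfolding R_def Compl_eq_Diff_UNIV using rapid_summable[OF f, of n] by (subst infsum_Diff) auto
    qed
    ultimately have "((\<lambda>F. R F n) \<longlongrightarrow> infsum ?a UNIV - infsum ?a UNIV) (finite_subsets_at_top UNIV)"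
      by (rule Lim_transform_eventually)
    then show ?thesis by (simp only: diff_self)
  qed
  have "((\<lambda>F. \<bar>C\<bar> * (\<Sum>n\<le>N. R F n)) \<longlongrightarrow> \<bar>C\<bar> * (\<Sum>n\<le>N. 0)) (finite_subsets_at_top UNIV)"
    by (intro tendsto_intros R0)
  then have "((\<lambda>F. T f - (\<Sum>k\<in>F. fc f k * T (ex k))) \<longlongrightarrow> 0) (finite_subsets_at_top UNIV)"
    by (intro Lim_null_comparison[of "\<lambda>F. T f - (\<Sum>k\<in>F. fc f k * T (ex k))" "\<lambda>F. \<bar>C\<bar> * (\<Sum>n\<le>N. R F n)"])
       (auto intro: eventually_finite_subsets_at_top_weakI bound)
  from tendsto_diff[OF tendsto_const[of "T f"] this] show ?thesis by (simp add: has_sum_def)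
qed

lemma distribution_eqI:
  assumes S: "periodic_distribution S" and T: "periodic_distribution T" and eq: "\<And>k. fcoeff S k = fcoeff T k"
  shows "S = T"
proof
  fix f
  show "S f = T f"
  proof (cases "test_fun f")
    case True
    have "S (ex k) = T (ex k)" for k using eq[of "- k"] by (simp add: fcoeff_ex)
    then show ?thesis using distribution_expansion[OF S True] distribution_expansion[OF T True]
      by (simp add: has_sum_unique)
  next
    case False
    then show ?thesis using S T by (simp add: periodic_distribution_def)
  qed
qed

lemma distr_of_circ: "test_fun \<phi> \<Longrightarrow> distr_of f \<phi> = integral\<^sup>L circ (\<lambda>x. f x * \<phi> x)"
  by (simp add: distr_of_def circ_integral)

lemma fcoeff_distr_of: "fcoeff (distr_of f) k = fc f k"
  by (simp add: fcoeff_ex distr_of_circ test_fun_ex fc_def)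

lemma integrable_mult_test_fun:
  assumes f: "integrable circ f" and \<phi>: "test_fun \<phi>"
  shows "integrable circ (\<lambda>x. f x * \<phi> x)"
proof -
  obtain M where M: "M \<ge> 0" "\<And>x. cmod (\<phi> x) \<le> M" using test_fun_bounded[OF \<phi>] by blast
  have "\<phi> \<in> borel_measurable circ"
    by (intro borel_circ borel_measurable_continuous_onI test_fun_continuous \<phi>)
  then have m: "(\<lambda>x. f x * \<phi> x) \<in> borel_measurable circ"
    by (intro borel_measurable_times borel_measurable_integrable[OF f])
  show ?thesis
  proof (rule Bochner_Integration.integrable_bound[OF integrable_mult_left[OF integrable_norm[OF f], of M] m])
    show "AE x in circ. cmod (f x * \<phi> x) \<le> norm (cmod (f x) * M)"
      using M by (intro AE_I2) (simp add: norm_mult abs_mult mult_left_mono)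
  qed
qed

lemma periodic_distribution_distr_of:
  assumes f: "integrable circ f"
  shows "periodic_distribution (distr_of f)"
  unfolding periodic_distribution_def
proof (intro conjI allI impI)
  fix \<phi> \<psi> assume "test_fun \<phi>" "test_fun \<psi>"
  then show "distr_of f (\<lambda>x. \<phi> x + \<psi> x) = distr_of f \<phi> + distr_of f \<psi>"
    using integrable_mult_test_fun[OF f] by (simp add: distr_of_circ test_fun_add distrib_left)
next
  fix c \<phi> assume "test_fun \<phi>"
  then show "distr_of f (\<lambda>x. c * \<phi> x) = c * distr_of f \<phi>"
    by (simp add: distr_of_circ test_fun_cmult mult.left_commute[of "f _" c])
next
  show "\<exists>C N. \<forall>\<phi>. test_fun \<phi> \<longrightarrow> cmod (distr_of f \<phi>) \<le> C * (\<Sum>n\<le>N. SUP x\<in>{0..2 * pi}. cmod (nderiv n \<phi> x))"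
  proof (intro exI[of _ "integral\<^sup>L circ (\<lambda>x. cmod (f x))"] exI[of _ 0] allI impI)
    fix \<phi> assume \<phi>: "test_fun \<phi>"
    define M where "M = (SUP x\<in>{0..2 * pi}. cmod (\<phi> x))"
    obtain B where "\<And>x. cmod (\<phi> x) \<le> B" using test_fun_bounded[OF \<phi>] by blast
    then have "bdd_above ((\<lambda>x. cmod (\<phi> x)) ` {0..2 * pi})" by (intro bdd_aboveI2)
    then have M: "cmod (\<phi> x) \<le> M" if "x \<in> {0..2 * pi}" for x unfolding M_def using that by (intro cSUP_upper)
    have "cmod (distr_of f \<phi>) \<le> integral\<^sup>L circ (\<lambda>x. cmod (f x * \<phi> x))"
      unfolding distr_of_circ[OF \<phi>] by (rule integral_norm_bound)
    also have "\<dots> \<le> integral\<^sup>L circ (\<lambda>x. cmod (f x) * M)"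
    proof (rule integral_mono)
      show "integrable circ (\<lambda>x. cmod (f x * \<phi> x))" by (intro integrable_norm integrable_mult_test_fun f \<phi>)
      show "integrable circ (\<lambda>x. cmod (f x) * M)" by (intro integrable_mult_left integrable_norm f)
    qed (use M in \<open>auto simp: norm_mult intro!: mult_left_mono\<close>)
    finally show "cmod (distr_of f \<phi>) \<le> integral\<^sup>L circ (\<lambda>x. cmod (f x)) * (\<Sum>n\<le>0. SUP x\<in>{0..2 * pi}. cmod (nderiv n \<phi> x))"
      by (simp add: M_def)
  qed
qed (simp add: distr_of_def)

section \<open>The theorem of Riesz and Fischer\<close>

lemma circ_cauchy_schwarz:
  fixes u :: "real \<Rightarrow> real"
  assumes u: "integrable circ u" and u2: "integrable circ (\<lambda>x. (u x)\<^sup>2)"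
  shows "(integral\<^sup>L circ u)\<^sup>2 \<le> 2 * pi * integral\<^sup>L circ (\<lambda>x. (u x)\<^sup>2)"
proof -
  define a where "a = integral\<^sup>L circ u / (2 * pi)"
  have ua: "integrable circ (\<lambda>x. 2 * a * u x)" using u by simp
  have "0 \<le> integral\<^sup>L circ (\<lambda>x. (u x - a)\<^sup>2)" by simp
  also have "\<dots> = integral\<^sup>L circ (\<lambda>x. ((u x)\<^sup>2 - 2 * a * u x) + a\<^sup>2)"
    by (intro Bochner_Integration.integral_cong) (auto simp: power2_diff)
  also have "\<dots> = (integral\<^sup>L circ (\<lambda>x. (u x)\<^sup>2) - 2 * a * integral\<^sup>L circ u) + 2 * pi * a\<^sup>2"
    using u2 ua by (subst Bochner_Integration.integral_add, simp, simp)
      (subst Bochner_Integration.integral_diff, auto)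
  also have "\<dots> = integral\<^sup>L circ (\<lambda>x. (u x)\<^sup>2) - (integral\<^sup>L circ u)\<^sup>2 / (2 * pi)"
    by (simp add: a_def power2_eq_square field_simps)
  finally have "(integral\<^sup>L circ u)\<^sup>2 / (2 * pi) \<le> integral\<^sup>L circ (\<lambda>x. (u x)\<^sup>2)" by simp
  then show ?thesis by (subst (asm) pos_divide_le_eq) (simp_all add: mult.commute)
qed

lemma square_fatou:
  fixes u :: "nat \<Rightarrow> real \<Rightarrow> complex"
  assumes um: "\<And>n. u n \<in> borel_measurable circ" and fm: "f \<in> borel_measurable circ"
    and lim: "AE x in circ. (\<lambda>n. u n x) \<longlonglongrightarrow> f x"
    and u2: "\<And>n. integrable circ (\<lambda>x. (cmod (u n x))\<^sup>2)"
    and B: "\<And>n. integral\<^sup>L circ (\<lambda>x. (cmod (u n x))\<^sup>2) \<le> B"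
  shows "integrable circ (\<lambda>x. (cmod (f x))\<^sup>2)" "integral\<^sup>L circ (\<lambda>x. (cmod (f x))\<^sup>2) \<le> B"
proof -
  have sq: "(\<lambda>x. (cmod (v x))\<^sup>2) \<in> borel_measurable circ" if "v \<in> borel_measurable circ" for v :: "real \<Rightarrow> complex"
    by (rule measurable_compose[OF that], intro borel_measurable_continuous_onI continuous_intros)
  have B0: "0 \<le> B" by (rule order_trans[OF _ B[of 0]]) simp
  have "(\<integral>\<^sup>+x. ennreal ((cmod (f x))\<^sup>2) \<partial>circ) = (\<integral>\<^sup>+x. liminf (\<lambda>n. ennreal ((cmod (u n x))\<^sup>2)) \<partial>circ)"
  proof (rule nn_integral_cong_AE)
    show "AE x in circ. ennreal ((cmod (f x))\<^sup>2) = liminf (\<lambda>n. ennreal ((cmod (u n x))\<^sup>2))"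
      using lim
    proof eventually_elim
      case (elim x)
      have "(\<lambda>n. ennreal ((cmod (u n x))\<^sup>2)) \<longlonglongrightarrow> ennreal ((cmod (f x))\<^sup>2)"
        by (intro tendsto_intros elim)
      from lim_imp_Liminf[OF _ this] show ?case by simp
    qed
  qed
  also have "\<dots> \<le> liminf (\<lambda>n. \<integral>\<^sup>+x. ennreal ((cmod (u n x))\<^sup>2) \<partial>circ)"
    by (rule nn_integral_liminf) (rule measurable_compose[OF sq[OF um] measurable_ennreal])
  also have "\<dots> \<le> liminf (\<lambda>n::nat. ennreal B)"
  proof (rule Liminf_mono, rule always_eventually, rule allI)
    fix n
    show "(\<integral>\<^sup>+x. ennreal ((cmod (u n x))\<^sup>2) \<partial>circ) \<le> ennreal B"
      using B[of n] by (subst nn_integral_eq_integral[OF u2]) (auto intro: ennreal_leI)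
  qed
  also have "\<dots> = ennreal B" by (simp add: Liminf_const)
  finally have nn: "(\<integral>\<^sup>+x. ennreal ((cmod (f x))\<^sup>2) \<partial>circ) \<le> ennreal B" .
  show int: "integrable circ (\<lambda>x. (cmod (f x))\<^sup>2)"
  proof (rule integrableI_bounded[OF sq[OF fm]])
    show "(\<integral>\<^sup>+x. ennreal (norm ((cmod (f x))\<^sup>2)) \<partial>circ) < \<infinity>"
      using nn by (simp add: ennreal_less_top le_less_trans[OF _ ennreal_less_top])
  qed
  show "integral\<^sup>L circ (\<lambda>x. (cmod (f x))\<^sup>2) \<le> B"
    using nn B0 by (subst (asm) nn_integral_eq_integral[OF int]) (auto simp: ennreal_le_iff)
qed

lemma square_integrable_imp_integrable:
  fixes f :: "real \<Rightarrow> complex"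
  assumes "f \<in> borel_measurable circ" "integrable circ (\<lambda>x. (cmod (f x))\<^sup>2)"
  shows "integrable circ f"
proof (rule Bochner_Integration.integrable_bound[OF _ assms(1)])
  show "integrable circ (\<lambda>x. 1 + (cmod (f x))\<^sup>2)" using assms(2) by simp
  have "cmod (f x) \<le> 1 + (cmod (f x))\<^sup>2" for x
    using sum_squares_bound[of 1 "cmod (f x)"] norm_ge_zero[of "f x"]
    unfolding one_power2 mult_1_right by linarith
  then show "AE x in circ. cmod (f x) \<le> norm (1 + (cmod (f x))\<^sup>2)"
    by (intro AE_I2) (simp add: add_nonneg_nonneg)
qed

lemma L2_iff: "f \<in> L2 \<longleftrightarrow> periodic f \<and> f \<in> borel_measurable lborel \<and> integrable circ (\<lambda>x. (cmod (f x))\<^sup>2)"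
  by (simp only: L2_def circ_integrable_iff mem_Collect_eq)

lemma L2_measurable: "f \<in> L2 \<Longrightarrow> f \<in> borel_measurable circ"
  by (auto simp: L2_iff intro: borel_circ)

lemma L2_integrable: "f \<in> L2 \<Longrightarrow> integrable circ f"
  by (rule square_integrable_imp_integrable[OF L2_measurable]) (auto simp: L2_iff)

lemma L2_mult_integrable:
  assumes "f \<in> L2" "h \<in> L2"
  shows "integrable circ (\<lambda>x. f x * h x)"
proof (rule Bochner_Integration.integrable_bound)
  show "integrable circ (\<lambda>x. (cmod (f x))\<^sup>2 + (cmod (h x))\<^sup>2)" using assms by (simp add: L2_iff)
  show "(\<lambda>x. f x * h x) \<in> borel_measurable circ" by (intro borel_measurable_times L2_measurable assms)
  have "cmod (f x * h x) \<le> (cmod (f x))\<^sup>2 + (cmod (h x))\<^sup>2" for x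
    using sum_squares_bound[of "cmod (f x)" "cmod (h x)"]
      mult_nonneg_nonneg[OF norm_ge_zero[of "f x"] norm_ge_zero[of "h x"]]
    unfolding norm_mult mult.assoc by linarith
  then show "AE x in circ. cmod (f x * h x) \<le> norm ((cmod (f x))\<^sup>2 + (cmod (h x))\<^sup>2)"
    by (intro AE_I2) simp
qed

lemma continuous_periodic_L2:
  assumes "continuous_on UNIV f" "periodic f"
  shows "f \<in> L2"
  unfolding L2_iff
proof (intro conjI)
  show "f \<in> borel_measurable lborel" using borel_measurable_continuous_onI[OF assms(1)] by simp
  show "integrable circ (\<lambda>x. (cmod (f x))\<^sup>2)"
    by (intro circ_continuous(1) continuous_intros continuous_on_subset[OF assms(1)]) auto
qed (rule assms)

lemma L2_cnj:
  assumes "f \<in> L2"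
  shows "(\<lambda>x. cnj (f x)) \<in> L2"
proof -
  have "f \<in> borel_measurable lborel" using assms by (simp add: L2_iff)
  then have "(\<lambda>x. cnj (f x)) \<in> borel_measurable lborel"
    by (rule measurable_compose) (intro borel_measurable_continuous_onI continuous_intros)
  then show ?thesis using assms by (simp add: L2_iff periodic_def)
qed

lemma test_fun_L2: "test_fun f \<Longrightarrow> f \<in> L2"
  by (rule continuous_periodic_L2[OF test_fun_continuous]) (auto simp: test_fun_def)

lemma L2_add: 
  assumes "f \<in> L2" "h \<in> L2"
  shows "(\<lambda>x. f x + h x) \<in> L2"
  unfolding L2_iff
proof (intro conjI)
  show "periodic (\<lambda>x. f x + h x)" using assms by (simp add: L2_iff periodic_def)
  show "(\<lambda>x. f x + h x) \<in> borel_measurable lborel"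
    by (rule borel_measurable_add) (use assms in \<open>simp_all add: L2_iff\<close>)
  show "integrable circ (\<lambda>x. (cmod (f x + h x))\<^sup>2)"
  proof (rule Bochner_Integration.integrable_bound)
    show "integrable circ (\<lambda>x. 2 * (cmod (f x))\<^sup>2 + 2 * (cmod (h x))\<^sup>2)" using assms by (simp add: L2_iff)
    show "(\<lambda>x. (cmod (f x + h x))\<^sup>2) \<in> borel_measurable circ"
      by (rule measurable_compose[OF borel_measurable_add[OF L2_measurable[OF assms(1)] L2_measurable[OF assms(2)]]],
          intro borel_measurable_continuous_onI continuous_intros)
    have "(cmod (f x + h x))\<^sup>2 \<le> 2 * (cmod (f x))\<^sup>2 + 2 * (cmod (h x))\<^sup>2" for x
    proof -
      have "(cmod (f x + h x))\<^sup>2 \<le> (cmod (f x) + cmod (h x))\<^sup>2" by (intro power_mono norm_triangle_ineq) auto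
      then show ?thesis using sum_squares_bound[of "cmod (f x)" "cmod (h x)"] by (simp add: power2_sum)
    qed
    then show "AE x in circ. norm ((cmod (f x + h x))\<^sup>2) \<le> norm (2 * (cmod (f x))\<^sup>2 + 2 * (cmod (h x))\<^sup>2)"
      by (intro AE_I2) simp
  qed
qed

lemma trig_sum_periodic: "periodic (trig_sum S \<xi>)"
  by (simp add: periodic_def trig_sum_ex ex_periodic)

lemma trig_sum_L2: "trig_sum S \<xi> \<in> L2"
  by (intro continuous_periodic_L2 continuous_on_trig_sum trig_sum_periodic)

lemma trig_sum_sq_integral:
  assumes "finite S"
  shows "integral\<^sup>L circ (\<lambda>x. (cmod (trig_sum S \<xi> x))\<^sup>2) = 2 * pi * (\<Sum>k\<in>S. (cmod (\<xi> k))\<^sup>2)"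
proof -
  have "complex_of_real (integral\<^sup>L circ (\<lambda>x. (cmod (trig_sum S \<xi> x))\<^sup>2))
     = integral\<^sup>L circ (\<lambda>x. trig_sum S \<xi> x * cnj (trig_sum S \<xi> x))"
    unfolding complex_norm_square[symmetric] by (rule integral_complex_of_real[symmetric])
  then show ?thesis unfolding trig_sum_norm_sq[OF assms] of_real_eq_iff .
qed

lemma fc_trig_sum:
  assumes S: "finite S"
  shows "fc (trig_sum S \<xi>) k = (if k \<in> S then \<xi> k else 0)"
proof -
  have "fc (trig_sum S \<xi>) k = (\<Sum>l\<in>S. \<xi> l * fc (ex l) k)"
    unfolding trig_sum_ex[abs_def] by (rule fc_sum[OF S circ_continuous(1)[OF continuous_on_ex]])
  also have "\<dots> = (\<Sum>l\<in>S. if l = k then \<xi> l else 0)" by (intro sum.cong) (auto simp: fc_ex)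
  finally show ?thesis using S by simp
qed

text \<open>The symmetric partial sums are Cauchy in \<open>L\<^sup>2\<close>, hence in \<open>L\<^sup>1\<close>, and a subsequence converges almost everywhere. By Fatou's lemma
the limit is as close to the partial sums in \<open>L\<^sup>2\<close> as the tail of the series tells, which identifies its coefficients by
Bessel's inequality.\<close>

lemma riesz_fischer:
  assumes c: "(\<lambda>k. (cmod (c k))\<^sup>2) summable_on UNIV"
  obtains f where "f \<in> L2" "\<And>k. fc f k = c k"
proof -
  define I where "I = (\<lambda>N::nat. {- int N..int N})"
  define S where "S = (\<lambda>N. trig_sum (I N) c)"
  define E where "E = (\<lambda>N. infsum (\<lambda>k. (cmod (c k))\<^sup>2) UNIV - (\<Sum>k\<in>I N. (cmod (c k))\<^sup>2))"
  have I: "finite (I N)" "i \<le> j \<Longrightarrow> I i \<subseteq> I j" for N i j by (auto simp: I_def)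
  have E0: "E \<longlonglongrightarrow> 0"
  proof -
    have "(\<lambda>N. \<Sum>k\<in>I N. (cmod (c k))\<^sup>2) \<longlonglongrightarrow> infsum (\<lambda>k. (cmod (c k))\<^sup>2) UNIV"
      unfolding I_def using filterlim_compose[OF infsum_tendsto[OF c] symmetric_intervals_at_top] by simp
    from tendsto_diff[OF tendsto_const this] show ?thesis unfolding E_def by (metis diff_self)
  qed
  have diff: "S j x - S i x = trig_sum (I j - I i) c x" if "i \<le> j" for i j x
    using I(2)[OF that] I(1) by (simp add: S_def trig_sum_def sum_diff)
  have tail: "integral\<^sup>L circ (\<lambda>x. (cmod (S j x - S i x))\<^sup>2) \<le> 2 * pi * E i" if "i \<le> j" for i j
  proof -
    have "(\<Sum>k\<in>I j - I i. (cmod (c k))\<^sup>2) = (\<Sum>k\<in>I j. (cmod (c k))\<^sup>2) - (\<Sum>k\<in>I i. (cmod (c k))\<^sup>2)"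
      by (rule sum_diff[OF I(1) I(2)[OF that]])
    also have "\<dots> \<le> E i" unfolding E_def
      by (intro diff_right_mono finite_sum_le_infsum c I) auto
    finally show ?thesis unfolding diff[OF that] using I by (subst trig_sum_sq_integral) auto
  qed
  have Sc: "continuous_on A (S N)" for A N unfolding S_def by (rule continuous_on_trig_sum)
  have Si: "integrable circ (S N)" for N by (rule circ_continuous(1)[OF Sc])
  have dsq: "integrable circ (\<lambda>x. (cmod (S j x - S i x))\<^sup>2)" and dn: "integrable circ (\<lambda>x. cmod (S j x - S i x))" for i j
    by (intro circ_continuous(1) continuous_intros Sc)+
  have L1: "(integral\<^sup>L circ (\<lambda>x. cmod (S j x - S i x)))\<^sup>2 \<le> (2 * pi)\<^sup>2 * E i" if "i \<le> j" for i j
  proof -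
    have "(integral\<^sup>L circ (\<lambda>x. cmod (S j x - S i x)))\<^sup>2 \<le> 2 * pi * integral\<^sup>L circ (\<lambda>x. (cmod (S j x - S i x))\<^sup>2)"
      by (rule circ_cauchy_schwarz[OF dn dsq])
    also have "\<dots> \<le> 2 * pi * (2 * pi * E i)" by (intro mult_left_mono tail that) auto
    finally show ?thesis by (simp add: power2_eq_square)
  qed
  have cauchy: "\<exists>N. \<forall>i\<ge>N. \<forall>j\<ge>N. integral\<^sup>L circ (\<lambda>x. norm (S i x - S j x)) < e" if e: "e > 0" for e
  proof -
    have "(\<lambda>i. (2 * pi)\<^sup>2 * E i) \<longlonglongrightarrow> (2 * pi)\<^sup>2 * 0" by (intro tendsto_intros E0)
    from order_tendstoD(2)[OF this, of "e\<^sup>2"] have "\<forall>\<^sub>F i in sequentially. (2 * pi)\<^sup>2 * E i < e\<^sup>2" using e by simp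
    then obtain N where N: "\<And>i. i \<ge> N \<Longrightarrow> (2 * pi)\<^sup>2 * E i < e\<^sup>2" by (auto simp: eventually_sequentially)
    have ij: "integral\<^sup>L circ (\<lambda>x. norm (S j x - S i x)) < e" if "i \<ge> N" "i \<le> j" for i j
      using L1[OF that(2)] N[OF that(1)] e by (intro power2_less_imp_less[of _ e]) auto
    show ?thesis
    proof (intro exI[of _ N] allI impI)
      fix i j assume "N \<le> i" "N \<le> j"
      then show "integral\<^sup>L circ (\<lambda>x. norm (S i x - S j x)) < e"
        using ij[of i j] ij[of j i] by (cases "i \<le> j") (auto simp: norm_minus_commute)
    qed
  qed
  obtain r where r: "strict_mono r" "AE x in circ. Cauchy (\<lambda>i. S (r i) x)"
    using cauchy_L1_AE_cauchy_subseq[OF Si cauchy] by blast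
  define f where "f = (\<lambda>x. lim (\<lambda>i. S (r i) x))"
  have fb: "f \<in> borel_measurable borel" unfolding f_def
    by (rule borel_measurable_lim_metric) (rule borel_measurable_continuous_onI[OF Sc])
  have fp: "periodic f" unfolding f_def periodic_def S_def using trig_sum_periodic by (simp add: periodic_def)
  have lim: "AE x in circ. (\<lambda>i. S (r i) x) \<longlonglongrightarrow> f x"
    using r(2) by eventually_elim (simp add: f_def convergent_LIMSEQ_iff[symmetric] Cauchy_convergent_iff)
  have tail_f: "integrable circ (\<lambda>x. (cmod (f x - S N x))\<^sup>2) \<and> integral\<^sup>L circ (\<lambda>x. (cmod (f x - S N x))\<^sup>2) \<le> 2 * pi * E N" for N
  proof -
    define u where "u = (\<lambda>i x. S (r (i + N)) x - S N x)"
    have u1: "u i \<in> borel_measurable circ" for i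
      unfolding u_def by (intro borel_circ borel_measurable_continuous_onI continuous_intros Sc)
    have u2: "(\<lambda>x. f x - S N x) \<in> borel_measurable circ"
      by (intro borel_circ borel_measurable_diff fb borel_measurable_continuous_onI Sc)
    have u3: "AE x in circ. (\<lambda>i. u i x) \<longlonglongrightarrow> f x - S N x"
      using lim unfolding u_def by eventually_elim (intro tendsto_intros LIMSEQ_ignore_initial_segment)
    have rN: "N \<le> r (i + N)" for i using seq_suble[OF r(1), of "i + N"] by linarith
    have u4: "integral\<^sup>L circ (\<lambda>x. (cmod (u i x))\<^sup>2) \<le> 2 * pi * E N" for i
      unfolding u_def by (rule tail[OF rN])
    show ?thesis using square_fatou[OF u1 u2 u3 _ u4] dsq unfolding u_def by blast
  qed
  have fL2: "f \<in> L2"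
  proof -
    have "(\<lambda>x. f x - S 0 x) \<in> L2"
      unfolding L2_iff using tail_f[of 0] fp trig_sum_periodic fb borel_measurable_continuous_onI[OF Sc]
      by (auto simp: periodic_def S_def)
    from L2_add[OF this trig_sum_L2[of "I 0" c]] show ?thesis by (simp add: S_def)
  qed
  have "fc f k = c k" for k
  proof -
    have b: "(cmod (fc f k - c k))\<^sup>2 \<le> E N" if "nat \<bar>k\<bar> \<le> N" for N
    proof -
      have "k \<in> I N" using that by (auto simp: I_def)
      then have "fc f k - c k = fc (\<lambda>x. f x - S N x) k"
        using I(1) by (simp add: fc_diff L2_integrable[OF fL2] Si) (simp add: S_def fc_trig_sum)
      moreover have "(\<Sum>k\<in>{k}. (cmod (fc (\<lambda>x. f x - S N x) k))\<^sup>2) \<le> integral\<^sup>L circ (\<lambda>x. (cmod (f x - S N x))\<^sup>2) / (2 * pi)"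
        using tail_f[of N] L2_integrable[OF fL2] Si by (intro bessel_inequality) auto
      moreover have "integral\<^sup>L circ (\<lambda>x. (cmod (f x - S N x))\<^sup>2) / (2 * pi) \<le> E N"
        using tail_f[of N] by (simp add: pos_divide_le_eq mult.commute)
      ultimately show ?thesis by simp
    qed
    have "(cmod (fc f k - c k))\<^sup>2 \<le> 0"
      by (rule LIMSEQ_le_const[OF E0]) (use b in blast)
    then show ?thesis by simp
  qed
  then show ?thesis using that fL2 by blast
qed

section \<open>The control operator in coordinates\<close>

locale control =
  fixes g :: "real \<Rightarrow> real"
  assumes g_smooth: "smooth g" and g_periodic: "periodic g" and g_mean: "(LBINT x:{0..2 * pi}. g x) = 1"
begin

abbreviation gc :: "real \<Rightarrow> complex" where "gc \<equiv> \<lambda>x. complex_of_real (g x)"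

lemma test_fun_gc: "test_fun gc"
  using g_periodic by (simp add: test_fun_def smooth_of_real[OF g_smooth] periodic_def)

lemma gc_L2: "gc \<in> L2" by (rule test_fun_L2[OF test_fun_gc])

lemma g_continuous: "continuous_on A g" by (rule smooth_continuous[OF g_smooth])

lemma integral_gc: "integral\<^sup>L circ gc = 1"
proof -
  have "integral\<^sup>L circ gc = complex_of_real (integral\<^sup>L circ g)" by (rule integral_complex_of_real)
  then show ?thesis using g_mean by (simp add: circ_integral)
qed

definition avg :: "(real \<Rightarrow> complex) \<Rightarrow> complex" where
  "avg f = integral\<^sup>L circ (\<lambda>y. gc y * f y)"

lemma G_eq: "G g f = (\<lambda>x. gc x * (f x - avg f))"
  by (simp add: G_def avg_def circ_integral)

lemma integrable_gc_mult: "integrable circ f \<Longrightarrow> integrable circ (\<lambda>x. gc x * f x)"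
  using integrable_mult_test_fun[OF _ test_fun_gc, of f] by (simp add: mult.commute)

lemma test_fun_G: "test_fun f \<Longrightarrow> test_fun (G g f)"
  unfolding G_eq by (intro test_fun_mult test_fun_gc test_fun_diff test_fun_const)

lemma integrable_G: "integrable circ f \<Longrightarrow> integrable circ (G g f)"
  unfolding G_eq by (intro integrable_gc_mult Bochner_Integration.integrable_diff) auto

lemma G_L2:
  assumes f: "f \<in> L2"
  shows "G g f \<in> L2"
proof -
  obtain M where M: "M \<ge> 0" "\<And>x. cmod (gc x) \<le> M" using test_fun_bounded[OF test_fun_gc] by blast
  have d: "(\<lambda>x. f x - avg f) \<in> L2"
    using L2_add[OF f test_fun_L2[OF test_fun_const[of "- avg f"]]] by simp
  have p: "(cmod (gc x))\<^sup>2 \<le> M\<^sup>2" for x by (rule power_mono[OF M(2)]) simp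
  have gm: "gc \<in> borel_measurable lborel" using gc_L2 by (simp add: L2_iff)
  have dm: "(\<lambda>x. f x - avg f) \<in> borel_measurable lborel" using d by (simp add: L2_iff)
  show ?thesis unfolding L2_iff G_eq
  proof (intro conjI)
    show "periodic (\<lambda>x. gc x * (f x - avg f))" using f g_periodic by (simp add: L2_iff periodic_def)
    show m: "(\<lambda>x. gc x * (f x - avg f)) \<in> borel_measurable lborel" by (rule borel_measurable_times[OF gm dm])
    show "integrable circ (\<lambda>x. (cmod (gc x * (f x - avg f)))\<^sup>2)"
    proof (rule Bochner_Integration.integrable_bound)
      show "integrable circ (\<lambda>x. M\<^sup>2 * (cmod (f x - avg f))\<^sup>2)" using d by (simp add: L2_iff)
      have "(\<lambda>x. gc x * (f x - avg f)) \<in> borel_measurable circ" using m by (intro borel_circ) simp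
      then show "(\<lambda>x. (cmod (gc x * (f x - avg f)))\<^sup>2) \<in> borel_measurable circ"
        by (rule measurable_compose) (intro borel_measurable_continuous_onI continuous_intros)
      show "AE x in circ. norm ((cmod (gc x * (f x - avg f)))\<^sup>2) \<le> norm (M\<^sup>2 * (cmod (f x - avg f))\<^sup>2)"
        by (intro AE_I2) (use p in \<open>simp add: norm_mult power_mult_distrib mult_right_mono\<close>)
    qed
  qed
qed

lemma G_sum:
  assumes F: "finite F" and f: "\<And>k. k \<in> F \<Longrightarrow> integrable circ (f k)"
  shows "G g (\<lambda>x. \<Sum>k\<in>F. c k * f k x) = (\<lambda>x. \<Sum>k\<in>F. c k * G g (f k) x)"
proof -
  have "avg (\<lambda>x. \<Sum>k\<in>F. c k * f k x) = (\<Sum>k\<in>F. c k * avg (f k))"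
    unfolding avg_def sum_distrib_left mult.left_commute[of "gc _" "c _"]
    using f by (subst Bochner_Integration.integral_sum) (auto intro!: integrable_mult_right integrable_gc_mult)
  then show ?thesis unfolding G_eq
    by (simp add: fun_eq_iff sum_distrib_left sum_subtractf right_diff_distrib mult_ac)
qed

lemma G_self_adjoint:
  assumes f: "f \<in> L2" and h: "h \<in> L2"
  shows "integral\<^sup>L circ (\<lambda>x. G g f x * cnj (h x)) = integral\<^sup>L circ (\<lambda>x. f x * cnj (G g h x))"
proof -
  have fh: "integrable circ (\<lambda>x. gc x * (f x * cnj (h x)))"
    by (intro integrable_gc_mult L2_mult_integrable f L2_cnj h)
  have gh: "integrable circ (\<lambda>x. gc x * cnj (h x))" and gf: "integrable circ (\<lambda>x. gc x * f x)"
    by (intro integrable_gc_mult L2_integrable L2_cnj h f)+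
  have ch: "integral\<^sup>L circ (\<lambda>x. gc x * cnj (h x)) = cnj (avg h)"
    unfolding avg_def using Bochner_Integration.integral_cnj[of circ "\<lambda>x. gc x * h x"] by simp
  have "integral\<^sup>L circ (\<lambda>x. G g f x * cnj (h x))
      = integral\<^sup>L circ (\<lambda>x. gc x * (f x * cnj (h x)) - avg f * (gc x * cnj (h x)))"
    by (intro Bochner_Integration.integral_cong) (auto simp: G_eq algebra_simps)
  also have "\<dots> = integral\<^sup>L circ (\<lambda>x. gc x * (f x * cnj (h x))) - avg f * cnj (avg h)"
    using fh gh by (subst Bochner_Integration.integral_diff) (simp_all add: ch)
  also have "\<dots> = integral\<^sup>L circ (\<lambda>x. gc x * (f x * cnj (h x)) - cnj (avg h) * (gc x * f x))"
    using fh gf by (subst Bochner_Integration.integral_diff) (simp_all add: avg_def[of f] mult.commute)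
  also have "\<dots> = integral\<^sup>L circ (\<lambda>x. f x * cnj (G g h x))"
    by (intro Bochner_Integration.integral_cong) (auto simp: G_eq algebra_simps)
  finally show ?thesis .
qed

definition matrix :: "int \<Rightarrow> int \<Rightarrow> complex" where
  "matrix k l = fc (G g (G g (ex l))) k"

lemma GG_trig_sum:
  assumes "finite S"
  shows "G g (G g (trig_sum S \<xi>)) = (\<lambda>x. \<Sum>l\<in>S. \<xi> l * G g (G g (ex l)) x)"
proof -
  have "G g (trig_sum S \<xi>) = (\<lambda>x. \<Sum>l\<in>S. \<xi> l * G g (ex l) x)"
    unfolding trig_sum_ex[abs_def] using assms by (intro G_sum) (auto intro: circ_continuous(1) continuous_on_ex)
  then show ?thesis using assms
    by (simp only:) (intro G_sum; auto intro: integrable_G circ_continuous(1) continuous_on_ex)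
qed

lemma integrable_GG_ex: "integrable circ (G g (G g (ex l)))"
  by (intro integrable_G circ_continuous(1) continuous_on_ex)

lemma matrix_row_sum:
  assumes "finite S"
  shows "(\<Sum>l\<in>S. matrix k l * \<xi> l) = fc (G g (G g (trig_sum S \<xi>))) k"
  unfolding GG_trig_sum[OF assms] matrix_def
  by (subst fc_sum[OF assms integrable_GG_ex]) (simp add: mult.commute)

text \<open>Summing the coefficients of \<open>G G \<psi>\<close> against those of the trigonometric sum \<open>\<psi>\<close> gives \<open>\<langle>G G \<psi>, \<psi>\<rangle> = \<langle>G \<psi>, G \<psi>\<rangle>\<close>.\<close>

lemma matrix_quadratic_form:
  assumes S: "finite S"
  shows "(\<Sum>k\<in>S. \<Sum>l\<in>S. Re (matrix k l * \<xi> l * cnj (\<xi> k)))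
    = integral\<^sup>L circ (\<lambda>x. (cmod (G g (trig_sum S \<xi>) x))\<^sup>2) / (2 * pi)"
proof -
  let ?\<psi> = "trig_sum S \<xi>"
  let ?h = "G g (G g ?\<psi>)"
  have hi: "integrable circ ?h" by (intro integrable_G L2_integrable trig_sum_L2)
  have "(\<Sum>k\<in>S. \<Sum>l\<in>S. matrix k l * \<xi> l * cnj (\<xi> k)) = (\<Sum>k\<in>S. fc ?h k * cnj (\<xi> k))"
    by (simp add: matrix_row_sum[OF S, symmetric] sum_distrib_right)
  also have "\<dots> = integral\<^sup>L circ (\<lambda>x. \<Sum>k\<in>S. ?h x * ex (- k) x * cnj (\<xi> k)) / (2 * pi)"
    using integrable_mult_ex[OF hi]
    by (subst Bochner_Integration.integral_sum) (auto simp: fc_def sum_divide_distrib)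
  also have "integral\<^sup>L circ (\<lambda>x. \<Sum>k\<in>S. ?h x * ex (- k) x * cnj (\<xi> k)) = integral\<^sup>L circ (\<lambda>x. ?h x * cnj (?\<psi> x))"
    by (intro Bochner_Integration.integral_cong) (auto simp: trig_sum_ex cnj_ex sum_distrib_left mult_ac)
  also have "\<dots> = integral\<^sup>L circ (\<lambda>x. G g ?\<psi> x * cnj (G g ?\<psi> x))"
    by (intro G_self_adjoint G_L2 trig_sum_L2)
  also have "\<dots> = complex_of_real (integral\<^sup>L circ (\<lambda>x. (cmod (G g ?\<psi> x))\<^sup>2))"
    unfolding complex_norm_square[symmetric] by (rule integral_complex_of_real)
  finally have "(\<Sum>k\<in>S. \<Sum>l\<in>S. matrix k l * \<xi> l * cnj (\<xi> k))
      = complex_of_real (integral\<^sup>L circ (\<lambda>x. (cmod (G g ?\<psi> x))\<^sup>2) / (2 * pi))" by simp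
  then have "Re (\<Sum>k\<in>S. \<Sum>l\<in>S. matrix k l * \<xi> l * cnj (\<xi> k)) = integral\<^sup>L circ (\<lambda>x. (cmod (G g ?\<psi> x))\<^sup>2) / (2 * pi)"
    by (simp only: Re_complex_of_real)
  then show ?thesis by simp
qed

lemma G_bounded: "\<exists>C>0. \<forall>h. continuous_on {0..2 * pi} h \<longrightarrow>
    integral\<^sup>L circ (\<lambda>x. (cmod (G g h x))\<^sup>2) \<le> C * integral\<^sup>L circ (\<lambda>x. (cmod (h x))\<^sup>2)"
proof -
  obtain M0 where M0: "\<And>x. cmod (gc x) \<le> M0" using test_fun_bounded[OF test_fun_gc] by blast
  define M where "M = max 1 M0"
  have M: "1 \<le> M" "\<And>x. cmod (gc x) \<le> M" using M0 by (auto simp: M_def le_max_iff_disj)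
  define C where "C = 2 * M\<^sup>2 * (1 + (2 * pi)\<^sup>2 * M\<^sup>2)"
  have "integral\<^sup>L circ (\<lambda>x. (cmod (G g h x))\<^sup>2) \<le> C * integral\<^sup>L circ (\<lambda>x. (cmod (h x))\<^sup>2)"
    if h: "continuous_on {0..2 * pi} h" for h
  proof -
    define Q where "Q = integral\<^sup>L circ (\<lambda>x. (cmod (h x))\<^sup>2)"
    have hi: "integrable circ h" "integrable circ (\<lambda>x. cmod (h x))" "integrable circ (\<lambda>x. (cmod (h x))\<^sup>2)"
      by (intro circ_continuous(1) continuous_intros h)+
    have gcc: "continuous_on A gc" for A by (intro continuous_intros g_continuous)
    have "cmod (avg h) \<le> integral\<^sup>L circ (\<lambda>x. cmod (gc x * h x))" unfolding avg_def by (rule integral_norm_bound)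
    also have "\<dots> \<le> integral\<^sup>L circ (\<lambda>x. M * cmod (h x))"
    proof (rule integral_mono)
      show "integrable circ (\<lambda>x. cmod (gc x * h x))" by (intro integrable_norm integrable_gc_mult hi)
      show "integrable circ (\<lambda>x. M * cmod (h x))" using hi(2) by simp
      show "cmod (gc x * h x) \<le> M * cmod (h x)" for x using M by (simp only: norm_mult mult_right_mono norm_ge_zero)
    qed
    finally have "cmod (avg h) \<le> M * integral\<^sup>L circ (\<lambda>x. cmod (h x))" by simp
    then have "(cmod (avg h))\<^sup>2 \<le> M\<^sup>2 * (integral\<^sup>L circ (\<lambda>x. cmod (h x)))\<^sup>2"
      by (metis norm_ge_zero power_mono power_mult_distrib)
    also have "\<dots> \<le> M\<^sup>2 * (2 * pi * Q)"
      unfolding Q_def by (intro mult_left_mono circ_cauchy_schwarz hi) auto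
    finally have avg: "(cmod (avg h))\<^sup>2 \<le> 2 * pi * M\<^sup>2 * Q" by (simp add: mult_ac)
    have "integral\<^sup>L circ (\<lambda>x. (cmod (G g h x))\<^sup>2) \<le> integral\<^sup>L circ (\<lambda>x. 2 * M\<^sup>2 * (cmod (h x))\<^sup>2 + 2 * M\<^sup>2 * (2 * pi * M\<^sup>2 * Q))"
    proof (rule integral_mono)
      show "integrable circ (\<lambda>x. (cmod (G g h x))\<^sup>2)"
        unfolding G_eq by (intro circ_continuous(1) continuous_intros h gcc g_continuous)
      show "integrable circ (\<lambda>x. 2 * M\<^sup>2 * (cmod (h x))\<^sup>2 + 2 * M\<^sup>2 * (2 * pi * M\<^sup>2 * Q))" using hi(3) by simp
      fix x
      have "cmod (h x - avg h) \<le> cmod (h x) + cmod (avg h)" by (rule norm_triangle_ineq4)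
      then have "(cmod (h x - avg h))\<^sup>2 \<le> (cmod (h x) + cmod (avg h))\<^sup>2" by (rule power_mono) simp
      also have "\<dots> \<le> 2 * (cmod (h x))\<^sup>2 + 2 * (cmod (avg h))\<^sup>2"
        using sum_squares_bound[of "cmod (h x)" "cmod (avg h)"] by (simp add: power2_sum)
      also have "\<dots> \<le> 2 * (cmod (h x))\<^sup>2 + 2 * (2 * pi * M\<^sup>2 * Q)"
        by (intro add_left_mono mult_left_mono avg) simp
      finally have d: "(cmod (h x - avg h))\<^sup>2 \<le> 2 * (cmod (h x))\<^sup>2 + 2 * (2 * pi * M\<^sup>2 * Q)" .
      have "(cmod (G g h x))\<^sup>2 = (cmod (gc x))\<^sup>2 * (cmod (h x - avg h))\<^sup>2" by (simp only: G_eq norm_mult power_mult_distrib)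
      also have "\<dots> \<le> M\<^sup>2 * (2 * (cmod (h x))\<^sup>2 + 2 * (2 * pi * M\<^sup>2 * Q))"
        by (intro mult_mono power_mono M(2) d) auto
      finally show "(cmod (G g h x))\<^sup>2 \<le> 2 * M\<^sup>2 * (cmod (h x))\<^sup>2 + 2 * M\<^sup>2 * (2 * pi * M\<^sup>2 * Q)"
        by (simp only: distrib_left mult_ac)
    qed
    also have "\<dots> = 2 * M\<^sup>2 * Q + 2 * pi * (2 * M\<^sup>2 * (2 * pi * M\<^sup>2 * Q))"
      unfolding Q_def using hi(3) by simp
    also have "\<dots> = C * Q" by (simp add: C_def power2_eq_square algebra_simps)
    finally show ?thesis by (simp only: Q_def)
  qed
  moreover have "0 < C" using M(1) by (simp add: C_def add_pos_nonneg)
  ultimately show ?thesis by blast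
qed

text \<open>Bessel's inequality for \<open>G G \<psi>\<close>, and boundedness of \<open>G\<close> applied to \<open>G \<psi>\<close>.\<close>

lemma matrix_square_le: "\<exists>C>0. \<forall>S F \<xi>. finite S \<longrightarrow> finite F \<longrightarrow>
   (\<Sum>k\<in>F. (cmod (\<Sum>l\<in>S. matrix k l * \<xi> l))\<^sup>2) \<le> C * (\<Sum>k\<in>S. \<Sum>l\<in>S. Re (matrix k l * \<xi> l * cnj (\<xi> k)))"
proof -
  obtain C where C: "C > 0" "\<And>h. continuous_on {0..2 * pi} h \<Longrightarrow>
    integral\<^sup>L circ (\<lambda>x. (cmod (G g h x))\<^sup>2) \<le> C * integral\<^sup>L circ (\<lambda>x. (cmod (h x))\<^sup>2)" using G_bounded by blast
  have "(\<Sum>k\<in>F. (cmod (\<Sum>l\<in>S. matrix k l * \<xi> l))\<^sup>2) \<le> C * (\<Sum>k\<in>S. \<Sum>l\<in>S. Re (matrix k l * \<xi> l * cnj (\<xi> k)))"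
    if S: "finite S" and F: "finite F" for S F \<xi>
  proof -
    let ?u = "G g (trig_sum S \<xi>)"
    have uc: "continuous_on {0..2 * pi} ?u"
      unfolding G_eq by (intro continuous_intros g_continuous)
    have GL: "G g ?u \<in> L2" by (intro G_L2 trig_sum_L2)
    have "(\<Sum>k\<in>F. (cmod (\<Sum>l\<in>S. matrix k l * \<xi> l))\<^sup>2) \<le> integral\<^sup>L circ (\<lambda>x. (cmod (G g ?u x))\<^sup>2) / (2 * pi)"
      unfolding matrix_row_sum[OF S] using GL by (intro bessel_inequality F L2_integrable) (auto simp: L2_iff)
    also have "\<dots> \<le> C * integral\<^sup>L circ (\<lambda>x. (cmod (?u x))\<^sup>2) / (2 * pi)"
      by (intro divide_right_mono C uc) auto
    finally show ?thesis unfolding matrix_quadratic_form[OF S] by simp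
  qed
  then show ?thesis using C(1) by blast
qed

text \<open>A continuous function with integral \<open>1\<close> over the period is nonzero at some interior point.\<close>

lemma g_positive_interval: "\<exists>a b g0. 0 \<le> a \<and> a < b \<and> b \<le> 2 * pi \<and> 0 < g0 \<and> (\<forall>x\<in>{a..b}. g0 \<le> \<bar>g x\<bar>)"
proof -
  have "\<exists>x0. 0 < x0 \<and> x0 < 2 * pi \<and> g x0 \<noteq> 0"
  proof (rule ccontr)
    assume none: "\<not> ?thesis"
    have z: "g x = 0" if "0 < x" "x < 2 * pi" for x using that none by blast
    have "integral\<^sup>L circ g = integral {0..2 * pi} g" by (rule circ_continuous(2)[OF g_continuous])
    also have "\<dots> = integral {0..2 * pi} (\<lambda>x. 0)"
      by (rule integral_spike[of "{0, 2 * pi}"]) (use z in \<open>auto simp: less_le\<close>)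
    finally show False using g_mean by (simp add: circ_integral)
  qed
  then obtain x0 where x0: "0 < x0" "x0 < 2 * pi" "g x0 \<noteq> 0" by blast
  have "isCont g x0" using g_continuous[of UNIV] by (simp add: continuous_on_eq_continuous_at)
  then have "\<forall>\<^sub>F x in at x0. dist (g x) (g x0) < \<bar>g x0\<bar> / 2"
    unfolding isCont_def using x0(3) by (intro tendstoD) auto
  then obtain d where d: "d > 0" "\<And>x. x \<noteq> x0 \<Longrightarrow> dist x x0 < d \<Longrightarrow> dist (g x) (g x0) < \<bar>g x0\<bar> / 2"
    unfolding eventually_at by auto
  define b where "b = min (2 * pi) (x0 + d / 2)"
  show ?thesis
  proof (rule exI[of _ x0], rule exI[of _ b], rule exI[of _ "\<bar>g x0\<bar> / 2"], intro conjI ballI)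
    fix x assume x: "x \<in> {x0..b}"
    show "\<bar>g x0\<bar> / 2 \<le> \<bar>g x\<bar>"
    proof (cases "x = x0")
      case False
      then have "dist (g x) (g x0) < \<bar>g x0\<bar> / 2" using x d(1) by (intro d(2)) (auto simp: b_def dist_real_def)
      then show ?thesis unfolding dist_real_def by linarith
    qed simp
  qed (use x0 d(1) in \<open>auto simp: b_def\<close>)
qed

text \<open>On an interval where \<open>g\<close> does not vanish, \<open>G\<close> sees a trigonometric sum up to a constant; the constant is one more
  frequency, namely \<open>0\<close>.\<close>

lemma matrix_coercive: "\<exists>c>0. \<forall>S \<xi>. finite S \<longrightarrow> 0 \<notin> S \<longrightarrow> card S \<le> n \<longrightarrow>
   c * (\<Sum>k\<in>S. (cmod (\<xi> k))\<^sup>2) \<le> (\<Sum>k\<in>S. \<Sum>l\<in>S. Re (matrix k l * \<xi> l * cnj (\<xi> k)))"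
proof -
  obtain a b g0 where ab: "0 \<le> a" "a < b" "b \<le> 2 * pi" "0 < g0" "\<And>x. x \<in> {a..b} \<Longrightarrow> g0 \<le> \<bar>g x\<bar>"
    using g_positive_interval by blast
  obtain c where c: "c > 0" "\<And>S \<xi>. finite S \<Longrightarrow> card S \<le> Suc n \<Longrightarrow>
    c * (\<Sum>k\<in>S. (cmod (\<xi> k))\<^sup>2) \<le> integral {a..b} (\<lambda>x. (cmod (trig_sum S \<xi> x))\<^sup>2)"
    using trig_sum_interval_lower_bound[OF ab(2), of "Suc n"] by blast
  have "g0\<^sup>2 * c / (2 * pi) * (\<Sum>k\<in>S. (cmod (\<xi> k))\<^sup>2) \<le> (\<Sum>k\<in>S. \<Sum>l\<in>S. Re (matrix k l * \<xi> l * cnj (\<xi> k)))"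
    if S: "finite S" "0 \<notin> S" "card S \<le> n" for S \<xi>
  proof -
    let ?\<psi> = "trig_sum S \<xi>"
    \<comment> \<open>\<open>\<psi> - avg \<psi>\<close> is a trigonometric sum with the additional frequency \<open>0\<close>.\<close>
    define \<zeta> where "\<zeta> = (\<lambda>k. if k = 0 then - avg ?\<psi> else \<xi> k)"
    have shift: "trig_sum (insert 0 S) \<zeta> x = ?\<psi> x - avg ?\<psi>" for x
    proof -
      have "(\<Sum>k\<in>S. \<zeta> k * ex k x) = (\<Sum>k\<in>S. \<xi> k * ex k x)" using S(2) by (intro sum.cong) (auto simp: \<zeta>_def)
      then show ?thesis using S by (simp add: trig_sum_ex \<zeta>_def)
    qed
    have Gi: "(\<lambda>x. (cmod (G g ?\<psi> x))\<^sup>2) integrable_on {c..d}" for c d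
      unfolding G_eq by (intro integrable_continuous_real continuous_intros g_continuous)
    have "(\<Sum>k\<in>S. (cmod (\<xi> k))\<^sup>2) = (\<Sum>k\<in>S. (cmod (\<zeta> k))\<^sup>2)" using S(2) by (intro sum.cong) (auto simp: \<zeta>_def)
    also have "\<dots> \<le> (\<Sum>k\<in>insert 0 S. (cmod (\<zeta> k))\<^sup>2)" using S by (intro sum_mono2) auto
    finally have "c * (\<Sum>k\<in>S. (cmod (\<xi> k))\<^sup>2) \<le> c * (\<Sum>k\<in>insert 0 S. (cmod (\<zeta> k))\<^sup>2)" using c(1) by simp
    also have "\<dots> \<le> integral {a..b} (\<lambda>x. (cmod (trig_sum (insert 0 S) \<zeta> x))\<^sup>2)"
      using S by (intro c(2)) auto
    finally have "g0\<^sup>2 * (c * (\<Sum>k\<in>S. (cmod (\<xi> k))\<^sup>2)) \<le> g0\<^sup>2 * integral {a..b} (\<lambda>x. (cmod (trig_sum (insert 0 S) \<zeta> x))\<^sup>2)"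
      by (rule mult_left_mono) simp
    also have "\<dots> = integral {a..b} (\<lambda>x. g0\<^sup>2 * (cmod (trig_sum (insert 0 S) \<zeta> x))\<^sup>2)" by simp
    also have "\<dots> \<le> integral {a..b} (\<lambda>x. (cmod (G g ?\<psi> x))\<^sup>2)"
    proof (rule integral_le)
      show "(\<lambda>x. g0\<^sup>2 * (cmod (trig_sum (insert 0 S) \<zeta> x))\<^sup>2) integrable_on {a..b}"
        by (intro integrable_on_mult_right trig_sum_sq_integrable)
      fix x assume "x \<in> {a..b}"
      then have "g0\<^sup>2 \<le> \<bar>g x\<bar>\<^sup>2" using ab(4,5) by (intro power_mono) auto
      then show "g0\<^sup>2 * (cmod (trig_sum (insert 0 S) \<zeta> x))\<^sup>2 \<le> (cmod (G g ?\<psi> x))\<^sup>2"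
        unfolding shift G_eq norm_mult power_mult_distrib norm_of_real by (intro mult_right_mono) auto
    qed (rule Gi)
    also have "\<dots> \<le> integral {0..2 * pi} (\<lambda>x. (cmod (G g ?\<psi> x))\<^sup>2)"
      using ab by (intro integral_subset_le Gi) auto
    also have "\<dots> = integral\<^sup>L circ (\<lambda>x. (cmod (G g ?\<psi> x))\<^sup>2)"
      unfolding G_eq by (rule circ_continuous(2)[symmetric]) (intro continuous_intros g_continuous)
    finally show ?thesis unfolding matrix_quadratic_form[OF S(1)]
      by (simp add: pos_le_divide_eq mult_ac)
  qed
  moreover have "0 < g0\<^sup>2 * c / (2 * pi)" using ab(4) c(1) by simp
  ultimately show ?thesis by blast
qed

lemma matrix_row_zero: "matrix 0 l = 0"
proof -
  let ?u = "G g (ex l)"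
  have u: "integrable circ ?u" by (intro integrable_G circ_continuous(1) continuous_on_ex)
  have "integral\<^sup>L circ (G g ?u) = integral\<^sup>L circ (\<lambda>x. gc x * ?u x - avg ?u * gc x)"
    unfolding G_eq[of ?u] by (intro Bochner_Integration.integral_cong) (auto simp: algebra_simps)
  also have "\<dots> = avg ?u - avg ?u * integral\<^sup>L circ gc"
    using integrable_gc_mult[OF u] L2_integrable[OF gc_L2]
    by (subst Bochner_Integration.integral_diff) (auto simp: avg_def)
  finally have "integral\<^sup>L circ (G g ?u) = 0" unfolding integral_gc by simp
  then show ?thesis by (simp add: matrix_def fc_def)
qed

lemma matrix_column_zero: "matrix k 0 = 0"
proof -
  have "avg (ex 0) = 1" using integral_gc by (simp add: avg_def)
  then have "G g (ex 0) = (\<lambda>x. 0)" by (simp add: G_eq)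
  then have "G g (G g (ex 0)) = (\<lambda>x. 0)" by (simp add: G_eq avg_def)
  then show ?thesis by (simp add: matrix_def fc_def)
qed

lemma avg_ex: "avg (ex l) = 2 * pi * fc gc (- l)"
  by (simp add: avg_def fc_def)

text \<open>Multiplication by \<open>g\<^sup>2\<close>, whose matrix is constant along diagonals, up to two operators of rank one with smooth ranges.\<close>

lemma matrix_formula:
  "matrix k l = fc (\<lambda>x. gc x * gc x) (k - l) - 2 * pi * fc gc (- l) * fc (\<lambda>x. gc x * gc x) k
     - avg (G g (ex l)) * fc gc k"
proof -
  have "G g (G g (ex l)) = (\<lambda>x. ((gc x * gc x) * ex l x - avg (ex l) * (gc x * gc x)) - avg (G g (ex l)) * gc x)"
    unfolding G_eq[of "G g (ex l)"] by (simp add: G_eq algebra_simps)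
  moreover have "integrable circ (\<lambda>x. gc x * gc x)" by (intro test_fun_integrable test_fun_mult test_fun_gc)
  ultimately show ?thesis
    by (simp add: matrix_def fc_diff integrable_mult_ex fc_mult_ex fc_cmult test_fun_integrable[OF test_fun_gc] avg_ex)
qed

lemma avg_G_ex: "avg (G g (ex l)) = 2 * pi * fc (\<lambda>x. gc x * gc x) (- l) - 2 * pi * fc gc (- l) * (2 * pi * fc (\<lambda>x. gc x * gc x) 0)"
proof -
  have i: "integrable circ (\<lambda>x. gc x * gc x)" by (intro test_fun_integrable test_fun_mult test_fun_gc)
  have "avg (G g (ex l)) = integral\<^sup>L circ (\<lambda>x. gc x * gc x * ex l x - avg (ex l) * (gc x * gc x))"
    unfolding avg_def[of "G g (ex l)"] by (intro Bochner_Integration.integral_cong) (auto simp: G_eq algebra_simps)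
  also have "\<dots> = integral\<^sup>L circ (\<lambda>x. gc x * gc x * ex l x) - avg (ex l) * integral\<^sup>L circ (\<lambda>x. gc x * gc x)"
    using i integrable_mult_ex[OF i] by (subst Bochner_Integration.integral_diff) auto
  finally show ?thesis by (simp add: avg_ex) (simp add: fc_def)
qed

text \<open>The rank-one terms decay in \<open>k\<close> and in \<open>l\<close> separately, and \<open>\<langle>k - l\<rangle> \<le> \<langle>k\<rangle> \<langle>l\<rangle>\<close>.\<close>

lemma matrix_rapid: "\<exists>C\<ge>0. \<forall>k l. cmod (matrix k l) \<le> C / bracket (k - l) ^ n"
proof -
  let ?H = "fc (\<lambda>x. gc x * gc x)"
  have tH: "test_fun (\<lambda>x. gc x * gc x)" by (intro test_fun_mult test_fun_gc)
  obtain A where A: "A \<ge> 0" "\<And>k. cmod (fc gc k) \<le> A / bracket k ^ n" using fc_rapid[OF test_fun_gc] by blast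
  obtain B where B: "B \<ge> 0" "\<And>k. cmod (?H k) \<le> B / bracket k ^ n" using fc_rapid[OF tH] by blast
  define D where "D = 2 * pi * B + 2 * pi * A * (2 * pi * cmod (?H 0))"
  have D: "0 \<le> D" using A B by (simp add: D_def)
  have prod: "u / bracket k ^ n * (v / bracket l ^ n) \<le> u * v / bracket (k - l) ^ n" if "0 \<le> u" "0 \<le> v" for u v k l
  proof -
    have "bracket (k - l) ^ n \<le> (bracket k * bracket l) ^ n"
      using bracket_triangle[of k "- l"] by (intro power_mono) auto
    then have "u * v / (bracket k * bracket l) ^ n \<le> u * v / bracket (k - l) ^ n"
      using that by (intro divide_left_mono) auto
    then show ?thesis by (simp add: power_mult_distrib)
  qed
  have avgb: "cmod (avg (G g (ex l))) \<le> D / bracket l ^ n" for l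
  proof -
    have "cmod (avg (G g (ex l))) \<le> 2 * pi * cmod (?H (- l)) + 2 * pi * cmod (fc gc (- l)) * (2 * pi * cmod (?H 0))"
      unfolding avg_G_ex by (rule order_trans[OF norm_triangle_ineq4]) (simp add: norm_mult)
    also have "\<dots> \<le> 2 * pi * (B / bracket l ^ n) + 2 * pi * (A / bracket l ^ n) * (2 * pi * cmod (?H 0))"
      using A(2)[of "- l"] B(2)[of "- l"] by (intro add_mono mult_left_mono mult_right_mono) auto
    also have "\<dots> = D / bracket l ^ n" by (simp add: D_def add_divide_distrib)
    finally show ?thesis .
  qed
  have "cmod (matrix k l) \<le> (B + 2 * pi * (B * A) + A * D) / bracket (k - l) ^ n" for k l
  proof -
    have "cmod (matrix k l) \<le> cmod (?H (k - l)) + cmod (2 * pi * fc gc (- l) * ?H k) + cmod (avg (G g (ex l)) * fc gc k)"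
      unfolding matrix_formula
      by (intro order_trans[OF norm_triangle_ineq4] add_mono order_refl)
    also have "\<dots> = cmod (?H (k - l)) + 2 * pi * (cmod (?H k) * cmod (fc gc (- l))) + cmod (fc gc k) * cmod (avg (G g (ex l)))"
      by (simp add: norm_mult)
    also have "\<dots> \<le> B / bracket (k - l) ^ n + 2 * pi * (B / bracket k ^ n * (A / bracket l ^ n)) + A / bracket k ^ n * (D / bracket l ^ n)"
      using A(2)[of "- l"] by (intro add_mono mult_left_mono mult_mono A B avgb) (auto simp: A B)
    also have "\<dots> \<le> B / bracket (k - l) ^ n + 2 * pi * (B * A / bracket (k - l) ^ n) + A * D / bracket (k - l) ^ n"
      by (intro add_mono mult_left_mono prod A B D order_refl) auto
    finally show ?thesis by (simp add: add_divide_distrib)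
  qed
  moreover have "0 \<le> B + 2 * pi * (B * A) + A * D" using A(1) B(1) D by simp
  ultimately show ?thesis by blast
qed

lemma damping_exists: "\<exists>c0 C1. damping matrix c0 C1"
proof -
  obtain c0 where c0: "c0 > 0" "\<forall>S \<xi>. finite S \<longrightarrow> 0 \<notin> S \<longrightarrow> card S \<le> 6 \<longrightarrow>
     c0 * (\<Sum>k\<in>S. (cmod (\<xi> k))\<^sup>2) \<le> (\<Sum>k\<in>S. \<Sum>l\<in>S. Re (matrix k l * \<xi> l * cnj (\<xi> k)))"
    using matrix_coercive[of 6] by blast
  obtain C1 where C1: "C1 > 0" "\<forall>S F \<xi>. finite S \<longrightarrow> finite F \<longrightarrow>
     (\<Sum>k\<in>F. (cmod (\<Sum>l\<in>S. matrix k l * \<xi> l))\<^sup>2) \<le> C1 * (\<Sum>k\<in>S. \<Sum>l\<in>S. Re (matrix k l * \<xi> l * cnj (\<xi> k)))"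
    using matrix_square_le by blast
  have "damping matrix c0 C1"
  proof
    show "\<exists>C\<ge>0. \<forall>k l. cmod (matrix k l) \<le> C / bracket (k - l) ^ n" for n by (rule matrix_rapid)
  qed (use c0 C1 matrix_row_zero matrix_column_zero in auto)
  then show ?thesis by blast
qed

end

section \<open>Sobolev distributions as square-summable sequences\<close>

text \<open>The factor \<open>sqrt (2 \<pi>)\<close> makes this an isometry. A relation, rather than a function from distributions, applies to Riemann
sums of distributions directly, as it looks at Fourier coefficients only.\<close>

definition represents :: "real \<Rightarrow> functional \<Rightarrow> ell2 \<Rightarrow> bool" where
  "represents s T x \<longleftrightarrow> (\<forall>k. coord x k = of_real (sqrt (2 * pi) * sobolev_weight s k) * fcoeff T k)"

lemma represents_fcoeff: "represents s T x \<Longrightarrow> fcoeff T k = coord x k / of_real (sqrt (2 * pi) * sobolev_weight s k)"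
  by (simp add: represents_def)

lemma represents_unique: "represents s T x \<Longrightarrow> represents s T y \<Longrightarrow> x = y"
  by (rule ell2_eqI) (simp add: represents_def)

lemma fcoeff_diff: "fcoeff (T - S) k = fcoeff T k - fcoeff S k"
  by (simp add: fcoeff_def diff_divide_distrib)

lemma represents_diff: "represents s T x \<Longrightarrow> represents s S y \<Longrightarrow> represents s (T - S) (x - y)"
  by (simp add: represents_def fcoeff_diff right_diff_distrib)

lemma represents_norm_sq:
  assumes "represents s T x"
  shows "(cmod (coord x k))\<^sup>2 = 2 * pi * ((1 + \<bar>real_of_int k\<bar>\<^sup>2) powr s * (cmod (fcoeff T k))\<^sup>2)"
proof -
  have "cmod (coord x k) = sqrt (2 * pi) * sobolev_weight s k * cmod (fcoeff T k)"
    using assms by (simp add: represents_def norm_mult)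
  then show ?thesis by (simp add: power_mult_distrib sobolev_weight_sq mult.assoc)
qed

lemma Hs_norm_represents:
  assumes "represents s T x"
  shows "Hs_norm s T = norm x"
proof -
  have "(norm x)\<^sup>2 = (\<Sum>\<^sub>\<infinity>k. 2 * pi * ((1 + \<bar>real_of_int k\<bar>\<^sup>2) powr s * (cmod (fcoeff T k))\<^sup>2))"
    unfolding norm_ell2_sq represents_norm_sq[OF assms] ..
  also have "\<dots> = 2 * pi * (\<Sum>\<^sub>\<infinity>k. (1 + \<bar>real_of_int k\<bar>\<^sup>2) powr s * (cmod (fcoeff T k))\<^sup>2)"
    by (rule infsum_cmult_right')
  finally show ?thesis unfolding Hs_norm_def by (metis norm_ge_zero real_sqrt_unique)
qed

lemma Hs_iff_represents: "T \<in> Hs s \<longleftrightarrow> periodic_distribution T \<and> (\<exists>x. represents s T x)"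
proof (intro iffI conjI)
  assume T: "T \<in> Hs s"
  then show "periodic_distribution T" by (simp add: Hs_def)
  let ?f = "\<lambda>k. of_real (sqrt (2 * pi) * sobolev_weight s k) * fcoeff T k"
  have "(cmod (?f k))\<^sup>2 = 2 * pi * ((1 + \<bar>real_of_int k\<bar>\<^sup>2) powr s * (cmod (fcoeff T k))\<^sup>2)" for k
    by (simp add: norm_mult power_mult_distrib sobolev_weight_sq mult.assoc)
  moreover have "(\<lambda>k. 2 * pi * ((1 + \<bar>real_of_int k\<bar>\<^sup>2) powr s * (cmod (fcoeff T k))\<^sup>2)) summable_on UNIV"
    using T by (intro summable_on_cmult_right) (simp add: Hs_def)
  ultimately have "(\<lambda>k. (cmod (?f k))\<^sup>2) summable_on UNIV" by simp
  then have "represents s T (Abs_ell2 ?f)" by (simp add: represents_def coord_Abs_ell2)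
  then show "\<exists>x. represents s T x" by blast
next
  assume a: "periodic_distribution T \<and> (\<exists>x. represents s T x)"
  then obtain x where x: "represents s T x" by blast
  have "(\<lambda>k. (1 / (2 * pi)) * (cmod (coord x k))\<^sup>2) summable_on UNIV"
    by (intro summable_on_cmult_right coord_summable)
  then show "T \<in> Hs s" using a by (simp add: Hs_def represents_norm_sq[OF x])
qed

lemma represents_eqI:
  "periodic_distribution S \<Longrightarrow> periodic_distribution T \<Longrightarrow> represents s S x \<Longrightarrow> represents s T x \<Longrightarrow> S = T"
  by (rule distribution_eqI) (simp_all add: represents_fcoeff)

lemma exists_L2_representative:
  assumes s: "0 \<le> s"
  obtains f where "f \<in> L2" "represents s (distr_of f) x" "periodic_distribution (distr_of f)"
proof -
  define c where "c = (\<lambda>k. coord (weight_down s x) k / of_real (sqrt (2 * pi)))"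
  have "(\<lambda>k. (1 / (2 * pi)) * (cmod (coord (weight_down s x) k))\<^sup>2) summable_on UNIV"
    by (intro summable_on_cmult_right coord_summable)
  then have "(\<lambda>k. (cmod (c k))\<^sup>2) summable_on UNIV"
    by (simp add: c_def norm_divide power_divide del: coord_weight_down)
  from riesz_fischer[OF this] obtain f where f: "f \<in> L2" "\<And>k. fc f k = c k" by blast
  have "represents s (distr_of f) x"
    using s by (simp add: represents_def fcoeff_distr_of f(2) c_def)
  then show thesis using that f(1) periodic_distribution_distr_of[OF L2_integrable[OF f(1)]] by blast
qed

definition distribution_of :: "real \<Rightarrow> ell2 \<Rightarrow> functional" where
  "distribution_of s x = (SOME T. periodic_distribution T \<and> represents s T x)"

lemma distribution_of:
  assumes "0 \<le> s"
  shows "periodic_distribution (distribution_of s x)" "represents s (distribution_of s x) x"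
proof -
  have "\<exists>T. periodic_distribution T \<and> represents s T x" using exists_L2_representative[OF assms] by metis
  from someI_ex[OF this] show "periodic_distribution (distribution_of s x)" "represents s (distribution_of s x) x"
    unfolding distribution_of_def by auto
qed

lemma distribution_of_Hs: "0 \<le> s \<Longrightarrow> distribution_of s x \<in> Hs s"
  using distribution_of Hs_iff_represents by blast

lemma periodic_distribution_diff:
  assumes S: "periodic_distribution S" and T: "periodic_distribution T"
  shows "periodic_distribution (S - T)"
  unfolding periodic_distribution_def
proof (intro conjI allI impI)
  obtain C N where C: "\<And>\<phi>. test_fun \<phi> \<Longrightarrow> cmod (S \<phi>) \<le> C * (\<Sum>n\<le>(N::nat). SUP x\<in>{0..2 * pi}. cmod (nderiv n \<phi> x))"
    using S unfolding periodic_distribution_def by blast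
  obtain D L where D: "\<And>\<phi>. test_fun \<phi> \<Longrightarrow> cmod (T \<phi>) \<le> D * (\<Sum>n\<le>(L::nat). SUP x\<in>{0..2 * pi}. cmod (nderiv n \<phi> x))"
    using T unfolding periodic_distribution_def by blast
  have "cmod ((S - T) \<phi>) \<le> (\<bar>C\<bar> + \<bar>D\<bar>) * (\<Sum>n\<le>max N L. SUP x\<in>{0..2 * pi}. cmod (nderiv n \<phi> x))"
    if \<phi>: "test_fun \<phi>" for \<phi>
  proof -
    let ?p = "\<lambda>n. SUP x\<in>{0..2 * pi}. cmod (nderiv n \<phi> x)"
    have p0: "0 \<le> ?p n" for n
    proof -
      obtain M where "\<And>x. cmod (nderiv n \<phi> x) \<le> M" using test_fun_bounded[OF test_fun_nderiv[OF \<phi>]] by blast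
      then have "bdd_above ((\<lambda>x. cmod (nderiv n \<phi> x)) ` {0..2 * pi})" by (intro bdd_aboveI2)
      then show ?thesis by (rule cSUP_upper2[where x = 0]) auto
    qed
    have m: "(\<Sum>n\<le>N. ?p n) \<le> (\<Sum>n\<le>max N L. ?p n)" "(\<Sum>n\<le>L. ?p n) \<le> (\<Sum>n\<le>max N L. ?p n)"
      by (intro sum_mono2; use p0 in auto)+
    have nn: "0 \<le> (\<Sum>n\<le>N. ?p n)" "0 \<le> (\<Sum>n\<le>L. ?p n)" using p0 by (auto intro: sum_nonneg)
    have "cmod (S \<phi>) \<le> \<bar>C\<bar> * (\<Sum>n\<le>max N L. ?p n)"
      by (rule order_trans[OF C[OF \<phi>] mult_mono]) (use m nn in auto)
    moreover have "cmod (T \<phi>) \<le> \<bar>D\<bar> * (\<Sum>n\<le>max N L. ?p n)"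
      by (rule order_trans[OF D[OF \<phi>] mult_mono]) (use m nn in auto)
    ultimately show ?thesis
      using norm_triangle_ineq4[of "S \<phi>" "T \<phi>"] by (simp add: distrib_right)
  qed
  then show "\<exists>C N. \<forall>\<phi>. test_fun \<phi> \<longrightarrow> cmod ((S - T) \<phi>) \<le> C * (\<Sum>n\<le>N. SUP x\<in>{0..2 * pi}. cmod (nderiv n \<phi> x))"
    by blast
qed (use S T in \<open>auto simp: periodic_distribution_def algebra_simps\<close>)

text \<open>Taking coordinates is linear and isometric, so Riemann sums correspond to Riemann sums and the two integrals have the same
definition.\<close>

lemma has_Hs_integral_iff:
  assumes F: "\<And>t. t \<in> {a..b} \<Longrightarrow> represents s (F t) (w t)" and I: "represents s I J"
  shows "has_Hs_integral s F I a b \<longleftrightarrow> I \<in> Hs s \<and> (\<forall>t\<in>{a..b}. F t \<in> Hs s) \<and> (w has_integral J) {a..b}"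
proof -
  have eq: "Hs_norm s (\<lambda>\<phi>. (\<Sum>(t,K)\<in>\<D>. measure lborel K *\<^sub>R F t \<phi>) - I \<phi>)
      = norm ((\<Sum>(t,K)\<in>\<D>. measure lborel K *\<^sub>R w t) - J)" if D: "\<D> tagged_division_of {a..b}" for \<D>
  proof (rule Hs_norm_represents)
    have fin: "finite \<D>" using D by blast
    have tags: "t \<in> {a..b}" if "(t, K) \<in> \<D>" for t K using tagged_division_ofD(2,3)[OF D that] by blast
    have cs: "coord (\<Sum>p\<in>A. h p) k = (\<Sum>p\<in>A. coord (h p) k)" if "finite A" for A and h :: "real \<times> real set \<Rightarrow> ell2" and k
      using that by (induction A rule: finite_induct) auto
    show "represents s (\<lambda>\<phi>. (\<Sum>(t,K)\<in>\<D>. measure lborel K *\<^sub>R F t \<phi>) - I \<phi>) ((\<Sum>(t,K)\<in>\<D>. measure lborel K *\<^sub>R w t) - J)"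
      unfolding represents_def
    proof
      fix k
      let ?c = "complex_of_real (sqrt (2 * pi) * sobolev_weight s k)"
      have "coord ((\<Sum>(t,K)\<in>\<D>. measure lborel K *\<^sub>R w t) - J) k
         = (\<Sum>p\<in>\<D>. coord (case p of (t, K) \<Rightarrow> measure lborel K *\<^sub>R w t) k) - coord J k"
        by (simp add: cs[OF fin])
      also have "(\<Sum>p\<in>\<D>. coord (case p of (t, K) \<Rightarrow> measure lborel K *\<^sub>R w t) k)
         = (\<Sum>p\<in>\<D>. ?c * (case p of (t, K) \<Rightarrow> measure lborel K *\<^sub>R fcoeff (F t) k))"
      proof (rule sum.cong[OF refl])
        fix p assume p: "p \<in> \<D>"
        obtain t K where tK: "p = (t, K)" by (cases p)
        then show "coord (case p of (t, K) \<Rightarrow> measure lborel K *\<^sub>R w t) k = ?c * (case p of (t, K) \<Rightarrow> measure lborel K *\<^sub>R fcoeff (F t) k)"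
          using F[OF tags[of t K]] p by (simp add: represents_def)
      qed
      also have "coord J k = ?c * fcoeff I k" using I by (simp add: represents_def)
      finally have "coord ((\<Sum>(t,K)\<in>\<D>. measure lborel K *\<^sub>R w t) - J) k
        = ?c * ((\<Sum>p\<in>\<D>. case p of (t, K) \<Rightarrow> measure lborel K *\<^sub>R fcoeff (F t) k) - fcoeff I k)"
        by (simp add: sum_distrib_left right_diff_distrib)
      also have "(\<Sum>p\<in>\<D>. case p of (t, K) \<Rightarrow> measure lborel K *\<^sub>R fcoeff (F t) k) - fcoeff I k
         = fcoeff (\<lambda>\<phi>. (\<Sum>(t,K)\<in>\<D>. measure lborel K *\<^sub>R F t \<phi>) - I \<phi>) k"
        by (simp add: fcoeff_def diff_divide_distrib sum_divide_distrib case_prod_unfold scaleR_conv_of_real)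
      finally show "coord ((\<Sum>(t,K)\<in>\<D>. measure lborel K *\<^sub>R w t) - J) k
        = ?c * fcoeff (\<lambda>\<phi>. (\<Sum>(t,K)\<in>\<D>. measure lborel K *\<^sub>R F t \<phi>) - I \<phi>) k" .
    qed
  qed
  have "(w has_integral J) {a..b} \<longleftrightarrow> (\<forall>e>0. \<exists>\<gamma>. gauge \<gamma> \<and>
      (\<forall>\<D>. \<D> tagged_division_of {a..b} \<and> \<gamma> fine \<D> \<longrightarrow> norm ((\<Sum>(t,K)\<in>\<D>. measure lborel K *\<^sub>R w t) - J) < e))"
    using has_integral[of w J a b] by simp
  also have "\<dots> \<longleftrightarrow> (\<forall>e>0. \<exists>\<gamma>. gauge \<gamma> \<and> (\<forall>\<D>. \<D> tagged_division_of {a..b} \<and> \<gamma> fine \<D> \<longrightarrow>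
           Hs_norm s (\<lambda>\<phi>. (\<Sum>(t,K)\<in>\<D>. measure lborel K *\<^sub>R F t \<phi>) - I \<phi>) < e))"
    using eq by (simp cong: conj_cong imp_cong)
  finally show ?thesis unfolding has_Hs_integral_def by blast
qed

text \<open>The multiplier problem has a solution because phases preserve square-summability, and only one because coefficients determine a
distribution.\<close>

lemma represents_U:
  assumes s: "0 \<le> s" and T: "represents s T x"
  shows "periodic_distribution (U \<alpha> t T)" "represents s (U \<alpha> t T) (phase (\<lambda>k. t * dispersion \<alpha> k) x)"
proof -
  let ?y = "phase (\<lambda>k. t * dispersion \<alpha> k) x"
  let ?m = "\<lambda>k. exp (\<i> * of_real ((real_of_int k)\<^sup>2 * (\<alpha> * sgn (real_of_int k) - real_of_int k) * t))"
  have m: "?m k = cis (t * dispersion \<alpha> k)" for k by (simp add: cis_conv_exp dispersion_def mult_ac)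
  define S where "S = distribution_of s ?y"
  have S: "periodic_distribution S" "represents s S ?y" using distribution_of[OF s] by (auto simp: S_def)
  have f: "fcoeff S k = ?m k * fcoeff T k" for k
    unfolding m represents_fcoeff[OF S(2)] represents_fcoeff[OF T] by simp
  have "U \<alpha> t T = S" unfolding U_def fourier_multiplier_def
  proof (rule the_equality)
    show "periodic_distribution S \<and> (\<forall>k. fcoeff S k = ?m k * fcoeff T k)" using S f by blast
    fix R assume "periodic_distribution R \<and> (\<forall>k. fcoeff R k = ?m k * fcoeff T k)"
    then show "R = S" using f S(1) by (intro distribution_eqI) auto
  qed
  then show "periodic_distribution (U \<alpha> t T)" "represents s (U \<alpha> t T) ?y" using S by auto
qed

lemma represents_const_distr:
  assumes "represents s T x" "coord x 0 = of_real (sqrt (2 * pi)) * c"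
  shows "represents s (T - const_distr c) (trunc (- {0}) x)"
  unfolding represents_def
proof
  fix k
  show "coord (trunc (- {0}) x) k = of_real (sqrt (2 * pi) * sobolev_weight s k) * fcoeff (T - const_distr c) k"
    using assms by (cases "k = 0") (auto simp: represents_def fcoeff_diff const_distr_def fcoeff_distr_of fc_const)
qed

section \<open>The feedback operator on distributions\<close>

context control
begin

lemma avg_cnj: "avg (\<lambda>x. cnj (f x)) = cnj (avg f)"
  unfolding avg_def using Bochner_Integration.integral_cnj[of circ "\<lambda>x. gc x * f x"] by simp

lemma G_cnj: "G g (\<lambda>x. cnj (f x)) = (\<lambda>x. cnj (G g f x))"
  by (simp add: G_eq avg_cnj)

lemma G_symmetric:
  assumes "f \<in> L2" "h \<in> L2"
  shows "integral\<^sup>L circ (\<lambda>x. G g f x * h x) = integral\<^sup>L circ (\<lambda>x. f x * G g h x)"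
  using G_self_adjoint[OF assms(1) L2_cnj[OF assms(2)]] by (simp add: G_cnj)

lemma matrix_symmetric: "matrix (- l) (- k) = matrix k l"
proof -
  have e: "ex j \<in> L2" for j by (rule test_fun_L2[OF test_fun_ex])
  have "integral\<^sup>L circ (\<lambda>x. G g (G g (ex (- k))) x * ex l x) = integral\<^sup>L circ (\<lambda>x. G g (ex (- k)) x * G g (ex l) x)"
    by (intro G_symmetric G_L2 e)
  also have "\<dots> = integral\<^sup>L circ (\<lambda>x. ex (- k) x * G g (G g (ex l)) x)" by (intro G_symmetric G_L2 e)
  finally show ?thesis by (simp add: matrix_def fc_def mult.commute)
qed

text \<open>The adjoint is a choice among functions that agree almost everywhere. It is characterised by its integrals against
square-integrable functions, and \<open>G\<close> is real and symmetric.\<close>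

lemma L2_adjoint_G:
  assumes f: "f \<in> L2"
  shows "L2_adjoint (G g) f \<in> L2"
    "\<And>h. h \<in> L2 \<Longrightarrow> integral\<^sup>L circ (\<lambda>x. h x * L2_adjoint (G g) f x) = integral\<^sup>L circ (\<lambda>x. G g h x * f x)"
proof -
  let ?P = "\<lambda>\<eta>. \<eta> \<in> L2 \<and> (\<forall>\<phi>\<in>L2. L2_inner (G g \<phi>) f = L2_inner \<phi> \<eta>)"
  have "?P (G g f)" using G_L2[OF f] G_self_adjoint[OF _ f] by (simp add: L2_inner_def circ_integral)
  then have P: "?P (L2_adjoint (G g) f)" unfolding L2_adjoint_def by (rule someI[of ?P])
  then show "L2_adjoint (G g) f \<in> L2" by blast
  fix h assume h: "h \<in> L2"
  have "integral\<^sup>L circ (\<lambda>x. G g (\<lambda>x. cnj (h x)) x * cnj (f x)) = integral\<^sup>L circ (\<lambda>x. cnj (h x) * cnj (L2_adjoint (G g) f x))"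
    using P L2_cnj[OF h] by (auto simp: L2_inner_def circ_integral)
  then have "cnj (integral\<^sup>L circ (\<lambda>x. G g h x * f x)) = cnj (integral\<^sup>L circ (\<lambda>x. h x * L2_adjoint (G g) f x))"
    unfolding G_cnj Bochner_Integration.integral_cnj[symmetric] by (simp only: complex_cnj_mult)
  then show "integral\<^sup>L circ (\<lambda>x. h x * L2_adjoint (G g) f x) = integral\<^sup>L circ (\<lambda>x. G g h x * f x)" by simp
qed

text \<open>Moving both operators onto the exponential leaves a test function, on which the distribution is evaluated by the Fourier expansion;
neither the chosen representative nor the chosen adjoint matters.\<close>

lemma GGstar_coefficients:
  assumes f: "f \<in> L2" and T: "periodic_distribution T" "T = distr_of f"
  shows "periodic_distribution (GGstar g T)" "fcoeff (GGstar g T) k = (\<Sum>\<^sub>\<infinity>l. matrix k l * fcoeff T l)"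
proof -
  define f' where "f' = (SOME f. f \<in> L2 \<and> T = distr_of f)"
  have f': "f' \<in> L2" "T = distr_of f'" 
    using someI[of "\<lambda>f. f \<in> L2 \<and> T = distr_of f" f] f T(2) by (auto simp: f'_def)
  define \<eta> where "\<eta> = L2_adjoint (G g) f'"
  have \<eta>: "\<eta> \<in> L2" "\<And>h. h \<in> L2 \<Longrightarrow> integral\<^sup>L circ (\<lambda>x. h x * \<eta> x) = integral\<^sup>L circ (\<lambda>x. G g h x * f' x)"
    unfolding \<eta>_def by (rule L2_adjoint_G[OF f'(1)])+
  have GG: "GGstar g T = distr_of (G g \<eta>)" by (simp add: GGstar_def on_distr_def f'_def \<eta>_def)
  show "periodic_distribution (GGstar g T)" unfolding GG by (intro periodic_distribution_distr_of L2_integrable G_L2 \<eta>)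
  have e: "ex j \<in> L2" for j by (rule test_fun_L2[OF test_fun_ex])
  let ?\<psi> = "G g (G g (ex (- k)))"
  have "2 * pi * fcoeff (GGstar g T) k = integral\<^sup>L circ (\<lambda>x. G g \<eta> x * ex (- k) x)"
    by (simp add: GG fcoeff_distr_of fc_def)
  also have "\<dots> = integral\<^sup>L circ (\<lambda>x. \<eta> x * G g (ex (- k)) x)" by (rule G_symmetric[OF \<eta>(1) e])
  also have "\<dots> = integral\<^sup>L circ (\<lambda>x. G g (ex (- k)) x * \<eta> x)" by (simp only: mult.commute)
  also have "\<dots> = integral\<^sup>L circ (\<lambda>x. ?\<psi> x * f' x)" by (intro \<eta>(2) G_L2 e)
  also have "\<dots> = T ?\<psi>"
    using test_fun_G[OF test_fun_G[OF test_fun_ex]] by (simp add: f'(2) distr_of_circ mult.commute)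
  finally have k: "2 * pi * fcoeff (GGstar g T) k = T ?\<psi>" .
  have "((\<lambda>l. fc ?\<psi> l * T (ex l)) has_sum T ?\<psi>) UNIV"
    by (intro distribution_expansion T test_fun_G test_fun_ex)
  then have "((\<lambda>l. fc ?\<psi> (- l) * T (ex (- l))) has_sum T ?\<psi>) UNIV"
    by (subst has_sum_reindex_bij_betw[of uminus UNIV UNIV, where f = "\<lambda>l. fc ?\<psi> l * T (ex l)"]) (auto simp: bij_uminus)
  moreover have "fc ?\<psi> (- l) * T (ex (- l)) = 2 * pi * (matrix k l * fcoeff T l)" for l
    using matrix_symmetric[of l k] by (simp add: matrix_def fcoeff_ex)
  ultimately have "((\<lambda>l. 2 * pi * (matrix k l * fcoeff T l)) has_sum T ?\<psi>) UNIV" by simp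
  then have "T ?\<psi> = (\<Sum>\<^sub>\<infinity>l. 2 * pi * (matrix k l * fcoeff T l))" by (rule infsumI[symmetric])
  also have "\<dots> = 2 * pi * (\<Sum>\<^sub>\<infinity>l. matrix k l * fcoeff T l)" by (rule infsum_cmult_right')
  finally have "T ?\<psi> = 2 * pi * (\<Sum>\<^sub>\<infinity>l. matrix k l * fcoeff T l)" .
  then show "fcoeff (GGstar g T) k = (\<Sum>\<^sub>\<infinity>l. matrix k l * fcoeff T l)" using k by simp
qed

end

section \<open>Decay of the closed loop\<close>

locale damped_control = control g + damping "control.matrix g" c0 C1 for g c0 C1
begin

lemma represents_GGstar:
  assumes s: "0 \<le> s" and T: "periodic_distribution T" "represents s T x"
  shows "periodic_distribution (GGstar g T)" "represents s (GGstar g T) (mat_app (weighted s) x)"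
proof -
  obtain f where f: "f \<in> L2" "represents s (distr_of f) x" "periodic_distribution (distr_of f)"
    by (rule exists_L2_representative[OF s])
  have Tf: "T = distr_of f" by (rule represents_eqI[OF T(1) f(3) T(2) f(2)])
  note GG = GGstar_coefficients[OF f(1) T(1) Tf]
  show "periodic_distribution (GGstar g T)" by (rule GG(1))
  obtain C where C: "offdiag C (weighted s)" using offdiag_weighted[OF s] by blast
  show "represents s (GGstar g T) (mat_app (weighted s) x)" unfolding represents_def
  proof
    fix k
    have "coord (mat_app (weighted s) x) k
        = (\<Sum>\<^sub>\<infinity>l. of_real (sqrt (2 * pi) * sobolev_weight s k) * (matrix k l * fcoeff T l))"
      unfolding coord_mat_app[OF C] using T(2)
      by (intro infsum_cong) (simp add: weighted_def represents_def)
    also have "\<dots> = of_real (sqrt (2 * pi) * sobolev_weight s k) * fcoeff (GGstar g T) k"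
      unfolding GG(2) by (rule infsum_cmult_right')
    finally show "coord (mat_app (weighted s) x) k = of_real (sqrt (2 * pi) * sobolev_weight s k) * fcoeff (GGstar g T) k" .
  qed
qed

lemma mild_solution_of_mild:
  assumes s: "0 \<le> s" and u0: "represents s u0 z0" and z: "mild \<alpha> s z0 z"
  shows "mild_solution \<alpha> g s u0 (\<lambda>t. distribution_of s (z t))"
  unfolding mild_solution_def Hs_continuous_def
proof (intro conjI allI impI)
  let ?u = "\<lambda>t. distribution_of s (z t)"
  note d = distribution_of[OF s]
  show "?u t \<in> Hs s" for t by (rule distribution_of_Hs[OF s])
  fix t :: real assume t: "0 \<le> t"
  have "((\<lambda>r. z r - z t) \<longlongrightarrow> 0) (at t within {0..})"
    using z t by (auto simp: mild_def continuous_on_def intro: LIM_zero)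
  then show "((\<lambda>r. Hs_norm s (?u r - ?u t)) \<longlongrightarrow> 0) (at t within {0..})"
    using Hs_norm_represents[OF represents_diff[OF d(2) d(2)]] by (simp add: tendsto_norm_zero)
  obtain J where J: "((\<lambda>r. flow \<alpha> (t - r) (mat_app (weighted s) (z r))) has_integral J) {0..t}"
    "z t = flow \<alpha> t z0 - J" using z t by (auto simp: mild_def)
  have F: "periodic_distribution (U \<alpha> (t - r) (GGstar g (?u r)))"
    "represents s (U \<alpha> (t - r) (GGstar g (?u r))) (flow \<alpha> (t - r) (mat_app (weighted s) (z r)))" for r
    by (rule represents_U[OF s represents_GGstar(2)[OF s d]])+
  have "has_Hs_integral s (\<lambda>r. U \<alpha> (t - r) (GGstar g (?u r))) (distribution_of s J) 0 t"
    by (subst has_Hs_integral_iff[OF F(2) d(2)]) (use J F distribution_of_Hs[OF s] Hs_iff_represents in blast)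
  moreover have "?u t = U \<alpha> t u0 - distribution_of s J"
  proof (rule represents_eqI[OF d(1) _ d(2)])
    show "periodic_distribution (U \<alpha> t u0 - distribution_of s J)"
      by (intro periodic_distribution_diff represents_U(1)[OF s u0] d(1))
    show "represents s (U \<alpha> t u0 - distribution_of s J) (z t)"
      unfolding J(2) by (intro represents_diff represents_U(2)[OF s u0] d(2))
  qed
  ultimately show "\<exists>I. has_Hs_integral s (\<lambda>r. U \<alpha> (t - r) (GGstar g (?u r))) I 0 t \<and> ?u t = U \<alpha> t u0 - I" by blast
qed

lemma mild_of_mild_solution:
  assumes s: "0 \<le> s" and u0: "represents s u0 z0" and v: "mild_solution \<alpha> g s u0 v"
  obtains z where "mild \<alpha> s z0 z" "\<And>t. 0 \<le> t \<Longrightarrow> periodic_distribution (v t) \<and> represents s (v t) (z t)"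
proof -
  define z where "z = (\<lambda>t. SOME x. represents s (v t) x)"
  have vH: "v t \<in> Hs s" if "0 \<le> t" for t using v that by (simp add: mild_solution_def Hs_continuous_def)
  have z: "periodic_distribution (v t)" "represents s (v t) (z t)" if "0 \<le> t" for t
    using vH[OF that] by (auto simp: Hs_iff_represents z_def intro: someI_ex)
  have zc: "continuous_on {0..} z"
    unfolding continuous_on_def
  proof
    fix t :: real assume "t \<in> {0..}"
    then have t: "0 \<le> t" by simp
    have "((\<lambda>r. Hs_norm s (v r - v t)) \<longlongrightarrow> 0) (at t within {0..})"
      using v t by (simp add: mild_solution_def Hs_continuous_def)
    moreover have "\<forall>\<^sub>F r in at t within {0..}. Hs_norm s (v r - v t) = norm (z r - z t)"
      unfolding eventually_at_filter
      by (rule always_eventually) (auto intro!: Hs_norm_represents represents_diff z t)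
    ultimately have "((\<lambda>r. norm (z r - z t)) \<longlongrightarrow> 0) (at t within {0..})" by (rule Lim_transform_eventually)
    then have "((\<lambda>r. z r - z t) \<longlongrightarrow> 0) (at t within {0..})" by (rule tendsto_norm_zero_cancel)
    then show "(z \<longlongrightarrow> z t) (at t within {0..})" by (simp add: Lim_null[symmetric])
  qed
  have "mild \<alpha> s z0 z" unfolding mild_def
  proof (intro conjI allI impI zc)
    fix t :: real assume t: "0 \<le> t"
    then obtain I where I: "has_Hs_integral s (\<lambda>r. U \<alpha> (t - r) (GGstar g (v r))) I 0 t" "v t = U \<alpha> t u0 - I"
      using v by (auto simp: mild_solution_def)
    then have "I \<in> Hs s" by (simp add: has_Hs_integral_def)
    then obtain J where J: "represents s I J" by (auto simp: Hs_iff_represents)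
    have F: "represents s (U \<alpha> (t - r) (GGstar g (v r))) (flow \<alpha> (t - r) (mat_app (weighted s) (z r)))"
      if "r \<in> {0..t}" for r
      using that by (intro represents_U(2)[OF s] represents_GGstar(2)[OF s] z) auto
    have "((\<lambda>r. flow \<alpha> (t - r) (mat_app (weighted s) (z r))) has_integral J) {0..t}"
      using I(1) by (subst (asm) has_Hs_integral_iff[OF _ J]) (use F in auto)
    moreover have "z t = flow \<alpha> t z0 - J"
      by (rule represents_unique[OF z(2)[OF t]]) (unfold I(2), intro represents_diff represents_U(2)[OF s u0] J)
    ultimately show "\<exists>J. ((\<lambda>r. flow \<alpha> (t - r) (mat_app (weighted s) (z r))) has_integral J) {0..t} \<and> z t = flow \<alpha> t z0 - J"
      by blast
  qed
  then show thesis using that z by blast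
qed

lemma closed_loop_decay:
  assumes s: "0 \<le> s"
  shows "\<exists>M>0. \<forall>u0\<in>Hs s. \<exists>u. mild_solution \<alpha> g s u0 u \<and>
        (\<forall>v. mild_solution \<alpha> g s u0 v \<longrightarrow> (\<forall>t\<ge>0. v t = u t)) \<and>
        (\<forall>t\<ge>0. Hs_norm s (u t - const_distr (mean u0))
                  \<le> M * exp (- (decay_rate / 2) * t) * Hs_norm s (u0 - const_distr (mean u0)))"
proof -
  obtain M where M: "M > 0" "\<And>\<alpha> z0 z t. mild \<alpha> s z0 z \<Longrightarrow> 0 \<le> t \<Longrightarrow>
    norm (trunc (- {0}) (z t)) \<le> M * exp (- (decay_rate / 2) * t) * norm (trunc (- {0}) z0)"
    using mild_decay[OF s] by blast
  have "\<exists>u. mild_solution \<alpha> g s u0 u \<and>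
        (\<forall>v. mild_solution \<alpha> g s u0 v \<longrightarrow> (\<forall>t\<ge>0. v t = u t)) \<and>
        (\<forall>t\<ge>0. Hs_norm s (u t - const_distr (mean u0))
                  \<le> M * exp (- (decay_rate / 2) * t) * Hs_norm s (u0 - const_distr (mean u0)))"
    if u0: "u0 \<in> Hs s" for u0
  proof -
    obtain z0 where z0: "represents s u0 z0" using u0 by (auto simp: Hs_iff_represents)
    obtain z where z: "mild \<alpha> s z0 z" by (rule mild_exists[OF s])
    note d = distribution_of[OF s]
    let ?u = "\<lambda>t. distribution_of s (z t)"
    have c0: "coord z0 0 = of_real (sqrt (2 * pi)) * mean u0"
      using z0 by (simp add: represents_def mean_eq_fcoeff)
    show ?thesis
    proof (intro exI[of _ ?u] conjI allI impI)
      show "mild_solution \<alpha> g s u0 ?u" by (rule mild_solution_of_mild[OF s z0 z])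
      fix v t assume v: "mild_solution \<alpha> g s u0 v" and t: "0 \<le> (t::real)"
      obtain y where y: "mild \<alpha> s z0 y" "\<And>t. 0 \<le> t \<Longrightarrow> periodic_distribution (v t) \<and> represents s (v t) (y t)"
        using mild_of_mild_solution[OF s z0 v] by blast
      have "y t = z t" by (rule mild_unique[OF s y(1) z t])
      then show "v t = ?u t" using y(2)[OF t] represents_eqI[OF _ d(1) _ d(2)] by metis
    next
      fix t :: real assume t: "0 \<le> t"
      have "represents s (?u t - const_distr (mean u0)) (trunc (- {0}) (z t))"
        by (rule represents_const_distr[OF d(2)]) (simp only: mild_mean_conserved[OF s z t] c0)
      moreover have "represents s (u0 - const_distr (mean u0)) (trunc (- {0}) z0)"
        by (rule represents_const_distr[OF z0 c0])
      ultimately show "Hs_norm s (?u t - const_distr (mean u0))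
          \<le> M * exp (- (decay_rate / 2) * t) * Hs_norm s (u0 - const_distr (mean u0))"
        using M(2)[OF z t] by (simp only: Hs_norm_represents)
    qed
  qed
  then show ?thesis using M(1) by blast
qed

end

theorem theorem1p4:
  fixes g :: "real \<Rightarrow> real"
  assumes "smooth g"
    and "periodic g"
    and "\<And>x. g x \<ge> 0"
    and "(LBINT x:{0..2 * pi}. g x) = 1"
    and "open_arc {x. g x > 0}"
  shows "\<exists>\<gamma>>0. \<forall>\<alpha>>0. \<forall>s\<ge>0. \<exists>M>0. \<forall>u0\<in>Hs s.
    \<exists>u. mild_solution \<alpha> g s u0 u \<and>
        (\<forall>v. mild_solution \<alpha> g s u0 v \<longrightarrow> (\<forall>t\<ge>0. v t = u t)) \<and>
        (\<forall>t\<ge>0. Hs_norm s (u t - const_distr (mean u0))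
                  \<le> M * exp (- \<gamma> * t) * Hs_norm s (u0 - const_distr (mean u0)))"
proof -
  interpret control g by unfold_locales (rule assms)+
  obtain c0 C1 where "damping (control.matrix g) c0 C1" using damping_exists by blast
  then interpret damped_control g c0 C1 by (intro damped_control.intro control_axioms)
  show ?thesis
  proof (rule exI[of _ "decay_rate / 2"], intro conjI allI impI)
    show "0 < decay_rate / 2" using decay_rate_pos by simp
    fix \<alpha> s :: real assume "0 < \<alpha>" and s: "0 \<le> s"
    show "\<exists>M>0. \<forall>u0\<in>Hs s. \<exists>u. mild_solution \<alpha> g s u0 u \<and>
        (\<forall>v. mild_solution \<alpha> g s u0 v \<longrightarrow> (\<forall>t\<ge>0. v t = u t)) \<and>
        (\<forall>t\<ge>0. Hs_norm s (u t - const_distr (mean u0))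
                  \<le> M * exp (- (decay_rate / 2) * t) * Hs_norm s (u0 - const_distr (mean u0)))"
      by (rule closed_loop_decay[OF s])
  qed
qed

end
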